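(* Let $k\ge 1$ and $m\ge 2$ be integers, let $(H,\Phi)$ be a gluing data with parameters $k,m$, and let $\mathcal R=\mathcal R_{(H,\Phi)}:\mathcal G_k\to\mathcal G_k$ be the associated graph recursion operator. Let $G_0\in\mathcal G_k$ and define $G_{n+1}=\mathcal R(G_n)$ for $n\ge 0$. Suppose that (i) the maximal vertex degrees of the graphs $G_n$ are uniformly bounded in $n$, and (ii) the minimal graph distance between pairs of distinct labeled vertices in $G_n$ diverges to $\infty$ as $n\to\infty$. Then there exists an open set $U\subset\mathbb C$ containing $\mathbb R_{\ge 0}=[0,\infty)$ such that $Z_{G_n}(\lambda)\neq 0$ for all $\lambda\in U$ and all $n\ge 0$.
   Context: Graphs are finite and undirected; multiple edges are allowed, loops are not. The graph distance between two vertices is the length of a shortest path connecting them, or $\infty$ if there is none. The independence polynomial of a graph $G$ is $Z_G(\lambda)=\sum_I\lambda^{\#I}$, the sum over all independent sets $I\subset V(G)$ (sets of pairwise non-adjacent vertices). $\mathcal G_k$ is the set of graphs with $k$ distinct marked (labeled) vertices, labeled $1,\dots,k$. A hypergraph has a finite vertex set and a finite multiset of edges, each a nonempty subset of the vertex set. A gluing data with parameters $k,m$ is a pair $(H,\Phi)$, where $H$ is a hypergraph with $V(H)=\{1,\dots,m\}$ whose edges $e\in E(H)$ each carry a label $\ell(e)\in\{1,\dots,k\}$ such that, for each $j\in\{1,\dots,k\}$, the edges labeled $j$ form a partition of $V(H)$; and $\Phi:\{1,\dots,k\}\to E(H)$ is an injective map. The graph recursion $\mathcal R=\mathcal R_{(H,\Phi)}:\mathcal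 G_k\to\mathcal G_k$ is defined as follows. Given $G\in\mathcal G_k$, take $m$ disjoint copies $G(1),\dots,G(m)$ of $G$; for each edge $e=\{i_1,\dots,i_s\}\in E(H)$ identify the vertices labeled $\ell(e)$ in the copies $G(i_1),\dots,G(i_s)$ into one vertex; finally, assign $k$ new labels: label $j$ is given to the vertex corresponding to the edge $\Phi(j)$ (old labels are forgotten). The result is $\mathcal R(G)\in\mathcal G_k$. *)

theory Defs
  imports "HOL-Analysis.Analysis" "HOL-Library.Multiset" "HOL-Library.Disjoint_Sets"
begin

section \<open>Marked multigraphs\<close>

text \<open>The multiset \<open>edges\<close> collects the end point sets of the edges, so parallel edges are
  repeated elements. Only the values of \<open>mark\<close> at the labels \<open>1, \<dots>, k\<close> are meaningful.\<close>

record 'v marked_graph =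
  verts :: "'v set"
  edges :: "'v set multiset"
  mark :: "nat \<Rightarrow> 'v"

definition marked_graphs :: "nat \<Rightarrow> 'v marked_graph set" where
  "marked_graphs k = {G. finite (verts G) \<and>
     (\<forall>e \<in># edges G. e \<subseteq> verts G \<and> card e = 2) \<and>
     mark G \<in> {1..k} \<rightarrow> verts G \<and> inj_on (mark G) {1..k}}"

definition adjacent :: "'v marked_graph \<Rightarrow> 'v \<Rightarrow> 'v \<Rightarrow> bool" where
  "adjacent G u v \<longleftrightarrow> {u, v} \<in># edges G"

text \<open>Degrees count parallel edges with multiplicity.\<close>

definition degree :: "'v marked_graph \<Rightarrow> 'v \<Rightarrow> nat" where
  "degree G v = size {#e \<in># edges G. v \<in> e#}"

definition max_degree :: "'v marked_graph \<Rightarrow> nat" where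
  "max_degree G = Max (degree G ` verts G)"

definition is_path :: "'v marked_graph \<Rightarrow> 'v \<Rightarrow> 'v list \<Rightarrow> 'v \<Rightarrow> bool" where
  "is_path G u p v \<longleftrightarrow> p \<noteq> [] \<and> hd p = u \<and> last p = v \<and> set p \<subseteq> verts G \<and>
     distinct p \<and> successively (adjacent G) p"

text \<open>The infimum of the empty set in \<^typ>\<open>enat\<close> is \<open>\<infinity>\<close>; this gives the value \<open>\<infinity>\<close> to the distance
  of unconnected vertices, and to the minimal label distance if there is at most one label.\<close>

definition graph_dist :: "'v marked_graph \<Rightarrow> 'v \<Rightarrow> 'v \<Rightarrow> enat" where
  "graph_dist G u v = Inf {enat (length p - 1) | p. is_path G u p v}"

definition min_mark_dist :: "nat \<Rightarrow> 'v marked_graph \<Rightarrow> enat" where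
  "min_mark_dist k G =
     Inf {graph_dist G (mark G i) (mark G j) | i j. i \<in> {1..k} \<and> j \<in> {1..k} \<and> i \<noteq> j}"

definition independent_set :: "'v marked_graph \<Rightarrow> 'v set \<Rightarrow> bool" where
  "independent_set G I \<longleftrightarrow> I \<subseteq> verts G \<and> (\<forall>u\<in>I. \<forall>v\<in>I. \<not> adjacent G u v)"

definition indep_poly :: "'v marked_graph \<Rightarrow> complex \<Rightarrow> complex" where
  "indep_poly G z = (\<Sum>I | independent_set G I. z ^ card I)"

section \<open>Gluing data\<close>

text \<open>The multiset of hyperedges is an indexed family: \<open>hedges\<close> is the set of edge names, and
  \<open>members\<close> gives the vertices of an edge, so that different edges may have the same vertices.\<close>

record 'h labeled_hypergraph =
  hedges :: "'h set"
  members :: "'h \<Rightarrow> nat set"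
  label :: "'h \<Rightarrow> nat"

text \<open>Injectivity of \<open>members\<close> on the edges with a given label is part of their being a partition:
  without it a part could be listed several times.\<close>

definition gluing_data :: "nat \<Rightarrow> nat \<Rightarrow> 'h labeled_hypergraph \<Rightarrow> (nat \<Rightarrow> 'h) \<Rightarrow> bool" where
  "gluing_data k m H \<Phi> \<longleftrightarrow>
     finite (hedges H) \<and>
     (\<forall>e\<in>hedges H. members H e \<noteq> {} \<and> members H e \<subseteq> {1..m} \<and> label H e \<in> {1..k}) \<and>
     (\<forall>j\<in>{1..k}. partition_on {1..m} (members H ` {e \<in> hedges H. label H e = j}) \<and>
                  inj_on (members H) {e \<in> hedges H. label H e = j}) \<and>
     \<Phi> \<in> {1..k} \<rightarrow> hedges H \<and> inj_on \<Phi> {1..k}"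

section \<open>The graph recursion\<close>

text \<open>A vertex type closed under gluing: \<open>Copy i v\<close> is the vertex \<open>v\<close> of the \<open>i\<close>-th copy,
  and \<open>Merged e\<close> is the vertex resulting from the identification along the hyperedge \<open>e\<close>.
  Every graph with vertices in \<open>'v\<close> is represented by its image under \<open>Base\<close>.\<close>

datatype ('v, 'h) vertex = Base 'v | Copy nat "('v, 'h) vertex" | Merged 'h

text \<open>The projection of the \<open>i\<close>-th copy of \<open>G\<close> to the glued graph. For a marked vertex \<open>v\<close>, the edge
  \<open>e\<close> below is the one containing \<open>i\<close> among the edges labeled with the label of \<open>v\<close>. By the
  lemma \<open>proj_eq_iff\<close>, these maps realise exactly the prescribed identifications.\<close>

definition proj :: "nat \<Rightarrow> 'h labeled_hypergraph \<Rightarrow> ('v, 'h) vertex marked_graph \<Rightarrow>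
    nat \<Rightarrow> ('v, 'h) vertex \<Rightarrow> ('v, 'h) vertex" where
  "proj k H G i v =
     (if v \<in> mark G ` {1..k}
      then Merged (THE e. e \<in> hedges H \<and> i \<in> members H e \<and> mark G (label H e) = v)
      else Copy i v)"

definition recursion :: "nat \<Rightarrow> nat \<Rightarrow> 'h labeled_hypergraph \<Rightarrow> (nat \<Rightarrow> 'h) \<Rightarrow>
    ('v, 'h) vertex marked_graph \<Rightarrow> ('v, 'h) vertex marked_graph" where
  "recursion k m H \<Phi> G =
     \<lparr>verts = (\<Union>i\<in>{1..m}. proj k H G i ` verts G),
      edges = (\<Sum>i\<in>{1..m}. image_mset ((`) (proj k H G i)) (edges G)),
      mark = (\<lambda>j. Merged (\<Phi> j))\<rparr>"

lemma ex1_hedge: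
  assumes "gluing_data k m H \<Phi>" "G \<in> marked_graphs k" "i \<in> {1..m}" "v \<in> mark G ` {1..k}"
  shows "\<exists>!e. e \<in> hedges H \<and> i \<in> members H e \<and> mark G (label H e) = v"
proof -
  from assms(4) obtain j where j: "j \<in> {1..k}" "v = mark G j" by blast
  have inj: "inj_on (mark G) {1..k}" using assms(2) by (simp add: marked_graphs_def)
  have p: "partition_on {1..m} (members H ` {e \<in> hedges H. label H e = j})"
    and q: "inj_on (members H) {e \<in> hedges H. label H e = j}"
    and l: "\<And>e. e \<in> hedges H \<Longrightarrow> label H e \<in> {1..k}"
    using assms(1) j(1) by (simp_all add: gluing_data_def)
  have "i \<in> \<Union>(members H ` {e \<in> hedges H. label H e = j})"
    using p assms(3) by (simp only: partition_on_def)
  then obtain e where e: "e \<in> hedges H" "label H e = j" "i \<in> members H e" by blast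
  show ?thesis
  proof (rule ex1I[of _ e])
    show "e \<in> hedges H \<and> i \<in> members H e \<and> mark G (label H e) = v" using e j by simp
  next
    fix f assume f: "f \<in> hedges H \<and> i \<in> members H f \<and> mark G (label H f) = v"
    then have lf: "label H f = j"
      using inj_onD[OF inj, of "label H f" j] l[of f] j by simp
    have mem: "e \<in> {e \<in> hedges H. label H e = j}" "f \<in> {e \<in> hedges H. label H e = j}"
      using e f lf by simp_all
    have "disjoint (members H ` {e \<in> hedges H. label H e = j})"
      using p by (simp only: partition_on_def)
    from disjointD[OF this imageI[OF mem(1)] imageI[OF mem(2)]]
    have "members H f = members H e" using e(3) f by blast
    then show "f = e" using inj_onD[OF q _ mem(2,1)] by simp
  qed
qed

lemma proj_marked:
  assumes "gluing_data k m H \<Phi>" "G \<in> marked_graphs k" "e \<in> hedges H" "i \<in> members H e"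
  shows "proj k H G i (mark G (label H e)) = Merged e"
proof -
  have "members H e \<subseteq> {1..m}" and l: "label H e \<in> {1..k}"
    using assms(1,3) by (simp_all add: gluing_data_def)
  then have i: "i \<in> {1..m}" using assms(4) by blast
  from l have 1: "mark G (label H e) \<in> mark G ` {1..k}" by blast
  show ?thesis
    using the1_equality[OF ex1_hedge[OF assms(1,2) i 1], of e] assms(3,4) 1
    by (simp add: proj_def)
qed

lemma proj_eq_iff:
  assumes "gluing_data k m H \<Phi>" "G \<in> marked_graphs k"
    and "i \<in> {1..m}" "i' \<in> {1..m}"
  shows "proj k H G i v = proj k H G i' v' \<longleftrightarrow>
    (i = i' \<and> v = v') \<or>
    (\<exists>e\<in>hedges H. i \<in> members H e \<and> i' \<in> members H e \<and>
        v = mark G (label H e) \<and> v' = mark G (label H e))"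
    (is "?L \<longleftrightarrow> ?R")
proof
  assume L: ?L
  show ?R
  proof (cases "v \<in> mark G ` {1..k} \<and> v' \<in> mark G ` {1..k}")
    case True
    obtain e where e: "e \<in> hedges H" "i \<in> members H e" "mark G (label H e) = v"
      using ex1_hedge[OF assms(1,2,3) conjunct1[OF True]] by blast
    obtain e' where e': "e' \<in> hedges H" "i' \<in> members H e'" "mark G (label H e') = v'"
      using ex1_hedge[OF assms(1,2,4) conjunct2[OF True]] by blast
    have "e = e'"
      using proj_marked[OF assms(1,2) e(1,2)] proj_marked[OF assms(1,2) e'(1,2)] e e' L by simp
    then show ?thesis using e e' by blast
  next
    case False
    then show ?thesis using L by (auto simp: proj_def split: if_splits)
  qed
next
  assume ?R
  then show ?L by (elim disjE bexE conjE) (simp_all add: proj_marked[OF assms(1,2)])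
qed

lemma recursion_in_marked_graphs:
  assumes "gluing_data k m H \<Phi>" "G \<in> marked_graphs k"
  shows "recursion k m H \<Phi> G \<in> marked_graphs k"
proof -
  have G: "finite (verts G)" "\<And>e. e \<in># edges G \<Longrightarrow> e \<subseteq> verts G \<and> card e = 2"
    "\<And>j. j \<in> {1..k} \<Longrightarrow> mark G j \<in> verts G"
    using assms(2) by (auto simp: marked_graphs_def)
  have inj: "inj (proj k H G i)" if "i \<in> {1..m}" for i
    using proj_eq_iff[OF assms that that] by (auto intro: injI)
  have E: "f \<subseteq> verts (recursion k m H \<Phi> G) \<and> card f = 2"
    if "f \<in># edges (recursion k m H \<Phi> G)" for f
  proof -
    from that obtain i e where i: "i \<in> {1..m}" "e \<in># edges G" "f = proj k H G i ` e"
      by (auto simp: recursion_def set_mset_sum)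
    have "card f = card e" unfolding i(3)
      by (rule card_image, rule inj_on_subset[OF inj[OF i(1)]]) simp
    moreover have "f \<subseteq> verts (recursion k m H \<Phi> G)"
      using G(2)[OF i(2)] i(1) unfolding i(3) recursion_def marked_graph.select_convs by blast
    ultimately show ?thesis using G(2)[OF i(2)] by simp
  qed
  have M: "Merged (\<Phi> j) \<in> verts (recursion k m H \<Phi> G)" if "j \<in> {1..k}" for j
  proof -
    have h: "\<Phi> j \<in> hedges H" using assms(1) that by (auto simp: gluing_data_def)
    then have "members H (\<Phi> j) \<noteq> {}" "members H (\<Phi> j) \<subseteq> {1..m}" and l: "label H (\<Phi> j) \<in> {1..k}"
      using assms(1) by (simp_all add: gluing_data_def)
    then obtain i where i: "i \<in> members H (\<Phi> j)" "i \<in> {1..m}" by blast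
    have "Merged (\<Phi> j) \<in> proj k H G i ` verts G"
      using proj_marked[OF assms h i(1)] G(3)[OF l] by (metis imageI)
    then show ?thesis using i(2) unfolding recursion_def marked_graph.select_convs by blast
  qed
  have "inj_on (mark (recursion k m H \<Phi> G)) {1..k}"
  proof (rule inj_onI)
    fix x y assume "x \<in> {1..k}" "y \<in> {1..k}"
      and "mark (recursion k m H \<Phi> G) x = mark (recursion k m H \<Phi> G) y"
    moreover from this(3) have "\<Phi> x = \<Phi> y"
      by (simp only: recursion_def marked_graph.select_convs vertex.inject)
    moreover have "inj_on \<Phi> {1..k}" using assms(1) by (simp only: gluing_data_def)
    ultimately show "x = y" by (simp only: inj_on_def)
  qed
  moreover have "finite (verts (recursion k m H \<Phi> G))"
    using G(1) by (simp add: recursion_def)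
  moreover have "mark (recursion k m H \<Phi> G) \<in> {1..k} \<rightarrow> verts (recursion k m H \<Phi> G)"
  proof (rule Pi_I)
    fix j assume "j \<in> {1..k}"
    from M[OF this] show "mark (recursion k m H \<Phi> G) j \<in> verts (recursion k m H \<Phi> G)"
      by (simp only: recursion_def marked_graph.select_convs)
  qed
  ultimately show ?thesis using E unfolding marked_graphs_def by blast
qed

end

theory Submission
  imports Defs
begin

text \<open>
  For a set \<open>X\<close> of labels let \<open>W\<^sub>n(X)\<close> be the part of the independence polynomial of \<open>G n\<close> coming from
  the independent sets that contain exactly the marked vertices with labels in \<open>X\<close>, divided by
  \<open>z ^ card X\<close>. An independent set of the glued graph amounts to a choice of occupied merged vertices
  together with a compatible independent set in every copy. Hence \<open>W\<^bsub>n+1\<^esub>\<close> arises from \<open>W\<^sub>n\<close> by a fixed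
  polynomial map, \<open>transfer\<close> (lemma \<open>cond_poly_recursion\<close>), and everything is read off from the
  ratios \<open>r\<^sub>a(X) = W(insert a X) / W(X)\<close>. The new vertex labeled \<open>a\<close> consists of copies of the old
  vertex labeled \<open>parent a\<close>, so the new \<open>r\<^sub>a(X)\<close> is a mean of products of old ratios \<open>r\<^bsub>parent a\<^esub>\<close>,
  averaged over the occupations of the unmarked merged vertices.

  The two hypotheses enter through combinatorics. Degrees multiply along \<open>a\<close>, \<open>parent a\<close>, \<open>\<dots>\<close> by the
  numbers of merged copies, so a degree bound forces these products to be bounded, except at marks
  that are eventually isolated vertices and have ratio \<open>1\<close>. If two marks keep lying in a common copy
  generation after generation, then a path between them is inherited forever, so that divergence of
  the distances rules this out for connected marks: after a fixed number \<open>N\<close> of generations the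
  occupation of \<open>b\<close> can influence that of \<open>a\<close> only through unmarked merged vertices
  (lemma \<open>influencers_vanish\<close>).

  For real \<open>x \<ge> 0\<close> the averages are over probability measures that give mass at least \<open>\<delta> > 0\<close> to the
  configuration in which all unmarked merged vertices are empty, uniformly in \<open>n\<close> and in \<open>X\<close>. By
  Doeblin's coupling argument the oscillation of \<open>X \<mapsto> r\<^sub>a(X)\<close> decays geometrically
  (\<open>real_oscillation_decay\<close>): the marked vertices become independent of each other.

  For complex \<open>z\<close> near \<open>x\<close> the same contraction holds as long as the complex weights are close to a
  probability measure (\<open>nearly_positive\<close>), which is so as long as the ratios at \<open>z\<close> are close to those
  at \<open>x\<close>. In a product state the ratios move only by \<open>r\<^sub>a \<mapsto> r\<^bsub>parent a\<^esub>\<close> raised to the number of merged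
  copies, up to an error of the size of the oscillation. So once the oscillation is small, the
  distance between the ratios at \<open>z\<close> and at \<open>x\<close> changes by a convergent geometric series only, and the
  estimates maintain themselves for all later times (\<open>eventually_nonzero\<close>). Closeness to the real
  orbit keeps the partition functions away from \<open>0\<close>; the finitely many earlier graphs are handled by
  continuity.
\<close>

section \<open>Estimates for products and weighted means\<close>

lemma norm_prod_diff_le:
  fixes f g :: "'i \<Rightarrow> complex" and B d :: real
  assumes "finite A" "1 \<le> B" "0 \<le> d"
    and "\<And>i. i \<in> A \<Longrightarrow> norm (f i) \<le> B" "\<And>i. i \<in> A \<Longrightarrow> norm (g i) \<le> B"
    and "\<And>i. i \<in> A \<Longrightarrow> norm (f i - g i) \<le> d"
  shows "norm ((\<Prod>i\<in>A. f i) - (\<Prod>i\<in>A. g i)) \<le> card A * B ^ (card A - 1) * d"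
  using assms(1,4-)
proof (induction A rule: finite_induct)
  case empty
  then show ?case by simp
next
  case (insert x A)
  have IH: "norm (prod f A - prod g A) \<le> card A * B ^ (card A - 1) * d"
    by (rule insert.IH) (use insert.prems in auto)
  have pf: "norm (prod f A) \<le> B ^ card A"
    using insert.prems(1) prod_mono[of A "\<lambda>i. norm (f i)" "\<lambda>_. B"] by (simp add: prod_norm)
  have "prod f (insert x A) - prod g (insert x A)
      = (f x - g x) * prod f A + g x * (prod f A - prod g A)"
    using insert.hyps by (simp add: algebra_simps)
  also have "norm \<dots> \<le> norm (f x - g x) * norm (prod f A) + norm (g x) * norm (prod f A - prod g A)"
    by (metis norm_mult norm_triangle_ineq)
  also have "\<dots> \<le> d * B ^ card A + B * (card A * B ^ (card A - 1) * d)"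
    using insert.prems pf IH assms by (intro add_mono mult_mono) auto
  also have "\<dots> \<le> real (card (insert x A)) * B ^ (card (insert x A) - 1) * d"
  proof (cases "card A")
    case 0 then show ?thesis using insert.hyps by simp
  next
    case (Suc n) then show ?thesis using insert.hyps by (simp add: algebra_simps)
  qed
  finally show ?case .
qed

text \<open>Doeblin's coupling estimate for complex weights. Both weight systems have the common mass \<open>\<delta>\<close>
  at \<open>t0\<close>, where the integrands differ by \<open>d0\<close> only. The remainders have total mass \<open>1 - \<delta>\<close> each, so
  the difference of their integrals is a double integral of \<open>R t - R' t'\<close> against the product of the
  remainders, divided by \<open>1 - \<delta>\<close>. For probability weights \<open>s = 1 - \<delta>\<close>, and \<open>d\<close> gets the
  factor \<open>1 - \<delta>\<close>.\<close>

lemma norm_weighted_sum_diff_le: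
  fixes p p' R R' :: "'t \<Rightarrow> complex" and \<delta> s d d0 :: real
  assumes "finite A" "t0 \<in> A" "0 \<le> \<delta>" "\<delta> < 1" "0 \<le> d"
    and sum1: "(\<Sum>t\<in>A. p t) = 1" "(\<Sum>t\<in>A. p' t) = 1"
    and tv: "(\<Sum>t\<in>A. norm (p t - (if t = t0 then of_real \<delta> else 0))) \<le> s"
      "(\<Sum>t\<in>A. norm (p' t - (if t = t0 then of_real \<delta> else 0))) \<le> s"
    and R0: "norm (R t0 - R' t0) \<le> d0"
    and R: "\<And>t t'. t \<in> A \<Longrightarrow> t' \<in> A \<Longrightarrow> norm (R t - R' t') \<le> d"
  shows "norm ((\<Sum>t\<in>A. p t * R t) - (\<Sum>t\<in>A. p' t * R' t)) \<le> \<delta> * d0 + s\<^sup>2 / (1 - \<delta>) * d"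
proof -
  define q where "q t = p t - (if t = t0 then of_real \<delta> else 0)" for t
  define q' where "q' t = p' t - (if t = t0 then of_real \<delta> else 0)" for t
  have s0: "0 \<le> s" using tv(1) by (rule order_trans[rotated]) (simp add: sum_nonneg)
  have q: "(\<Sum>t\<in>A. q t) = of_real (1 - \<delta>)" "(\<Sum>t\<in>A. q' t) = of_real (1 - \<delta>)"
    using assms(1,2) sum1 by (simp_all add: q_def q'_def sum_subtractf)
  have e1: "(\<Sum>t\<in>A. p t * R t) = of_real \<delta> * R t0 + (\<Sum>t\<in>A. q t * R t)"
  proof -
    have "(\<Sum>t\<in>A. q t * R t) = (\<Sum>t\<in>A. p t * R t) - (\<Sum>t\<in>A. if t = t0 then of_real \<delta> * R t else 0)"
      unfolding sum_subtractf[symmetric] by (intro sum.cong) (auto simp: q_def algebra_simps)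
    then show ?thesis using assms(1,2) by simp
  qed
  have e2: "(\<Sum>t\<in>A. p' t * R' t) = of_real \<delta> * R' t0 + (\<Sum>t\<in>A. q' t * R' t)"
  proof -
    have "(\<Sum>t\<in>A. q' t * R' t) = (\<Sum>t\<in>A. p' t * R' t) - (\<Sum>t\<in>A. if t = t0 then of_real \<delta> * R' t else 0)"
      unfolding sum_subtractf[symmetric] by (intro sum.cong) (auto simp: q'_def algebra_simps)
    then show ?thesis using assms(1,2) by simp
  qed
  have "of_real (1 - \<delta>) * ((\<Sum>t\<in>A. q t * R t) - (\<Sum>t\<in>A. q' t * R' t))
      = (\<Sum>t'\<in>A. q' t') * (\<Sum>t\<in>A. q t * R t) - (\<Sum>t\<in>A. q t) * (\<Sum>t'\<in>A. q' t' * R' t')"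
    unfolding q by (simp add: algebra_simps)
  also have "\<dots> = (\<Sum>t\<in>A. \<Sum>t'\<in>A. q t * q' t' * (R t - R' t'))"
  proof -
    have "(\<Sum>t'\<in>A. q' t') * (\<Sum>t\<in>A. q t * R t) = (\<Sum>t\<in>A. \<Sum>t'\<in>A. q t * q' t' * R t)"
      by (subst mult.commute, unfold sum_product) (intro sum.cong refl, simp add: mult_ac)
    moreover have "(\<Sum>t\<in>A. q t) * (\<Sum>t'\<in>A. q' t' * R' t') = (\<Sum>t\<in>A. \<Sum>t'\<in>A. q t * q' t' * R' t')"
      unfolding sum_product by (intro sum.cong refl) (simp add: mult_ac)
    ultimately show ?thesis by (simp add: right_diff_distrib sum_subtractf)
  qed
  finally have "norm (of_real (1 - \<delta>) * ((\<Sum>t\<in>A. q t * R t) - (\<Sum>t\<in>A. q' t * R' t)))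
      \<le> (\<Sum>t\<in>A. \<Sum>t'\<in>A. norm (q t) * norm (q' t') * d)"
    by (simp only:, intro sum_norm_le) (simp add: norm_mult mult_left_mono R)
  also have "\<dots> = (\<Sum>t\<in>A. norm (q t)) * (\<Sum>t\<in>A. norm (q' t)) * d"
    by (subst sum_product) (simp only: sum_distrib_right)
  also have "\<dots> \<le> s * s * d"
    using tv s0 assms(5) unfolding q_def[symmetric] q'_def[symmetric]
    by (intro mult_right_mono mult_mono) (auto simp: sum_nonneg)
  finally have "(1 - \<delta>) * norm ((\<Sum>t\<in>A. q t * R t) - (\<Sum>t\<in>A. q' t * R' t)) \<le> s\<^sup>2 * d"
    using assms(4) by (simp add: norm_mult power2_eq_square del: of_real_diff)
  then have q_le: "norm ((\<Sum>t\<in>A. q t * R t) - (\<Sum>t\<in>A. q' t * R' t)) \<le> s\<^sup>2 / (1 - \<delta>) * d"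
    using assms(4) by (simp add: field_simps)
  have "(\<Sum>t\<in>A. p t * R t) - (\<Sum>t\<in>A. p' t * R' t)
      = of_real \<delta> * (R t0 - R' t0) + ((\<Sum>t\<in>A. q t * R t) - (\<Sum>t\<in>A. q' t * R' t))"
    unfolding e1 e2 by (simp add: algebra_simps)
  also have "norm \<dots> \<le> \<delta> * d0 + s\<^sup>2 / (1 - \<delta>) * d"
    using q_le R0 assms(3)
    by (intro order_trans[OF norm_triangle_ineq] add_mono) (auto simp: norm_mult mult_left_mono)
  finally show ?thesis .
qed

section \<open>The transfer operator of a gluing data\<close>

definition ratio :: "(nat set \<Rightarrow> complex) \<Rightarrow> nat \<Rightarrow> nat set \<Rightarrow> complex" where
  "ratio W a X = W (insert a X) / W X"

locale gluing =
  fixes k m :: nat and H :: "'h labeled_hypergraph" and \<Phi> :: "nat \<Rightarrow> 'h"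
  assumes gluing: "gluing_data k m H \<Phi>"
begin

definition inner_edges :: "'h set" where
  "inner_edges = hedges H - \<Phi> ` {1..k}"

definition parent :: "nat \<Rightarrow> nat" where
  "parent j = label H (\<Phi> j)"

text \<open>The labels of the occupied marked vertices in the \<open>i\<close>-th copy, when \<open>S\<close> is the set of
  the occupied merged vertices of the glued graph.\<close>

definition occupied_marks :: "nat \<Rightarrow> 'h set \<Rightarrow> nat set" where
  "occupied_marks i S = label H ` {e \<in> S. i \<in> members H e}"

definition config_weight :: "complex \<Rightarrow> (nat set \<Rightarrow> complex) \<Rightarrow> nat set \<Rightarrow> 'h set \<Rightarrow> complex" where
  "config_weight z W Y T = z ^ card T * (\<Prod>i\<in>{1..m}. W (occupied_marks i (T \<union> \<Phi> ` Y)))"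

text \<open>The vertices \<open>Merged e\<close> with \<open>e \<in> \<Phi> ` Y\<close> are the occupied marks of the glued graph; they carry no factor
  \<open>z\<close>, in accordance with the normalization of \<open>W\<close>.\<close>

definition transfer :: "complex \<Rightarrow> (nat set \<Rightarrow> complex) \<Rightarrow> nat set \<Rightarrow> complex" where
  "transfer z W Y = (\<Sum>T\<in>Pow inner_edges. config_weight z W Y T)"

lemma finite_inner_edges: "finite inner_edges"
  using gluing by (simp add: gluing_data_def inner_edges_def)

lemma mark_edge:
  assumes "a \<in> {1..k}"
  shows "\<Phi> a \<in> hedges H" "members H (\<Phi> a) \<subseteq> {1..m}" "members H (\<Phi> a) \<noteq> {}"
    "finite (members H (\<Phi> a))" "parent a \<in> {1..k}"
    "1 \<le> card (members H (\<Phi> a))" "card (members H (\<Phi> a)) \<le> m"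
proof -
  show 1: "\<Phi> a \<in> hedges H" using gluing assms by (auto simp: gluing_data_def)
  show 2: "members H (\<Phi> a) \<subseteq> {1..m}" and 3: "members H (\<Phi> a) \<noteq> {}" and "parent a \<in> {1..k}"
    using gluing 1 by (auto simp: gluing_data_def parent_def)
  show 4: "finite (members H (\<Phi> a))" using 2 finite_subset by blast
  show "1 \<le> card (members H (\<Phi> a))" using 3 4 by (simp add: Suc_le_eq card_gt_0_iff)
  show "card (members H (\<Phi> a)) \<le> m" using card_mono[OF _ 2] by simp
qed

text \<open>Edges with the same label are the parts of a partition of the copies.\<close>

lemma hedge_unique:
  assumes "e \<in> hedges H" "e' \<in> hedges H" "label H e = label H e'" "i \<in> members H e" "i \<in> members H e'"
  shows "e = e'"
proof -
  let ?E = "{e \<in> hedges H. label H e = label H e'}"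
  have "label H e' \<in> {1..k}" using gluing assms(2) by (auto simp: gluing_data_def)
  then have p: "partition_on {1..m} (members H ` ?E)" and q: "inj_on (members H) ?E"
    using gluing by (auto simp: gluing_data_def)
  have E: "e \<in> ?E" "e' \<in> ?E" using assms by simp_all
  have "disjoint (members H ` ?E)" using p by (simp only: partition_on_def)
  from disjointD[OF this imageI[OF E(1)] imageI[OF E(2)]]
  have "members H e = members H e'" using assms(4,5) by blast
  then show ?thesis using inj_onD[OF q _ E] by blast
qed

lemma occupied_marks_subset:
  assumes "S \<subseteq> hedges H" shows "occupied_marks i S \<subseteq> {1..k}"
  using gluing assms by (auto simp: gluing_data_def occupied_marks_def)

lemma config_subset:
  assumes "Y \<subseteq> {1..k}" "T \<subseteq> inner_edges" shows "T \<union> \<Phi> ` Y \<subseteq> hedges H"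
  using gluing assms by (auto simp: gluing_data_def inner_edges_def)

text \<open>In a copy \<open>i\<close> taking part in \<open>\<Phi> a\<close>, the only hyperedge labeled \<open>parent a\<close> is \<open>\<Phi> a\<close> itself. So the
  occupation of \<open>parent a\<close> in that copy is decided by the new mark \<open>a\<close> alone.\<close>

lemma parent_notin_occupied_marks:
  assumes "a \<in> {1..k}" "Y \<subseteq> {1..k} - {a}" "T \<subseteq> inner_edges" "i \<in> members H (\<Phi> a)"
  shows "parent a \<notin> occupied_marks i (T \<union> \<Phi> ` Y)"
proof
  assume "parent a \<in> occupied_marks i (T \<union> \<Phi> ` Y)"
  then obtain e where e: "e \<in> T \<union> \<Phi> ` Y" "i \<in> members H e" "label H e = label H (\<Phi> a)"
    unfolding occupied_marks_def parent_def by (elim imageE CollectE conjE) (simp only:)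
  have "e \<in> hedges H" using e(1) config_subset[of Y T] assms by auto
  then have "e = \<Phi> a" by (rule hedge_unique[OF _ mark_edge(1)[OF assms(1)] e(3,2) assms(4)])
  moreover have "inj_on \<Phi> {1..k}" using gluing by (simp add: gluing_data_def)
  ultimately show False using e(1) assms by (auto simp: inner_edges_def inj_on_eq_iff)
qed

lemma occupied_marks_insert:
  "occupied_marks i (T \<union> \<Phi> ` insert a Y) =
    (if i \<in> members H (\<Phi> a) then insert (parent a) (occupied_marks i (T \<union> \<Phi> ` Y))
     else occupied_marks i (T \<union> \<Phi> ` Y))"
proof (cases "i \<in> members H (\<Phi> a)")
  case True
  then have "{e \<in> T \<union> \<Phi> ` insert a Y. i \<in> members H e}
      = insert (\<Phi> a) {e \<in> T \<union> \<Phi> ` Y. i \<in> members H e}" by blast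
  then show ?thesis using True unfolding occupied_marks_def parent_def by (simp only: image_insert if_True)
next
  case False
  then have "{e \<in> T \<union> \<Phi> ` insert a Y. i \<in> members H e}
      = {e \<in> T \<union> \<Phi> ` Y. i \<in> members H e}" by blast
  then show ?thesis using False unfolding occupied_marks_def by (simp only: if_False)
qed

definition mark_factor :: "(nat set \<Rightarrow> complex) \<Rightarrow> nat \<Rightarrow> nat set \<Rightarrow> 'h set \<Rightarrow> complex" where
  "mark_factor W a Y T = (\<Prod>i\<in>members H (\<Phi> a). ratio W (parent a) (occupied_marks i (T \<union> \<Phi> ` Y)))"

definition nonvanishing :: "(nat set \<Rightarrow> complex) \<Rightarrow> bool" where
  "nonvanishing W \<longleftrightarrow> (\<forall>X\<subseteq>{1..k}. W X \<noteq> 0)"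

text \<open>Occupying the mark \<open>a\<close> of the glued graph occupies \<open>parent a\<close> in every copy of \<open>\<Phi> a\<close> and changes
  nothing in the other copies.\<close>

lemma config_weight_insert:
  assumes W: "nonvanishing W" and a: "a \<in> {1..k}" "Y \<subseteq> {1..k} - {a}" and T: "T \<subseteq> inner_edges"
  shows "config_weight z W (insert a Y) T = config_weight z W Y T * mark_factor W a Y T"
proof -
  let ?S = "\<lambda>i. occupied_marks i (T \<union> \<Phi> ` Y)"
  from a(2) have "Y \<subseteq> {1..k}" by blast
  then have "T \<union> \<Phi> ` Y \<subseteq> hedges H" using T by (rule config_subset)
  then have nz: "W (?S i) \<noteq> 0" for i
    using W occupied_marks_subset unfolding nonvanishing_def by blast
  have "(\<Prod>i\<in>{1..m}. W (occupied_marks i (T \<union> \<Phi> ` insert a Y)))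
      = (\<Prod>i\<in>{1..m}. W (?S i) * (if i \<in> members H (\<Phi> a) then ratio W (parent a) (?S i) else 1))"
    by (intro prod.cong) (auto simp del: image_insert simp: occupied_marks_insert ratio_def nz)
  also have "\<dots> = (\<Prod>i\<in>{1..m}. W (?S i)) * mark_factor W a Y T"
    using mark_edge(2)[OF a(1)]
    by (simp add: prod.distrib mark_factor_def prod.If_cases Int_absorb1)
  finally show ?thesis by (simp add: config_weight_def)
qed

lemma transfer_insert:
  assumes "nonvanishing W" "a \<in> {1..k}" "Y \<subseteq> {1..k} - {a}"
  shows "transfer z W (insert a Y) = (\<Sum>T\<in>Pow inner_edges. config_weight z W Y T * mark_factor W a Y T)"
  unfolding transfer_def using config_weight_insert[OF assms] by (intro sum.cong) simp_all

end

section \<open>The effect of one gluing step on the ratios\<close>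

context gluing
begin

text \<open>The normalized configuration weights are within \<open>\<eta>\<close> of having the total variation of a probability
  measure with mass at least \<open>\<delta>\<close> at the empty configuration: for such a measure the sum below
  is exactly \<open>1 - \<delta>\<close>.\<close>

definition nearly_positive :: "real \<Rightarrow> real \<Rightarrow> complex \<Rightarrow> (nat set \<Rightarrow> complex) \<Rightarrow> bool" where
  "nearly_positive \<delta> \<eta> z W \<longleftrightarrow> (\<forall>Y\<subseteq>{1..k}. transfer z W Y \<noteq> 0 \<and>
     (\<Sum>T\<in>Pow inner_edges. norm (config_weight z W Y T / transfer z W Y -
        (if T = {} then of_real \<delta> else 0))) \<le> 1 - \<delta> + \<eta>)"

text \<open>The influence on \<open>a\<close> of the marks outside \<open>B\<close> is at most \<open>d\<close>. For \<open>B = {}\<close> this bounds the full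
  oscillation of the ratio.\<close>

definition osc_le :: "nat set \<Rightarrow> nat \<Rightarrow> real \<Rightarrow> (nat set \<Rightarrow> complex) \<Rightarrow> bool" where
  "osc_le B a d W \<longleftrightarrow> (\<forall>X X'. X \<subseteq> {1..k} - {a} \<longrightarrow> X' \<subseteq> {1..k} - {a} \<longrightarrow> X \<inter> B = X' \<inter> B \<longrightarrow>
     norm (ratio W a X - ratio W a X') \<le> d)"

lemma ratio_transfer:
  assumes "nonvanishing W" "a \<in> {1..k}" "Y \<subseteq> {1..k} - {a}"
  shows "ratio (transfer z W) a Y =
    (\<Sum>T\<in>Pow inner_edges. config_weight z W Y T / transfer z W Y * mark_factor W a Y T)"
  unfolding ratio_def transfer_insert[OF assms] by (simp add: sum_divide_distrib)

lemma config_weights_sum_1: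
  assumes "transfer z W Y \<noteq> 0"
  shows "(\<Sum>T\<in>Pow inner_edges. config_weight z W Y T / transfer z W Y) = 1"
  using assms unfolding sum_divide_distrib[symmetric] by (simp add: transfer_def)

lemma occupied_marks_config:
  assumes "a \<in> {1..k}" "Y \<subseteq> {1..k} - {a}" "T \<subseteq> inner_edges" "i \<in> members H (\<Phi> a)"
  shows "occupied_marks i (T \<union> \<Phi> ` Y) \<subseteq> {1..k} - {parent a}"
proof -
  have "Y \<subseteq> {1..k}" using assms(2) by blast
  from occupied_marks_subset[OF config_subset[OF this assms(3)]] parent_notin_occupied_marks[OF assms]
  show ?thesis by blast
qed

text \<open>The Lipschitz constant of a product of \<open>q\<close> ratios. It has to be exactly \<open>1\<close> for \<open>q = 1\<close>, since a mark
  that is not merged any more goes through arbitrarily many generations; for \<open>q \<ge> 2\<close>, which happens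
  only boundedly often among the ancestors of a mark of positive degree, \<open>q\<^sup>2\<close> is good enough.\<close>

lemma mult_power_le_square:
  fixes B :: real
  assumes "1 \<le> q" "q \<le> m" "1 \<le> B" "B ^ m \<le> 2"
  shows "q * B ^ (q - 1) \<le> (real q)\<^sup>2"
proof (cases "q = 1")
  case False
  have "B ^ (q - 1) \<le> B ^ m" using assms by (intro power_increasing) auto
  also have "\<dots> \<le> q" using assms False by linarith
  finally show ?thesis using assms(1) by (simp add: power2_eq_square mult_left_mono)
qed simp

text \<open>The coupling estimate applied to one gluing step. If two configurations of new marks agree on
  \<open>L'\<close>, then, with all inner merged vertices empty, the induced configurations of old marks in the copies
  of \<open>\<Phi> a\<close> agree on \<open>L\<close>; this gives the term with \<open>d0\<close>. The rest of the mass sees the full oscillation \<open>d\<close>.\<close>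

lemma osc_transfer:
  fixes B d d0 \<delta> \<eta> :: real
  assumes W: "nonvanishing W" and np: "nearly_positive \<delta> \<eta> z W" and d: "0 \<le> \<delta>" "\<delta> < 1" "0 \<le> d" "0 \<le> d0"
    and B: "1 \<le> B" "B ^ m \<le> 2" "\<And>X. X \<subseteq> {1..k} - {parent a} \<Longrightarrow> norm (ratio W (parent a) X) \<le> B"
    and a: "a \<in> {1..k}"
    and osc: "osc_le L (parent a) d0 W" "osc_le {} (parent a) d W"
    and L': "\<And>b. b \<in> {1..k} \<Longrightarrow> b \<noteq> a \<Longrightarrow> members H (\<Phi> a) \<inter> members H (\<Phi> b) \<noteq> {} \<Longrightarrow>
      parent b \<in> L \<Longrightarrow> b \<in> L'"
  shows "osc_le L' a ((card (members H (\<Phi> a)))\<^sup>2 * (\<delta> * d0 + (1 - \<delta> + \<eta>)\<^sup>2 / (1 - \<delta>) * d)) (transfer z W)"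
  unfolding osc_le_def
proof (intro allI impI)
  fix X X' assume X: "X \<subseteq> {1..k} - {a}" "X' \<subseteq> {1..k} - {a}" and eq: "X \<inter> L' = X' \<inter> L'"
  define q where "q = card (members H (\<Phi> a))"
  have q: "1 \<le> q" "q \<le> m" using mark_edge[OF a] by (simp_all add: q_def)
  note sub = occupied_marks_config[OF a]
  have XK: "X \<subseteq> {1..k}" "X' \<subseteq> {1..k}" using X by auto
  have prod: "norm (mark_factor W a X T - mark_factor W a X' T') \<le> (real q)\<^sup>2 * e"
    if T: "T \<subseteq> inner_edges" "T' \<subseteq> inner_edges" and e: "0 \<le> e"
      and *: "\<And>i. i \<in> members H (\<Phi> a) \<Longrightarrow> norm (ratio W (parent a) (occupied_marks i (T \<union> \<Phi> ` X)) -
        ratio W (parent a) (occupied_marks i (T' \<union> \<Phi> ` X'))) \<le> e" for T T' e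
  proof -
    have "norm (mark_factor W a X T - mark_factor W a X' T') \<le> q * B ^ (q - 1) * e"
      unfolding mark_factor_def q_def
      using mark_edge(4)[OF a] B(1) e B(3)[OF sub[OF X(1) T(1)]] B(3)[OF sub[OF X(2) T(2)]] *
      by (rule norm_prod_diff_le)
    also have "\<dots> \<le> (real q)\<^sup>2 * e"
      using mult_power_le_square[OF q B(1,2)] e by (rule mult_right_mono)
    finally show ?thesis .
  qed
  have R: "norm (mark_factor W a X T - mark_factor W a X' T') \<le> (real q)\<^sup>2 * d"
    if T: "T \<in> Pow inner_edges" "T' \<in> Pow inner_edges" for T T'
  proof (rule prod)
    show "T \<subseteq> inner_edges" "T' \<subseteq> inner_edges" "0 \<le> d" using T d by auto
    fix i assume i: "i \<in> members H (\<Phi> a)"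
    show "norm (ratio W (parent a) (occupied_marks i (T \<union> \<Phi> ` X)) -
        ratio W (parent a) (occupied_marks i (T' \<union> \<Phi> ` X'))) \<le> d"
      using osc(2) sub[OF X(1) _ i, of T] sub[OF X(2) _ i, of T'] T unfolding osc_le_def by simp
  qed
  have R0: "norm (mark_factor W a X {} - mark_factor W a X' {}) \<le> (real q)\<^sup>2 * d0"
  proof (rule prod)
    fix i assume i: "i \<in> members H (\<Phi> a)"
    have inc: "occupied_marks i ({} \<union> \<Phi> ` V) \<inter> L \<subseteq> occupied_marks i ({} \<union> \<Phi> ` V')"
      if V: "V \<subseteq> {1..k} - {a}" "V \<inter> L' = V' \<inter> L'" for V V'
    proof
      fix c assume c: "c \<in> occupied_marks i ({} \<union> \<Phi> ` V) \<inter> L"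
      then obtain b where b: "b \<in> V" "i \<in> members H (\<Phi> b)" "c = parent b"
        by (auto simp: occupied_marks_def parent_def)
      have "b \<in> L'" using c b V i by (intro L') auto
      then have "b \<in> V'" using b V by blast
      then show "c \<in> occupied_marks i ({} \<union> \<Phi> ` V')"
        using b by (auto simp: occupied_marks_def parent_def)
    qed
    have "occupied_marks i ({} \<union> \<Phi> ` X) \<inter> L = occupied_marks i ({} \<union> \<Phi> ` X') \<inter> L"
      using inc[OF X(1) eq] inc[OF X(2) eq[symmetric]] by blast
    then show "norm (ratio W (parent a) (occupied_marks i ({} \<union> \<Phi> ` X)) -
        ratio W (parent a) (occupied_marks i ({} \<union> \<Phi> ` X'))) \<le> d0"
      using osc(1) sub[OF X(1) _ i, of "{}"] sub[OF X(2) _ i, of "{}"] unfolding osc_le_def by simp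
  qed (use d in auto)
  let ?p = "\<lambda>X T. config_weight z W X T / transfer z W X"
  have np': "transfer z W Y \<noteq> 0" "(\<Sum>T\<in>Pow inner_edges. norm (?p Y T -
        (if T = {} then of_real \<delta> else 0))) \<le> 1 - \<delta> + \<eta>" if "Y \<subseteq> {1..k}" for Y
    using np that by (auto simp: nearly_positive_def)
  have "norm ((\<Sum>T\<in>Pow inner_edges. ?p X T * mark_factor W a X T) -
      (\<Sum>T\<in>Pow inner_edges. ?p X' T * mark_factor W a X' T))
      \<le> \<delta> * ((real q)\<^sup>2 * d0) + (1 - \<delta> + \<eta>)\<^sup>2 / (1 - \<delta>) * ((real q)\<^sup>2 * d)"
  proof (rule norm_weighted_sum_diff_le[where ?t0.0 = "{}"])
    show "(\<Sum>T\<in>Pow inner_edges. ?p X T) = 1" "(\<Sum>T\<in>Pow inner_edges. ?p X' T) = 1"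
      using np'(1) XK config_weights_sum_1 by auto
  qed (use finite_inner_edges d np'(2) XK R0 R in auto)
  then show "norm (ratio (transfer z W) a X - ratio (transfer z W) a X')
      \<le> real ((card (members H (\<Phi> a)))\<^sup>2) * (\<delta> * d0 + (1 - \<delta> + \<eta>)\<^sup>2 / (1 - \<delta>) * d)"
    unfolding ratio_transfer[OF W a X(1)] ratio_transfer[OF W a X(2)] q_def
    by (simp add: algebra_simps)
qed

text \<open>If the old ratio hardly depends on the other marks, then the new ratio is a mean of nearly constant
  products, taken with respect to weights of total variation at most \<open>2\<close>.\<close>

lemma ratio_transfer_approx:
  fixes B d \<delta> \<eta> :: real
  assumes W: "nonvanishing W" and np: "nearly_positive \<delta> \<eta> z W" and d: "0 \<le> \<delta>" "0 \<le> d" "\<eta> \<le> 1"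
    and B: "1 \<le> B" "B ^ m \<le> 2" "\<And>X. X \<subseteq> {1..k} - {parent a} \<Longrightarrow> norm (ratio W (parent a) X) \<le> B"
    and a: "a \<in> {1..k}" "X \<subseteq> {1..k} - {a}" and osc: "osc_le {} (parent a) d W"
  shows "norm (ratio (transfer z W) a X - ratio W (parent a) {} ^ card (members H (\<Phi> a)))
    \<le> 2 * (card (members H (\<Phi> a)))\<^sup>2 * d"
proof -
  define q where "q = card (members H (\<Phi> a))"
  have q: "1 \<le> q" "q \<le> m" using mark_edge[OF a(1)] by (simp_all add: q_def)
  note sub = occupied_marks_config[OF a(1)]
  let ?p = "\<lambda>T. config_weight z W X T / transfer z W X"
  have XK: "X \<subseteq> {1..k}" using a(2) by auto
  have np': "transfer z W X \<noteq> 0" "(\<Sum>T\<in>Pow inner_edges. norm (?p T -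
        (if T = {} then of_real \<delta> else 0))) \<le> 1 - \<delta> + \<eta>"
    using np XK by (auto simp: nearly_positive_def)
  have R: "norm (mark_factor W a X T - ratio W (parent a) {} ^ q) \<le> (real q)\<^sup>2 * d"
    if T: "T \<in> Pow inner_edges" for T
  proof -
    have "norm (mark_factor W a X T - (\<Prod>i\<in>members H (\<Phi> a). ratio W (parent a) {})) \<le> q * B ^ (q - 1) * d"
      unfolding mark_factor_def q_def
    proof (rule norm_prod_diff_le)
      fix i assume i: "i \<in> members H (\<Phi> a)"
      show "norm (ratio W (parent a) (occupied_marks i (T \<union> \<Phi> ` X))) \<le> B"
        using T by (intro B(3) sub[OF a(2) _ i]) auto
      show "norm (ratio W (parent a) {}) \<le> B" by (intro B(3)) auto
      show "norm (ratio W (parent a) (occupied_marks i (T \<union> \<Phi> ` X)) - ratio W (parent a) {}) \<le> d"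
        using osc sub[OF a(2) _ i, of T] T unfolding osc_le_def by simp
    qed (use mark_edge(4)[OF a(1)] B(1) d in auto)
    also have "\<dots> \<le> (real q)\<^sup>2 * d"
      using mult_power_le_square[OF q B(1,2)] d(2) by (rule mult_right_mono)
    finally show ?thesis by (simp add: q_def)
  qed
  have tv: "(\<Sum>T\<in>Pow inner_edges. norm (?p T)) \<le> 2"
  proof -
    have "(\<Sum>T\<in>Pow inner_edges. norm (?p T)) \<le> (\<Sum>T\<in>Pow inner_edges. norm (?p T -
        (if T = {} then of_real \<delta> else 0)) + (if T = {} then \<delta> else 0))"
    proof (rule sum_mono)
      fix T
      have "norm (?p T) \<le> norm (?p T - (if T = {} then of_real \<delta> else 0)) + norm (if T = {} then of_real \<delta> else (0::complex))"
        by (metis diff_add_cancel norm_triangle_ineq)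
      then show "norm (?p T) \<le> norm (?p T - (if T = {} then of_real \<delta> else 0)) + (if T = {} then \<delta> else 0)"
        using d(1) by (cases "T = {}") simp_all
    qed
    also have "\<dots> \<le> 1 - \<delta> + \<eta> + \<delta>"
      using np'(2) finite_inner_edges by (simp add: sum.distrib)
    finally show ?thesis using d(3) by simp
  qed
  have "(\<Sum>T\<in>Pow inner_edges. ?p T * (mark_factor W a X T - ratio W (parent a) {} ^ q))
    = ratio (transfer z W) a X - (\<Sum>T\<in>Pow inner_edges. ?p T) * ratio W (parent a) {} ^ q"
    unfolding ratio_transfer[OF W a] right_diff_distrib sum_subtractf sum_distrib_right ..
  also have "\<dots> = ratio (transfer z W) a X - ratio W (parent a) {} ^ q"
    using config_weights_sum_1[OF np'(1)] by simp
  finally have "norm (ratio (transfer z W) a X - ratio W (parent a) {} ^ q)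
      \<le> (\<Sum>T\<in>Pow inner_edges. norm (?p T) * ((real q)\<^sup>2 * d))"
    using R by (metis (no_types, lifting) sum_norm_le norm_mult mult_left_mono norm_ge_zero)
  also have "\<dots> = (\<Sum>T\<in>Pow inner_edges. norm (?p T)) * ((real q)\<^sup>2 * d)"
    by (simp only: sum_distrib_right)
  also have "\<dots> \<le> 2 * ((real q)\<^sup>2 * d)" using tv d by (intro mult_right_mono) auto
  finally show ?thesis by (simp add: q_def)
qed

end

section \<open>Comparison with positive weights\<close>

context gluing
begin

text \<open>The properties of the partition functions at real \<open>x \<ge> 0\<close>: they are positive, and occupying one more
  mark reduces them by a factor between \<open>c\<close> and \<open>1\<close>.\<close>

definition antitone_weights :: "real \<Rightarrow> (nat set \<Rightarrow> real) \<Rightarrow> bool" where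
  "antitone_weights c V \<longleftrightarrow> (\<forall>X\<subseteq>{1..k}. 0 < V X) \<and>
     (\<forall>a X. insert a X \<subseteq> {1..k} \<longrightarrow> c * V X \<le> V (insert a X) \<and> V (insert a X) \<le> V X)"

lemma antitone_weights_mono:
  assumes V: "antitone_weights c V" and "X \<subseteq> X'" "X' \<subseteq> {1..k}"
  shows "V X' \<le> V X"
proof -
  have X: "X \<subseteq> {1..k}" using assms by blast
  have "V (X \<union> D) \<le> V X" if "finite D" "D \<subseteq> {1..k}" for D
    using that
  proof (induction D rule: finite_induct)
    case empty then show ?case by simp
  next
    case (insert a D)
    have "insert a (X \<union> D) \<subseteq> {1..k}" using insert.prems X by blast
    then have "V (insert a (X \<union> D)) \<le> V (X \<union> D)"
      using V by (simp add: antitone_weights_def)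
    then show ?case using insert by simp
  qed
  from this[of X'] show ?thesis using assms finite_subset by (auto simp: Un_absorb1)
qed

definition edge_count_sum :: "real \<Rightarrow> real" where
  "edge_count_sum x = (\<Sum>T\<in>Pow inner_edges. x ^ card T)"

lemma edge_count_sum_ge_1:
  assumes "0 \<le> x" shows "1 \<le> edge_count_sum x"
proof -
  have "(\<Sum>T\<in>{{} :: 'h set}. x ^ card T) \<le> edge_count_sum x"
    unfolding edge_count_sum_def using assms finite_inner_edges by (intro sum_mono2) auto
  then show ?thesis by simp
qed

definition real_config_weight :: "real \<Rightarrow> (nat set \<Rightarrow> real) \<Rightarrow> nat set \<Rightarrow> 'h set \<Rightarrow> real" where
  "real_config_weight x V Y T = x ^ card T * (\<Prod>i\<in>{1..m}. V (occupied_marks i (T \<union> \<Phi> ` Y)))"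

lemma config_weight_of_real:
  "config_weight (of_real x) (\<lambda>X. of_real (V X)) Y T = of_real (real_config_weight x V Y T)"
  by (simp add: config_weight_def real_config_weight_def)

text \<open>A nonempty configuration loses against the empty one since it occupies more marks in the copies.
  This gives the empty configuration its share of at least \<open>1 / edge_count_sum x\<close> of the total weight,
  for every \<open>Y\<close>.\<close>

lemma real_config_weight_bounds:
  assumes V: "antitone_weights c V" and x: "0 \<le> x" and Y: "Y \<subseteq> {1..k}" and T: "T \<subseteq> inner_edges"
  shows "0 \<le> real_config_weight x V Y T" "0 < real_config_weight x V Y {}"
    "real_config_weight x V Y T \<le> x ^ card T * real_config_weight x V Y {}"
proof -
  have sub: "occupied_marks i (T' \<union> \<Phi> ` Y) \<subseteq> {1..k}" if "T' \<subseteq> inner_edges" for T' i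
    by (rule occupied_marks_subset[OF config_subset[OF Y that]])
  have pos: "0 < V (occupied_marks i (T' \<union> \<Phi> ` Y))" if "T' \<subseteq> inner_edges" for T' i
    using V sub[OF that] by (simp add: antitone_weights_def)
  show "0 \<le> real_config_weight x V Y T"
    unfolding real_config_weight_def using pos[OF T] x by (intro mult_nonneg_nonneg prod_nonneg) (auto intro: less_imp_le)
  show "0 < real_config_weight x V Y {}"
    unfolding real_config_weight_def using pos[of "{}"] by (auto intro: prod_pos)
  have "V (occupied_marks i (T \<union> \<Phi> ` Y)) \<le> V (occupied_marks i ({} \<union> \<Phi> ` Y))" for i
    using V by (rule antitone_weights_mono) (use sub[OF T] in \<open>auto simp: occupied_marks_def\<close>)
  then show "real_config_weight x V Y T \<le> x ^ card T * real_config_weight x V Y {}"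
    unfolding real_config_weight_def using x pos[OF T]
    by (auto intro!: mult_left_mono prod_mono intro: less_imp_le)
qed

definition real_transfer :: "real \<Rightarrow> (nat set \<Rightarrow> real) \<Rightarrow> nat set \<Rightarrow> real" where
  "real_transfer x V Y = (\<Sum>T\<in>Pow inner_edges. real_config_weight x V Y T)"

lemma transfer_of_real:
  "transfer (of_real x) (\<lambda>X. of_real (V X)) Y = of_real (real_transfer x V Y)"
  by (simp add: transfer_def real_transfer_def config_weight_of_real)

lemma real_transfer_bounds:
  assumes V: "antitone_weights c V" and x: "0 \<le> x" and Y: "Y \<subseteq> {1..k}"
  shows "0 < real_transfer x V Y" "real_config_weight x V Y {} \<le> real_transfer x V Y"
    "real_transfer x V Y \<le> edge_count_sum x * real_config_weight x V Y {}"
proof -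
  note b = real_config_weight_bounds[OF V x Y]
  have "(\<Sum>T\<in>{{}}. real_config_weight x V Y T) \<le> real_transfer x V Y"
    unfolding real_transfer_def using finite_inner_edges b(1) by (intro sum_mono2) auto
  then show 1: "real_config_weight x V Y {} \<le> real_transfer x V Y" by simp
  show "0 < real_transfer x V Y" using b(2)[of "{}"] 1 by simp
  show "real_transfer x V Y \<le> edge_count_sum x * real_config_weight x V Y {}"
    unfolding real_transfer_def edge_count_sum_def sum_distrib_right
    using b(3) by (intro sum_mono) auto
qed

lemma real_tv:
  assumes V: "antitone_weights c V" and x: "0 \<le> x" and Y: "Y \<subseteq> {1..k}"
    and d: "0 \<le> \<delta>" "\<delta> * edge_count_sum x \<le> 1"
  shows "(\<Sum>T\<in>Pow inner_edges. \<bar>real_config_weight x V Y T / real_transfer x V Y - (if T = {} then \<delta> else 0)\<bar>) = 1 - \<delta>"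
proof -
  note b = real_config_weight_bounds[OF V x Y] and t = real_transfer_bounds[OF V x Y]
  have "\<delta> * real_transfer x V Y \<le> \<delta> * (edge_count_sum x * real_config_weight x V Y {})"
    using t(3) d by (intro mult_left_mono) auto
  also have "\<dots> \<le> 1 * real_config_weight x V Y {}"
    using d(2) b(2)[of "{}"] by (simp only: mult.assoc[symmetric]) (intro mult_right_mono, auto)
  finally have "\<delta> \<le> real_config_weight x V Y {} / real_transfer x V Y"
    using t(1) by (simp add: field_simps)
  then have "(\<Sum>T\<in>Pow inner_edges. \<bar>real_config_weight x V Y T / real_transfer x V Y - (if T = {} then \<delta> else 0)\<bar>)
     = (\<Sum>T\<in>Pow inner_edges. real_config_weight x V Y T / real_transfer x V Y - (if T = {} then \<delta> else 0))"
    using b(1) t(1) by (intro sum.cong refl) auto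
  also have "\<dots> = 1 - \<delta>"
    using t(1) finite_inner_edges
    by (simp add: sum_subtractf sum_divide_distrib[symmetric] real_transfer_def)
  finally show ?thesis .
qed

lemma nearly_positive_real:
  assumes V: "antitone_weights c V" and x: "0 \<le> x" and d: "0 \<le> \<delta>" "\<delta> * edge_count_sum x \<le> 1"
  shows "nearly_positive \<delta> 0 (of_real x) (\<lambda>X. of_real (V X))"
  unfolding nearly_positive_def
proof (intro allI impI conjI)
  fix Y assume Y: "Y \<subseteq> {1..k}"
  show "transfer (of_real x) (\<lambda>X. of_real (V X)) Y \<noteq> 0"
    using real_transfer_bounds(1)[OF V x Y] by (simp add: transfer_of_real)
  have "norm (config_weight (of_real x) (\<lambda>X. of_real (V X)) Y T / transfer (of_real x) (\<lambda>X. of_real (V X)) Y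
        - (if T = {} then of_real \<delta> else 0))
      = \<bar>real_config_weight x V Y T / real_transfer x V Y - (if T = {} then \<delta> else 0)\<bar>" for T
  proof -
    have "config_weight (of_real x) (\<lambda>X. of_real (V X)) Y T / transfer (of_real x) (\<lambda>X. of_real (V X)) Y
        - (if T = {} then of_real \<delta> else 0)
      = complex_of_real (real_config_weight x V Y T / real_transfer x V Y - (if T = {} then \<delta> else 0))"
      by (simp add: config_weight_of_real transfer_of_real)
    then show ?thesis by (simp only: norm_of_real)
  qed
  then show "(\<Sum>T\<in>Pow inner_edges. norm (config_weight (of_real x) (\<lambda>X. of_real (V X)) Y T /
      transfer (of_real x) (\<lambda>X. of_real (V X)) Y - (if T = {} then of_real \<delta> else 0))) \<le> 1 - \<delta> + 0"
    using real_tv[OF V x Y d] by simp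
qed

lemma norm_power_diff_le:
  fixes z w :: complex and A d :: real
  assumes "norm z \<le> A" "norm w \<le> A" "1 \<le> A" "norm (z - w) \<le> d" "n \<le> N"
  shows "norm (z ^ n - w ^ n) \<le> N * A ^ N * d"
proof -
  have d: "0 \<le> d" using assms(4) norm_ge_zero order_trans by blast
  have "norm ((\<Prod>i<n. z) - (\<Prod>i<n. w)) \<le> card {..<n} * A ^ (card {..<n} - 1) * d"
    using assms d by (intro norm_prod_diff_le) auto
  also have "\<dots> \<le> N * A ^ N * d"
    using assms d by (intro mult_mono mult_right_mono power_increasing) auto
  finally show ?thesis by simp
qed

text \<open>Normalized weights are products of ratios, so closeness of the ratios is inherited.\<close>

lemma normalized_weight_close:
  assumes V: "antitone_weights c V" and c: "0 \<le> c" "c \<le> 1" and W: "nonvanishing W" and b: "0 \<le> \<beta>" "\<beta> \<le> 1"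
    and close: "\<And>a X. a \<in> {1..k} \<Longrightarrow> X \<subseteq> {1..k} - {a} \<Longrightarrow> norm (ratio W a X - of_real (V (insert a X) / V X)) \<le> \<beta>"
    and X: "X \<subseteq> {1..k}"
  shows "norm (W X / W {} - of_real (V X / V {})) \<le> 3 ^ card X * \<beta>"
    and "c ^ card X \<le> V X / V {}" and "V X / V {} \<le> 1"
proof -
  have fin: "finite X" using X finite_subset by blast
  have pos: "0 < V X" if "X \<subseteq> {1..k}" for X using V that by (simp add: antitone_weights_def)
  from fin X have "norm (W X / W {} - of_real (V X / V {})) \<le> 3 ^ card X * \<beta> \<and> c ^ card X \<le> V X / V {} \<and> V X / V {} \<le> 1"
  proof (induction X rule: finite_induct)
    case empty
    have "W {} \<noteq> 0" "V {} \<noteq> 0" using W pos[of "{}"] by (auto simp: nonvanishing_def)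
    then show ?case using b by simp
  next
    case (insert a X)
    let ?y = "V X / V {}" and ?r = "V (insert a X) / V X"
    have XK: "X \<subseteq> {1..k}" "a \<in> {1..k}" "X \<subseteq> {1..k} - {a}" using insert by auto
    have nz: "W X \<noteq> 0" "W {} \<noteq> 0" using W XK by (auto simp: nonvanishing_def)
    have p: "0 < V X" "0 < V {}" using pos XK by auto
    have IH: "norm (W X / W {} - of_real ?y) \<le> 3 ^ card X * \<beta>" "c ^ card X \<le> ?y" "?y \<le> 1"
      using insert XK by auto
    have r: "c \<le> ?r" "?r \<le> 1" using V insert.prems p by (auto simp: antitone_weights_def field_simps)
    have nr: "norm (ratio W a X) \<le> 2"
    proof -
      have "norm (ratio W a X) \<le> norm (ratio W a X - of_real ?r) + norm (complex_of_real ?r)"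
        by (metis diff_add_cancel norm_triangle_ineq)
      also have "norm (complex_of_real ?r) = ?r" using r c unfolding norm_of_real by linarith
      also have "norm (ratio W a X - of_real ?r) + ?r \<le> 1 + 1"
        using order_trans[OF close[OF XK(2,3)] b(2)] r(2) by (rule add_mono)
      finally show ?thesis by simp
    qed
    have y0: "0 \<le> ?y" using p by simp
    have "W (insert a X) / W {} - of_real (V (insert a X) / V {})
        = ratio W a X * (W X / W {} - of_real ?y) + (ratio W a X - of_real ?r) * of_real ?y"
      using nz p by (simp add: ratio_def field_simps)
    also have "norm \<dots> \<le> norm (ratio W a X) * norm (W X / W {} - of_real ?y) + norm (ratio W a X - of_real ?r) * norm (complex_of_real ?y)"
      by (metis norm_mult norm_triangle_ineq)
    also have "\<dots> \<le> 2 * (3 ^ card X * \<beta>) + \<beta> * 1"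
      using nr IH close[OF XK(2,3)] y0 b by (intro add_mono mult_mono) (auto simp only: norm_of_real abs_of_nonneg norm_ge_zero zero_le_mult_iff)
    also have "\<dots> \<le> 3 ^ card (insert a X) * \<beta>"
    proof -
      have "1 * \<beta> \<le> 3 ^ card X * \<beta>" using b by (intro mult_right_mono) auto
      then show ?thesis using insert.hyps by (simp add: mult.commute)
    qed
    finally have 1: "norm (W (insert a X) / W {} - of_real (V (insert a X) / V {})) \<le> 3 ^ card (insert a X) * \<beta>" .
    have e: "V (insert a X) / V {} = ?r * ?y" using p by simp
    have "c * c ^ card X \<le> ?r * ?y" using r IH c by (intro mult_mono) auto
    moreover have "?r * ?y \<le> 1" using r IH y0 by (intro mult_le_one) auto
    moreover have "c ^ card (insert a X) = c * c ^ card X" using insert.hyps by simp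
    ultimately show ?case using 1 unfolding e by (intro conjI) (simp_all only:)
  qed
  then show "norm (W X / W {} - of_real (V X / V {})) \<le> 3 ^ card X * \<beta>"
    and "c ^ card X \<le> V X / V {}" and "V X / V {} \<le> 1" by blast+
qed

lemma config_weight_scale:
  "config_weight z (\<lambda>X. W X / u) Y T = config_weight z W Y T / u ^ m"
  by (simp add: config_weight_def prod_dividef)

text \<open>Weights matter only up to a common factor, which allows one to normalize them to \<open>1\<close> at the empty set.\<close>

lemma nearly_positive_scale:
  assumes "u \<noteq> 0" "nearly_positive \<delta> \<eta> z (\<lambda>X. W X / u)"
  shows "nearly_positive \<delta> \<eta> z W"
proof -
  have t: "transfer z (\<lambda>X. W X / u) Y = transfer z W Y / u ^ m" for Y
    by (simp add: transfer_def config_weight_scale sum_divide_distrib)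
  show ?thesis
    using assms unfolding nearly_positive_def t config_weight_scale by simp
qed

lemma config_weight_close:
  fixes A \<epsilon> :: real
  assumes A: "1 \<le> A" "norm z \<le> A" "\<bar>x\<bar> \<le> A" and e: "0 \<le> \<epsilon>" "norm (z - of_real x) \<le> \<epsilon>"
    and w: "\<And>X. X \<subseteq> {1..k} \<Longrightarrow> norm (w X - of_real (y X)) \<le> \<epsilon>"
      "\<And>X. X \<subseteq> {1..k} \<Longrightarrow> norm (w X) \<le> 2" "\<And>X. X \<subseteq> {1..k} \<Longrightarrow> \<bar>y X\<bar> \<le> 1"
    and Y: "Y \<subseteq> {1..k}" and T: "T \<subseteq> inner_edges"
  shows "norm (config_weight z w Y T - of_real (real_config_weight x y Y T))
    \<le> A ^ card inner_edges * (m * 2 ^ m + card inner_edges) * \<epsilon>"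
proof -
  let ?e = "card inner_edges"
  let ?S = "\<lambda>i. occupied_marks i (T \<union> \<Phi> ` Y)"
  define P where "P = (\<Prod>i\<in>{1..m}. w (?S i))"
  define Q where "Q = (\<Prod>i\<in>{1..m}. complex_of_real (y (?S i)))"
  have sub: "?S i \<subseteq> {1..k}" for i by (rule occupied_marks_subset[OF config_subset[OF Y T]])
  have cT: "card T \<le> ?e" using T finite_inner_edges by (rule card_mono[rotated])
  have PQ: "norm (P - Q) \<le> m * 2 ^ m * \<epsilon>"
  proof -
    have "norm (P - Q) \<le> real (card {1..m}) * 2 ^ (card {1..m} - 1) * \<epsilon>"
      unfolding P_def Q_def
    proof (rule norm_prod_diff_le)
      fix i
      show "norm (complex_of_real (y (?S i))) \<le> 2"
        using w(3)[OF sub[of i]] by simp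
    qed (use w sub e in auto)
    also have "\<dots> \<le> m * 2 ^ m * \<epsilon>"
    proof -
      have "(2::real) ^ (card {1..m} - 1) \<le> 2 ^ m" by (intro power_increasing) auto
      then have "real m * 2 ^ (card {1..m} - 1) \<le> real m * 2 ^ m" by (rule mult_left_mono) simp
      then show ?thesis using e(1) by (simp add: mult_right_mono)
    qed
    finally show ?thesis .
  qed
  have Q1: "norm Q \<le> 1"
    unfolding Q_def prod_norm[symmetric] using w(3) sub by (intro prod_le_1) auto
  have zT: "norm (z ^ card T) \<le> A ^ ?e"
  proof -
    have "norm (z ^ card T) \<le> A ^ card T" using A by (simp add: norm_power power_mono)
    also have "\<dots> \<le> A ^ ?e" using A cT by (intro power_increasing) auto
    finally show ?thesis .
  qed
  have "norm (z ^ card T - of_real x ^ card T) \<le> ?e * A ^ ?e * \<epsilon>"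
    using A e cT by (intro norm_power_diff_le) auto
  note zx = this
  have "config_weight z w Y T - of_real (real_config_weight x y Y T)
      = z ^ card T * (P - Q) + (z ^ card T - of_real x ^ card T) * Q"
    by (simp add: config_weight_def real_config_weight_def P_def Q_def algebra_simps)
  also have "norm \<dots> \<le> norm (z ^ card T) * norm (P - Q) + norm (z ^ card T - of_real x ^ card T) * norm Q"
    by (metis norm_mult norm_triangle_ineq)
  also have "\<dots> \<le> A ^ ?e * (m * 2 ^ m * \<epsilon>) + (?e * A ^ ?e * \<epsilon>) * 1"
    using zT PQ zx Q1 e A by (intro add_mono mult_mono) auto
  finally show ?thesis by (simp add: algebra_simps)
qed

text \<open>The lower bound \<open>s\<close> keeps the real normalization above \<open>s ^ m\<close>, so that dividing by the
  complex one is harmless.\<close>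

lemma nearly_positive_close:
  fixes C :: real
  assumes V: "antitone_weights c y" and y: "\<And>X. X \<subseteq> {1..k} \<Longrightarrow> s \<le> y X" "0 < s"
    and x: "0 \<le> x" and d: "0 \<le> \<delta>" "\<delta> * edge_count_sum x \<le> 1"
    and C: "\<And>Y T. Y \<subseteq> {1..k} \<Longrightarrow> T \<subseteq> inner_edges \<Longrightarrow>
      norm (config_weight z w Y T - of_real (real_config_weight x y Y T)) \<le> C" "0 \<le> C"
    and small: "4 ^ card inner_edges * 4 * C \<le> s ^ m * \<eta>" and eta: "\<eta> \<le> 1"
  shows "nearly_positive \<delta> \<eta> z w"
  unfolding nearly_positive_def
proof (intro allI impI)
  fix Y assume Y: "Y \<subseteq> {1..k}"
  let ?M = "real (card (Pow inner_edges))"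
  define b where "b = config_weight z w Y"
  define r where "r = real_config_weight x y Y"
  define S where "S = transfer z w Y"
  define R where "R = real_transfer x y Y"
  note rb = real_config_weight_bounds[OF V x Y] and t = real_transfer_bounds[OF V x Y]
  have M: "?M = 2 ^ card inner_edges" using finite_inner_edges by (simp add: card_Pow)
  have M1: "1 \<le> ?M" unfolding M by simp
  have MM: "?M * ?M = 4 ^ card inner_edges"
    by (simp only: M power_mult_distrib[symmetric]) simp
  have Rs: "s ^ m \<le> R"
  proof -
    have "(\<Prod>i\<in>{1..m}. s) \<le> real_config_weight x y Y {}"
    proof -
      have "s \<le> y (occupied_marks i ({} \<union> \<Phi> ` Y))" for i
        by (intro y occupied_marks_subset config_subset Y) simp
      then have "(\<Prod>i\<in>{1..m}. s) \<le> (\<Prod>i\<in>{1..m}. y (occupied_marks i ({} \<union> \<Phi> ` Y)))"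
        using y(2) by (intro prod_mono) (simp add: less_imp_le)
      then show ?thesis by (simp only: real_config_weight_def card.empty power_0 mult_1)
    qed
    then show ?thesis using t(2) by (simp add: R_def)
  qed
  have sm: "0 < s ^ m" using y by simp
  have br: "norm (b T - of_real (r T)) \<le> C" if "T \<in> Pow inner_edges" for T
    using C Y that by (simp add: b_def r_def)
  have "S - of_real R = (\<Sum>T\<in>Pow inner_edges. b T - of_real (r T))"
    by (simp add: S_def R_def transfer_def real_transfer_def b_def r_def sum_subtractf)
  also have "norm \<dots> \<le> (\<Sum>T\<in>Pow inner_edges. C)" by (rule sum_norm_le) (rule br)
  finally have SR: "norm (S - of_real R) \<le> ?M * C" by simp
  have MC: "?M * C * 4 \<le> s ^ m"
  proof -
    have "?M * C * 4 \<le> ?M * (?M * C * 4)" using mult_right_mono[OF M1, of "?M * C * 4"] C(2) by simp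
    also have "\<dots> = 4 ^ card inner_edges * 4 * C" unfolding MM[symmetric] by simp
    also have "\<dots> \<le> s ^ m * \<eta>" by (rule small)
    also have "\<dots> \<le> s ^ m * 1" using sm eta by (intro mult_left_mono) auto
    finally show ?thesis by simp
  qed
  have Rpos: "0 < R" using t(1) by (simp add: R_def)
  have "R \<le> norm S + norm (S - of_real R)"
    using norm_triangle_ineq2[of "complex_of_real R" S] Rpos by (simp add: norm_minus_commute)
  then have S2: "R / 2 \<le> norm S" using SR MC Rs norm_ge_zero[of S] by linarith
  then have S0: "S \<noteq> 0" using Rpos by auto
  have diff: "norm (b T / S - of_real (r T / R)) \<le> (1 + ?M) * C * 2 / s ^ m" if T: "T \<in> Pow inner_edges" for T
  proof -
    have rT: "0 \<le> r T" "r T \<le> R"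
    proof -
      show "0 \<le> r T" using rb(1) T by (simp add: r_def)
      show "r T \<le> R" unfolding R_def r_def real_transfer_def
        using T rb(1) finite_inner_edges by (intro member_le_sum) auto
    qed
    have "b T / S - of_real (r T / R) = ((b T - of_real (r T)) + of_real (r T / R) * (of_real R - S)) / S"
      using S0 Rpos by (simp add: field_simps)
    also have "norm \<dots> \<le> (C + 1 * (?M * C)) / norm S"
      unfolding norm_divide
    proof (intro divide_right_mono order_trans[OF norm_triangle_ineq] add_mono br[OF T])
      show "norm (of_real (r T / R) * (of_real R - S)) \<le> 1 * (?M * C)"
        unfolding norm_mult norm_of_real using rT Rpos SR
        by (intro mult_mono) (auto simp: norm_minus_commute)
    qed simp
    also have "\<dots> \<le> (C + 1 * (?M * C)) / (s ^ m / 2)"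
      using S2 Rs sm C(2) S0 by (intro divide_left_mono) (auto simp: zero_less_mult_iff)
    finally show ?thesis by (simp add: algebra_simps)
  qed
  have "(\<Sum>T\<in>Pow inner_edges. norm (b T / S - (if T = {} then of_real \<delta> else 0)))
     \<le> (\<Sum>T\<in>Pow inner_edges. (1 + ?M) * C * 2 / s ^ m + \<bar>r T / R - (if T = {} then \<delta> else 0)\<bar>)"
  proof (rule sum_mono)
    fix T assume T: "T \<in> Pow inner_edges"
    have "b T / S - (if T = {} then of_real \<delta> else 0)
        = (b T / S - of_real (r T / R)) + of_real (r T / R - (if T = {} then \<delta> else 0))" by simp
    also have "norm \<dots> \<le> (1 + ?M) * C * 2 / s ^ m + \<bar>r T / R - (if T = {} then \<delta> else 0)\<bar>"
      using diff[OF T] by (intro order_trans[OF norm_triangle_ineq] add_mono) (simp_all only: norm_of_real order_refl)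
    finally show "norm (b T / S - (if T = {} then of_real \<delta> else 0))
        \<le> (1 + ?M) * C * 2 / s ^ m + \<bar>r T / R - (if T = {} then \<delta> else 0)\<bar>" .
  qed
  also have "\<dots> = ?M * ((1 + ?M) * C * 2 / s ^ m) + (1 - \<delta>)"
    using real_tv[OF V x Y d] by (simp add: sum.distrib r_def R_def)
  also have "?M * ((1 + ?M) * C * 2 / s ^ m) \<le> \<eta>"
  proof -
    have "?M * ((1 + ?M) * C * 2) \<le> ?M * ((?M + ?M) * C * 2)"
      using M1 C(2) by (intro mult_left_mono mult_right_mono) auto
    also have "\<dots> = 4 ^ card inner_edges * 4 * C" unfolding MM[symmetric] by (simp add: algebra_simps)
    finally show ?thesis using small sm by (simp add: field_simps)
  qed
  finally show "transfer z w Y \<noteq> 0 \<and> (\<Sum>T\<in>Pow inner_edges. norm (config_weight z w Y T / transfer z w Y -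
        (if T = {} then of_real \<delta> else 0))) \<le> 1 - \<delta> + \<eta>"
    using S0 by (simp add: b_def S_def)
qed

text \<open>There is a uniform radius \<open>\<beta>\<close>: whatever the real weights with constant \<open>c\<close> are, complex weights whose
  ratios are within \<open>\<beta>\<close> of theirs yield nearly positive configuration weights and a nonzero total
  partition function. This is what converts closeness to the real orbit into absence of zeros.\<close>

lemma stable_neighbourhood:
  assumes x: "0 \<le> x" and c: "0 < c" "c \<le> 1" and d: "0 \<le> \<delta>" "\<delta> * edge_count_sum x \<le> 1"
    and eta: "0 < \<eta>" "\<eta> \<le> 1"
  shows "\<exists>\<beta>>0. \<forall>z W V. norm (z - of_real x) \<le> \<beta> \<longrightarrow> antitone_weights c V \<longrightarrow> nonvanishing W \<longrightarrow>
    (\<forall>a\<in>{1..k}. \<forall>X\<subseteq>{1..k} - {a}. norm (ratio W a X - of_real (V (insert a X) / V X)) \<le> \<beta>) \<longrightarrow>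
    nearly_positive \<delta> \<eta> z W \<and> (\<Sum>X\<in>Pow {1..k}. z ^ card X * W X) \<noteq> 0"
proof -
  let ?e = "card inner_edges"
  define A where "A = x + 1"
  define C1 where "C1 = A ^ ?e * (m * 2 ^ m + ?e) * 3 ^ k"
  define C2 where "C2 = 2 ^ k * (A ^ k * 3 ^ k + k * A ^ k)"
  have A: "1 \<le> A" using x by (simp add: A_def)
  have C: "0 \<le> C1" "0 \<le> C2" using A by (simp_all add: C1_def C2_def)
  let ?s = "c ^ k"
  have s: "0 < ?s ^ m" using c by simp
  \<comment> \<open>The three bounds give, in this order, normalized weights of norm at most \<open>2\<close>, near positivity, and a total partition function at distance less than \<open>1\<close> from a real one that is at least \<open>1\<close>.\<close>
  define \<beta> where "\<beta> = min (1 / 3 ^ k) (min (?s ^ m * \<eta> / (4 ^ ?e * 4 * C1 + 1)) (1 / (2 * C2 + 1)))"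
  have b0: "0 < \<beta>" using C s eta by (simp add: \<beta>_def add_nonneg_pos)
  have b1: "3 ^ k * \<beta> \<le> 1"
  proof -
    have "\<beta> \<le> 1 / 3 ^ k" by (simp add: \<beta>_def)
    then show ?thesis by (simp add: field_simps)
  qed
  have b2: "4 ^ ?e * 4 * (C1 * \<beta>) \<le> ?s ^ m * \<eta>"
  proof -
    have "\<beta> \<le> ?s ^ m * \<eta> / (4 ^ ?e * 4 * C1 + 1)" by (simp add: \<beta>_def)
    then have "(4 ^ ?e * 4 * C1 + 1) * \<beta> \<le> ?s ^ m * \<eta>"
      using C(1) by (simp add: pos_le_divide_eq add_nonneg_pos mult.commute)
    then show ?thesis using b0 by (simp add: algebra_simps)
  qed
  have b3: "C2 * \<beta> < 1"
  proof -
    have "\<beta> \<le> 1 / (2 * C2 + 1)" by (simp add: \<beta>_def)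
    then have "(2 * C2 + 1) * \<beta> \<le> 1"
      using C(2) by (simp add: pos_le_divide_eq add_nonneg_pos mult.commute)
    moreover have "C2 * \<beta> \<le> 2 * C2 * \<beta>" using C(2) b0 by simp
    ultimately show ?thesis using b0 by (simp add: algebra_simps)
  qed
  have b31: "\<beta> \<le> 3 ^ k * \<beta>" using b0 by (simp add: mult_le_cancel_right1)
  then have b4: "\<beta> \<le> 1" using b1 by simp
  have main: "nearly_positive \<delta> \<eta> z W" "(\<Sum>X\<in>Pow {1..k}. z ^ card X * W X) \<noteq> 0"
    if z: "norm (z - of_real x) \<le> \<beta>" and V: "antitone_weights c V" and W: "nonvanishing W"
      and close: "\<forall>a\<in>{1..k}. \<forall>X\<subseteq>{1..k} - {a}. norm (ratio W a X - of_real (V (insert a X) / V X)) \<le> \<beta>"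
    for z W V
  proof -
    define w where "w X = W X / W {}" for X
    define y where "y X = V X / V {}" for X
    have nz: "W {} \<noteq> 0" using W by (simp add: nonvanishing_def)
    have V0: "0 < V {}" using V by (simp add: antitone_weights_def)
    have yV: "antitone_weights c y"
      using V V0 unfolding antitone_weights_def y_def by (auto simp: divide_right_mono)
    have card: "card X \<le> k" if "X \<subseteq> {1..k}" for X using card_mono[OF _ that] by simp
    have wy: "norm (w X - of_real (y X)) \<le> 3 ^ k * \<beta>" "?s \<le> y X" "y X \<le> 1" if X: "X \<subseteq> {1..k}" for X
    proof -
      note n = normalized_weight_close[OF V less_imp_le[OF c(1)] c(2) W less_imp_le[OF b0] b4 _ X]
      have "norm (w X - of_real (y X)) \<le> 3 ^ card X * \<beta>"
        unfolding w_def y_def using close by (intro n(1)) blast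
      also have "\<dots> \<le> 3 ^ k * \<beta>" using card[OF X] b0 by (intro mult_right_mono power_increasing) auto
      finally show "norm (w X - of_real (y X)) \<le> 3 ^ k * \<beta>" .
      have "?s \<le> c ^ card X" using card[OF X] c by (intro power_decreasing) auto
      also have "\<dots> \<le> y X" unfolding y_def using close by (intro n(2)) blast
      finally show "?s \<le> y X" .
      show "y X \<le> 1" unfolding y_def using close by (intro n(3)) blast
    qed
    have y1: "\<bar>y X\<bar> \<le> 1" if "X \<subseteq> {1..k}" for X
      using wy(2,3)[OF that] zero_le_power[of c k] c by linarith
    have w2: "norm (w X) \<le> 2" if X: "X \<subseteq> {1..k}" for X
    proof -
      have "norm (w X) \<le> norm (w X - of_real (y X)) + norm (complex_of_real (y X))"
        by (metis diff_add_cancel norm_triangle_ineq)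
      also have "\<dots> \<le> 1 + 1" using order_trans[OF wy(1)[OF X] b1] y1[OF X] by (intro add_mono) simp_all
      finally show ?thesis by simp
    qed
    have zA: "norm z \<le> A"
    proof -
      have "norm z \<le> norm (z - of_real x) + norm (complex_of_real x)"
        by (metis diff_add_cancel norm_triangle_ineq)
      then show ?thesis using z b4 x by (simp add: A_def)
    qed
    have xA: "\<bar>x\<bar> \<le> A" using x by (simp add: A_def)
    have "nearly_positive \<delta> \<eta> z w"
    proof (rule nearly_positive_close[OF yV wy(2) _ x d _ _ b2 eta(2)])
      fix Y T assume "Y \<subseteq> {1..k}" "T \<subseteq> inner_edges"
      then have "norm (config_weight z w Y T - of_real (real_config_weight x y Y T))
          \<le> A ^ ?e * (m * 2 ^ m + ?e) * (3 ^ k * \<beta>)"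
        using A zA xA b0 order_trans[OF z b31] wy(1) w2 y1 by (intro config_weight_close) auto
      then show "norm (config_weight z w Y T - of_real (real_config_weight x y Y T)) \<le> C1 * \<beta>"
        by (simp add: C1_def mult.assoc)
    qed (use c C b0 in auto)
    then show "nearly_positive \<delta> \<eta> z W" unfolding w_def by (rule nearly_positive_scale[OF nz])
    have "norm ((\<Sum>X\<in>Pow {1..k}. z ^ card X * w X) - (\<Sum>X\<in>Pow {1..k}. of_real (x ^ card X * y X)))
        \<le> (\<Sum>X\<in>Pow {1..k}. (A ^ k * 3 ^ k + k * A ^ k) * \<beta>)"
      unfolding sum_subtractf[symmetric]
    proof (rule sum_norm_le)
      fix X assume "X \<in> Pow {1..k}"
      then have X: "X \<subseteq> {1..k}" by simp
      have zX: "norm (z ^ card X) \<le> A ^ k"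
      proof -
        have "norm (z ^ card X) \<le> A ^ card X" using zA by (simp add: norm_power power_mono)
        also have "\<dots> \<le> A ^ k" using A card[OF X] by (intro power_increasing) auto
        finally show ?thesis .
      qed
      have zx: "norm (z ^ card X - of_real x ^ card X) \<le> k * A ^ k * \<beta>"
        using zA xA A z card[OF X] by (intro norm_power_diff_le) auto
      have "z ^ card X * w X - of_real (x ^ card X * y X)
          = z ^ card X * (w X - of_real (y X)) + (z ^ card X - of_real x ^ card X) * of_real (y X)"
        by (simp add: algebra_simps)
      also have "norm \<dots> \<le> norm (z ^ card X) * norm (w X - of_real (y X))
          + norm (z ^ card X - of_real x ^ card X) * norm (complex_of_real (y X))"
        by (metis norm_mult norm_triangle_ineq)
      also have "\<dots> \<le> A ^ k * (3 ^ k * \<beta>) + k * A ^ k * \<beta> * 1"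
        using zX zx wy(1)[OF X] y1[OF X] A b0 by (intro add_mono mult_mono) auto
      finally show "norm (z ^ card X * w X - of_real (x ^ card X * y X)) \<le> (A ^ k * 3 ^ k + k * A ^ k) * \<beta>"
        by (simp add: algebra_simps)
    qed
    also have "\<dots> = C2 * \<beta>" by (simp add: C2_def card_Pow)
    finally have diff: "norm ((\<Sum>X\<in>Pow {1..k}. z ^ card X * w X) - of_real (\<Sum>X\<in>Pow {1..k}. x ^ card X * y X)) < 1"
      using b3 by simp
    have "(\<Sum>X\<in>{{}}. x ^ card X * y X) \<le> (\<Sum>X\<in>Pow {1..k}. x ^ card X * y X)"
      using x yV by (intro sum_mono2) (auto simp: antitone_weights_def less_imp_le)
    then have "1 \<le> (\<Sum>X\<in>Pow {1..k}. x ^ card X * y X)" using V0 by (simp add: y_def)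
    then have "(\<Sum>X\<in>Pow {1..k}. z ^ card X * w X) \<noteq> 0" using diff by (auto simp del: of_real_sum)
    then show "(\<Sum>X\<in>Pow {1..k}. z ^ card X * W X) \<noteq> 0"
      using nz by (auto simp: w_def sum_divide_distrib[symmetric])
  qed
  show ?thesis by (rule exI[of _ \<beta>]) (intro conjI allI impI b0 main)
qed

end

section \<open>Contraction of oscillations along the recursion\<close>

text \<open>The oscillation caused by marks that stop influencing \<open>a\<close> within \<open>t\<close> generations is measured relative to
  the weight \<open>1 - (\<delta> / 2) ^ t\<close>. This weight grows from \<open>0\<close> with \<open>t\<close> in such a way that the coupling
  estimate, in which the mass \<open>\<delta>\<close> goes from \<open>t + 1\<close> to \<open>t\<close>, contracts by a common factor in every single step,
  with room for the error \<open>\<eta>\<close>.\<close>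

lemma contraction_factor:
  fixes \<delta> \<eta> :: real
  assumes d: "0 < \<delta>" "\<delta> \<le> 1 / 2" and t: "Suc t \<le> N" and e: "0 \<le> \<eta>" "\<eta> \<le> (\<delta> / 2) ^ N / 8"
  shows "\<delta> * (1 - (\<delta> / 2) ^ t) + (1 - \<delta> + \<eta>)\<^sup>2 / (1 - \<delta>)
    \<le> (1 - (\<delta> / 2) ^ N / 2) * (1 - (\<delta> / 2) ^ Suc t)"
proof -
  define \<kappa> where "\<kappa> = (\<delta> / 2) ^ N"
  define \<tau> where "\<tau> = (\<delta> / 2) ^ Suc t"
  have k: "0 < \<kappa>" "\<kappa> \<le> 1" using d by (auto simp: \<kappa>_def intro!: power_le_one)
  have kt: "\<kappa> \<le> \<tau>" unfolding \<kappa>_def \<tau>_def using d t by (intro power_decreasing) auto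
  have "(1 - \<delta> + \<eta>)\<^sup>2 / (1 - \<delta>) = 1 - \<delta> + 2 * \<eta> + \<eta> * (\<eta> / (1 - \<delta>))"
    using d by (simp add: field_simps power2_eq_square)
  also have "\<eta> * (\<eta> / (1 - \<delta>)) \<le> \<eta> * 1"
  proof -
    have "\<eta> \<le> 1 / 2" using e k by (simp add: \<kappa>_def)
    then show ?thesis using d e by (intro mult_left_mono) (auto simp: divide_le_eq)
  qed
  finally have 1: "(1 - \<delta> + \<eta>)\<^sup>2 / (1 - \<delta>) \<le> 1 - \<delta> + \<kappa> / 2" using e k unfolding \<kappa>_def by linarith
  have 2: "\<delta> * (\<delta> / 2) ^ t = 2 * \<tau>" by (simp add: \<tau>_def)
  have "\<kappa> * \<tau> \<ge> 0" using k kt by simp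
  moreover have "(1 - \<kappa> / 2) * (1 - \<tau>) = 1 - \<tau> - \<kappa> / 2 + \<kappa> * \<tau> / 2" by (simp add: field_simps)
  ultimately have "\<delta> - 2 * \<tau> + (1 - \<delta> + \<kappa> / 2) \<le> (1 - \<kappa> / 2) * (1 - \<tau>)"
    using kt by linarith
  then show ?thesis using 1 2 unfolding \<kappa>_def[symmetric] \<tau>_def[symmetric]
    by (simp add: algebra_simps)
qed

context gluing
begin

lemma osc_le_mono: "osc_le B a d W \<Longrightarrow> d \<le> d' \<Longrightarrow> osc_le B a d' W"
  unfolding osc_le_def by (meson order_trans)

lemma osc_le_cong:
  assumes "\<And>Y. Y \<subseteq> {1..k} \<Longrightarrow> W Y = W' Y" "a \<in> {1..k}" "osc_le B a d W"
  shows "osc_le B a d W'"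
proof -
  have "ratio W a X = ratio W' a X" if "X \<subseteq> {1..k} - {a}" for X
  proof -
    have "insert a X \<subseteq> {1..k}" "X \<subseteq> {1..k}" using that assms(2) by auto
    then show ?thesis by (simp add: ratio_def assms(1))
  qed
  then show ?thesis using assms(3) by (simp add: osc_le_def)
qed

text \<open>A mean of products is at least the power of the minimal factor.\<close>

lemma real_transfer_insert_ge:
  assumes V: "antitone_weights 0 V" and x: "0 \<le> x" and a: "a \<in> {1..k}" "Y \<subseteq> {1..k} - {a}"
    and p: "0 \<le> p" "\<And>S. S \<subseteq> {1..k} - {parent a} \<Longrightarrow> p * V S \<le> V (insert (parent a) S)"
  shows "p ^ card (members H (\<Phi> a)) * real_transfer x V Y \<le> real_transfer x V (insert a Y)"
proof -
  let ?W = "\<lambda>X. complex_of_real (V X)"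
  define R where "R T = (\<Prod>i\<in>members H (\<Phi> a). V (insert (parent a) (occupied_marks i (T \<union> \<Phi> ` Y))) /
    V (occupied_marks i (T \<union> \<Phi> ` Y)))" for T
  have Y: "Y \<subseteq> {1..k}" using a by auto
  have "V X \<noteq> 0" if "X \<subseteq> {1..k}" for X
    using V that unfolding antitone_weights_def by (metis less_irrefl)
  then have nz: "nonvanishing ?W" by (simp add: nonvanishing_def)
  have "complex_of_real (real_transfer x V (insert a Y)) = transfer (of_real x) ?W (insert a Y)"
    by (rule transfer_of_real[symmetric])
  also have "\<dots> = (\<Sum>T\<in>Pow inner_edges. of_real (real_config_weight x V Y T * R T))"
    unfolding transfer_insert[OF nz a]
    by (intro sum.cong) (simp_all add: config_weight_of_real mark_factor_def R_def ratio_def)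
  finally have eq: "real_transfer x V (insert a Y) = (\<Sum>T\<in>Pow inner_edges. real_config_weight x V Y T * R T)"
    unfolding of_real_sum[symmetric] of_real_eq_iff .
  have "p ^ card (members H (\<Phi> a)) \<le> R T" if T: "T \<in> Pow inner_edges" for T
  proof -
    have "(\<Prod>i\<in>members H (\<Phi> a). p) \<le> R T"
      unfolding R_def
    proof (intro prod_mono conjI p(1))
      fix i assume i: "i \<in> members H (\<Phi> a)"
      have S: "occupied_marks i (T \<union> \<Phi> ` Y) \<subseteq> {1..k} - {parent a}"
        using occupied_marks_config[OF a _ i] T by simp
      then have "0 < V (occupied_marks i (T \<union> \<Phi> ` Y))"
        using V by (auto simp: antitone_weights_def)
      then show "p \<le> V (insert (parent a) (occupied_marks i (T \<union> \<Phi> ` Y))) / V (occupied_marks i (T \<union> \<Phi> ` Y))"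
        using p(2)[OF S] by (simp add: pos_le_divide_eq)
    qed
    then show ?thesis by simp
  qed
  then have "(\<Sum>T\<in>Pow inner_edges. real_config_weight x V Y T * p ^ card (members H (\<Phi> a)))
      \<le> real_transfer x V (insert a Y)"
    unfolding eq using real_config_weight_bounds(1)[OF V x Y] by (intro sum_mono mult_left_mono) auto
  then show ?thesis
    by (simp only: real_transfer_def sum_distrib_left mult.commute[of "p ^ card (members H (\<Phi> a))"])
qed

end

text \<open>The analytic core, separated from graphs. \<open>W n z X\<close> are the partition functions and \<open>V\<close> their values at real
  points. \<open>L t a\<close> contains the marks that still influence \<open>a\<close> through common copies after going back
  \<open>t\<close> generations. \<open>F\<close> is the set of isolated marks. \<open>v a\<close> is a weight that
  absorbs the Lipschitz constants of the products along \<open>a\<close>, \<open>parent a\<close>, \<open>\<dots>\<close>, so that distances measured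
  relative to \<open>v\<close> do not grow.\<close>

locale hard_core_recursion = gluing k m H \<Phi>
  for k m and H :: "'h labeled_hypergraph" and \<Phi> +
  fixes W :: "nat \<Rightarrow> complex \<Rightarrow> nat set \<Rightarrow> complex" and V :: "nat \<Rightarrow> real \<Rightarrow> nat set \<Rightarrow> real"
    and L :: "nat \<Rightarrow> nat \<Rightarrow> nat set" and N :: nat and F :: "nat set" and v :: "nat \<Rightarrow> real"
  assumes step: "\<And>n z Y. Y \<subseteq> {1..k} \<Longrightarrow> W (Suc n) z Y = transfer z (W n z) Y"
    and cont: "\<And>n X. continuous_on UNIV (\<lambda>z. W n z X)"
    and W_of_real: "\<And>n x X. W n (of_real x) X = of_real (V n x X)"
    and V_antitone: "\<And>n x. 0 \<le> x \<Longrightarrow> antitone_weights 0 (V n x)"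
    and L_Suc: "\<And>t a b. a \<in> {1..k} \<Longrightarrow> b \<in> {1..k} \<Longrightarrow> b \<noteq> a \<Longrightarrow>
      members H (\<Phi> a) \<inter> members H (\<Phi> b) \<noteq> {} \<Longrightarrow> parent b \<in> L t (parent a) \<Longrightarrow> b \<in> L (Suc t) a"
    and L_N: "\<And>a. a \<in> {1..k} \<Longrightarrow> L N a = {}"
    and separated: "\<And>n z a b X. a \<in> {1..k} \<Longrightarrow> b \<in> {1..k} \<Longrightarrow> b \<noteq> a \<Longrightarrow> b \<notin> L 0 a \<Longrightarrow> X \<subseteq> {1..k} - {a, b} \<Longrightarrow>
      W n z X * W n z (insert a (insert b X)) = W n z (insert a X) * W n z (insert b X)"
    and isolated: "\<And>n z a X. a \<in> F \<Longrightarrow> insert a X \<subseteq> {1..k} \<Longrightarrow> W n z (insert a X) = W n z X"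
    and v_parent: "\<And>a. a \<in> {1..k} - F \<Longrightarrow> parent a \<notin> F \<and> v a = (card (members H (\<Phi> a)))\<^sup>2 * v (parent a)"
    and v_ge_1: "\<And>a. a \<in> {1..k} \<Longrightarrow> 1 \<le> v a"
begin

lemma ratio_Suc:
  assumes "a \<in> {1..k}" "X \<subseteq> {1..k} - {a}"
  shows "ratio (W (Suc n) z) a X = ratio (transfer z (W n z)) a X"
proof -
  have "insert a X \<subseteq> {1..k}" "X \<subseteq> {1..k}" using assms by auto
  then show ?thesis by (simp add: ratio_def step)
qed

text \<open>The base of the hierarchy \<open>L 0 a\<close>, \<open>L 1 a\<close>, \<open>\<dots>\<close>: marks that are never connected with \<open>a\<close> do not influence it.\<close>

lemma osc_separated:
  assumes W: "nonvanishing (W n z)" and a: "a \<in> {1..k}"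
  shows "osc_le (L 0 a) a 0 (W n z)"
proof -
  have *: "ratio (W n z) a (X \<union> D) = ratio (W n z) a X"
    if "finite D" "D \<subseteq> {1..k} - {a} - L 0 a" "X \<subseteq> {1..k} - {a}" for X D
    using that
  proof (induction D rule: finite_induct)
    case empty then show ?case by simp
  next
    case (insert b D)
    have IH: "ratio (W n z) a (X \<union> D) = ratio (W n z) a X" using insert by auto
    show ?case
    proof (cases "b \<in> X")
      case True then show ?thesis using IH by (simp add: insert_absorb)
    next
      case False
      define S where "S = X \<union> D"
      have b: "b \<in> {1..k}" "b \<noteq> a" "b \<notin> L 0 a" using insert.prems by auto
      have S: "S \<subseteq> {1..k} - {a, b}" using insert False by (auto simp: S_def)
      have "insert b S \<subseteq> {1..k}" "S \<subseteq> {1..k}" using S b by auto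
      then have "W n z S \<noteq> 0" "W n z (insert b S) \<noteq> 0" using W by (simp_all add: nonvanishing_def)
      then have "ratio (W n z) a (insert b S) = ratio (W n z) a S"
        using separated[OF a b S] by (simp add: ratio_def field_simps)
      then show ?thesis using IH by (simp add: S_def)
    qed
  qed
  have "ratio (W n z) a X = ratio (W n z) a (X \<inter> L 0 a)" if "X \<subseteq> {1..k} - {a}" for X
  proof -
    have "finite (X - L 0 a)" using that finite_subset[of X "{1..k}"] by blast
    then have "ratio (W n z) a ((X \<inter> L 0 a) \<union> (X - L 0 a)) = ratio (W n z) a (X \<inter> L 0 a)"
      using that by (intro *) auto
    then show ?thesis by (simp add: Int_Diff_Un)
  qed
  then show ?thesis unfolding osc_le_def by simp
qed

lemma ratio_isolated:
  assumes "nonvanishing (W n z)" "a \<in> F" "insert a X \<subseteq> {1..k}"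
  shows "ratio (W n z) a X = 1"
  using assms isolated[of a X n z] by (simp add: ratio_def nonvanishing_def)

lemma contraction_step:
  fixes \<delta> \<eta> \<epsilon> B :: real
  assumes W: "nonvanishing (W n z)" and np: "nearly_positive \<delta> \<eta> z (W n z)"
    and d: "0 < \<delta>" "\<delta> \<le> 1 / 2" and e: "0 \<le> \<eta>" "\<eta> \<le> (\<delta> / 2) ^ N / 8" "0 \<le> \<epsilon>"
    and B: "1 \<le> B" "B ^ m \<le> 2" "\<And>a X. a \<in> {1..k} \<Longrightarrow> X \<subseteq> {1..k} - {a} \<Longrightarrow> norm (ratio (W n z) a X) \<le> B"
    and osc: "\<And>t a. t \<le> N \<Longrightarrow> a \<in> {1..k} - F \<Longrightarrow> osc_le (L t a) a (\<epsilon> * (1 - (\<delta> / 2) ^ t) * v a) (W n z)"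
    and t: "t \<le> N" and a: "a \<in> {1..k} - F"
  shows "osc_le (L t a) a ((1 - (\<delta> / 2) ^ N / 2) * \<epsilon> * (1 - (\<delta> / 2) ^ t) * v a) (W (Suc n) z)"
proof (cases t)
  case 0
  have "nonvanishing (W (Suc n) z)" using np by (simp add: nonvanishing_def nearly_positive_def step)
  from osc_separated[OF this] show ?thesis using a 0 by simp
next
  case (Suc s)
  let ?b = "parent a" and ?q = "card (members H (\<Phi> a))"
  let ?\<theta> = "\<lambda>t. 1 - (\<delta> / 2) ^ t"
  have ak: "a \<in> {1..k}" using a by simp
  have b: "?b \<in> {1..k} - F" using v_parent[OF a] mark_edge(5)[OF ak] by simp
  have vb: "1 \<le> v ?b" using v_ge_1 b by simp
  have th: "0 \<le> ?\<theta> r" "?\<theta> r \<le> 1" for r using d by (auto intro!: power_le_one)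
  have s: "s \<le> N" "Suc s \<le> N" using Suc t by auto
  have "osc_le {} ?b (\<epsilon> * ?\<theta> N * v ?b) (W n z)" using osc[of N ?b] b L_N by simp
  then have o1: "osc_le {} ?b (\<epsilon> * v ?b) (W n z)"
    by (rule osc_le_mono) (use th[of N] e vb in \<open>auto intro!: mult_right_mono simp: mult_left_le\<close>)
  have "osc_le (L t a) a (?q\<^sup>2 * (\<delta> * (\<epsilon> * ?\<theta> s * v ?b) + (1 - \<delta> + \<eta>)\<^sup>2 / (1 - \<delta>) * (\<epsilon> * v ?b)))
      (transfer z (W n z))"
    using W np
  proof (rule osc_transfer)
    show "osc_le (L s ?b) ?b (\<epsilon> * ?\<theta> s * v ?b) (W n z)" using osc[OF s(1)] b by simp
    show "osc_le {} ?b (\<epsilon> * v ?b) (W n z)" by (rule o1)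
    show "norm (ratio (W n z) ?b X) \<le> B" if "X \<subseteq> {1..k} - {?b}" for X using B(3) b that by simp
    show "c \<in> L t a" if "c \<in> {1..k}" "c \<noteq> a" "members H (\<Phi> a) \<inter> members H (\<Phi> c) \<noteq> {}" "parent c \<in> L s ?b" for c
      unfolding Suc using ak that by (intro L_Suc)
  qed (use d e B vb th[of s] ak in auto)
  then have "osc_le (L t a) a (?q\<^sup>2 * (\<delta> * (\<epsilon> * ?\<theta> s * v ?b) + (1 - \<delta> + \<eta>)\<^sup>2 / (1 - \<delta>) * (\<epsilon> * v ?b))) (W (Suc n) z)"
    by (rule osc_le_cong[rotated 2]) (use ak step in auto)
  moreover have "?q\<^sup>2 * (\<delta> * (\<epsilon> * ?\<theta> s * v ?b) + (1 - \<delta> + \<eta>)\<^sup>2 / (1 - \<delta>) * (\<epsilon> * v ?b))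
      \<le> (1 - (\<delta> / 2) ^ N / 2) * \<epsilon> * ?\<theta> t * v a"
  proof -
    have "?q\<^sup>2 * (\<delta> * (\<epsilon> * ?\<theta> s * v ?b) + (1 - \<delta> + \<eta>)\<^sup>2 / (1 - \<delta>) * (\<epsilon> * v ?b))
        = (\<delta> * ?\<theta> s + (1 - \<delta> + \<eta>)\<^sup>2 / (1 - \<delta>)) * (\<epsilon> * v a)"
      using v_parent[OF a] by (simp add: algebra_simps)
    also have "\<dots> \<le> ((1 - (\<delta> / 2) ^ N / 2) * ?\<theta> (Suc s)) * (\<epsilon> * v a)"
      using contraction_factor[OF d s(2) e(1,2)] e(3) v_ge_1[OF ak] by (intro mult_right_mono) auto
    also have "\<dots> = (1 - (\<delta> / 2) ^ N / 2) * \<epsilon> * ?\<theta> t * v a" by (simp only: Suc mult_ac)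
    finally show ?thesis .
  qed
  ultimately show ?thesis by (rule osc_le_mono)
qed

lemma V_Suc:
  assumes "Y \<subseteq> {1..k}" shows "V (Suc n) x Y = real_transfer x (V n x) Y"
proof -
  have "complex_of_real (V (Suc n) x Y) = transfer (of_real x) (\<lambda>X. of_real (V n x X)) Y"
    using step[OF assms, of n "of_real x"] by (simp only: W_of_real[abs_def] ext[OF W_of_real])
  then show ?thesis by (simp add: transfer_of_real)
qed

text \<open>The bound \<open>r\<^sub>a \<ge> c0 powr v a\<close> reproduces itself: a product of \<open>q\<close> ratios of \<open>parent a\<close> is at least
  \<open>c0 powr (q * v (parent a))\<close>, and \<open>q * v (parent a) \<le> v a\<close>.\<close>

lemma real_ratio_lower_bound:
  assumes x: "0 \<le> x"
  shows "\<exists>c>0. c \<le> 1 \<and> (\<forall>n. antitone_weights c (V n x))"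
proof -
  define c0 where "c0 = Min ((\<lambda>X. V 0 x X / V 0 x {}) ` Pow {1..k})"
  have pos: "0 < V n x X" if "X \<subseteq> {1..k}" for n X using V_antitone[OF x] that by (simp add: antitone_weights_def)
  have c0: "0 < c0" "c0 \<le> V 0 x X / V 0 x {}" if "X \<subseteq> {1..k}" for X
  proof -
    show "0 < c0" unfolding c0_def
    proof (subst Min_gr_iff)
      show "\<forall>a\<in>(\<lambda>X. V 0 x X / V 0 x {}) ` Pow {1..k}. 0 < a" using pos by (auto intro!: divide_pos_pos)
    qed auto
    show "c0 \<le> V 0 x X / V 0 x {}" using that unfolding c0_def by (intro Min_le) auto
  qed
  have c01: "c0 \<le> 1" using c0(2)[of "{}"] pos[of "{}" 0] by simp
  have c0p: "0 < c0" by (rule c0(1)[of "{}"]) simp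
  have main: "c0 powr v a * V n x X \<le> V n x (insert a X)" if "a \<in> {1..k} - F" "X \<subseteq> {1..k} - {a}" for n a X
    using that
  proof (induction n arbitrary: a X)
    case 0
    have "insert a X \<subseteq> {1..k}" "X \<subseteq> {1..k}" using 0 by auto
    have "c0 powr v a \<le> c0 powr 1" using c0p c01 v_ge_1[of a] 0 by (intro powr_mono') auto
    then have "c0 powr v a * V 0 x X \<le> c0 * V 0 x {}"
      using c0p pos antitone_weights_mono[OF V_antitone[OF x], of "{}" X] \<open>X \<subseteq> {1..k}\<close>
      by (intro mult_mono) (auto intro: less_imp_le)
    also have "\<dots> \<le> V 0 x (insert a X)"
      using c0(2)[OF \<open>insert a X \<subseteq> {1..k}\<close>] pos[of "{}" 0] by (simp add: field_simps)
    finally show ?case .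
  next
    case (Suc n)
    let ?b = "parent a" and ?q = "card (members H (\<Phi> a))"
    have ak: "a \<in> {1..k}" using Suc.prems by simp
    have b: "?b \<in> {1..k} - F" using v_parent[of a] Suc.prems mark_edge(5)[OF ak] by simp
    have XK: "X \<subseteq> {1..k}" "insert a X \<subseteq> {1..k}" using Suc.prems by auto
    have "(c0 powr v ?b) ^ ?q * V (Suc n) x X \<le> V (Suc n) x (insert a X)"
      unfolding V_Suc[OF XK(1)] V_Suc[OF XK(2)]
      by (rule real_transfer_insert_ge[OF V_antitone[OF x] x ak Suc.prems(2) _ Suc.IH[OF b]]) auto
    moreover have "c0 powr v a \<le> (c0 powr v ?b) ^ ?q"
    proof -
      have "?q * v ?b \<le> v a"
      proof -
        have "real ?q * 1 \<le> real ?q * real ?q"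
          using mark_edge(6)[OF ak] by (intro mult_left_mono) auto
        then have "?q * v ?b \<le> ?q\<^sup>2 * v ?b" using v_ge_1[of ?b] b
          by (intro mult_right_mono) (auto simp: power2_eq_square)
        then show ?thesis using v_parent[of a] Suc.prems by simp
      qed
      then have "c0 powr v a \<le> c0 powr (?q * v ?b)" using c0p c01 by (intro powr_mono') auto
      also have "\<dots> = (c0 powr v ?b) ^ ?q" using c0p by (simp add: powr_power mult.commute)
      finally show ?thesis .
    qed
    moreover have "0 < V (Suc n) x X" using Suc.prems by (intro pos) auto
    ultimately show ?case by (meson mult_right_mono less_imp_le order_trans)
  qed
  define c where "c = c0 powr (\<Sum>a\<in>{1..k}. v a)"
  have cv: "c \<le> c0 powr v a" if "a \<in> {1..k}" for a
  proof -
    have "v a \<le> (\<Sum>a\<in>{1..k}. v a)" using that v_ge_1 by (intro member_le_sum) force+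
    then show ?thesis unfolding c_def using c0p c01 by (intro powr_mono') auto
  qed
  have c: "0 < c" "c \<le> 1"
  proof -
    show "0 < c" using c0p by (simp add: c_def)
    have "0 \<le> (\<Sum>a\<in>{1..k}. v a)" using v_ge_1 by (intro sum_nonneg) force
    then have "c \<le> c0 powr 0" unfolding c_def using c0p c01 by (intro powr_mono') auto
    then show "c \<le> 1" using c0p by simp
  qed
  have "c * V n x X \<le> V n x (insert a X)" if X: "insert a X \<subseteq> {1..k}" for n a X
  proof -
    have p: "0 < V n x X" using X pos by auto
    consider "a \<in> X" | "a \<in> F" | "a \<in> {1..k} - F" "X \<subseteq> {1..k} - {a}" using X by blast
    then show ?thesis
    proof cases
      case 1 then show ?thesis using p c by (simp add: insert_absorb)
    next
      case 2
      have "V n x (insert a X) = V n x X"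
        using isolated[OF 2 X, of n "of_real x"] by (simp add: W_of_real)
      then show ?thesis using p c by simp
    next
      case 3
      have "c * V n x X \<le> c0 powr v a * V n x X" using cv[of a] 3 p by (intro mult_right_mono) auto
      then show ?thesis using main[OF 3, of n] by simp
    qed
  qed
  then have "antitone_weights c (V n x)" for n
    using V_antitone[OF x, of n] by (auto simp: antitone_weights_def)
  then show ?thesis using c by blast
qed

text \<open>Real ratios lie in \<open>[0, 1]\<close>, so the estimate starts with the constant \<open>2\<close> without any smallness
  assumption. The weight \<open>1 - (\<delta> / 2) ^ t\<close> is at least \<open>1 / 2\<close> for \<open>t > 0\<close>.\<close>

lemma real_oscillation_decay:
  assumes x: "0 \<le> x" and d: "0 < \<delta>" "\<delta> \<le> 1 / 2" "\<delta> * edge_count_sum x \<le> 1"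
    and t: "t \<le> N" and a: "a \<in> {1..k} - F"
  shows "osc_le (L t a) a (2 * (1 - (\<delta> / 2) ^ N / 2) ^ n * (1 - (\<delta> / 2) ^ t) * v a) (W n (of_real x))"
  using t a
proof (induction n arbitrary: t a)
  case 0
  have nz: "nonvanishing (W 0 (of_real x))"
    using V_antitone[OF x, of 0] by (auto simp: nonvanishing_def W_of_real antitone_weights_def)
  have ak: "a \<in> {1..k}" using 0 by simp
  show ?case
  proof (cases t)
    case z: 0
    show ?thesis using osc_separated[OF nz ak] by (simp add: z)
  next
    case (Suc s)
    have "(\<delta> / 2) ^ t \<le> (\<delta> / 2) ^ 1" unfolding Suc using d by (intro power_decreasing) auto
    then have th: "1 / 2 \<le> 1 - (\<delta> / 2) ^ t" using d by simp
    have "2 * (1 / 2) * 1 \<le> 2 * (1 - (\<delta> / 2) ^ t) * v a"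
      using th v_ge_1[OF ak] by (intro mult_mono) auto
    moreover have "osc_le (L t a) a 1 (W 0 (of_real x))"
      unfolding osc_le_def
    proof (intro allI impI)
      fix X X' assume X: "X \<subseteq> {1..k} - {a}" "X' \<subseteq> {1..k} - {a}"
      define r where "r X = V 0 x (insert a X) / V 0 x X" for X
      have r: "0 \<le> r X \<and> r X \<le> 1" if "X \<subseteq> {1..k} - {a}" for X
      proof -
        have "insert a X \<subseteq> {1..k}" "X \<subseteq> {1..k}" using that ak by auto
        then have "0 < V 0 x X" "0 < V 0 x (insert a X)" "V 0 x (insert a X) \<le> V 0 x X"
          using V_antitone[OF x, of 0] by (simp_all add: antitone_weights_def)
        then show ?thesis by (simp add: r_def)
      qed
      have "ratio (W 0 (of_real x)) a X - ratio (W 0 (of_real x)) a X' = of_real (r X - r X')"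
        by (simp add: ratio_def W_of_real r_def)
      also have "norm \<dots> \<le> 1" using r[OF X(1)] r[OF X(2)] unfolding norm_of_real by linarith
      finally show "norm (ratio (W 0 (of_real x)) a X - ratio (W 0 (of_real x)) a X') \<le> 1" .
    qed
    ultimately show ?thesis using osc_le_mono by simp
  qed
next
  case (Suc n)
  let ?g = "1 - (\<delta> / 2) ^ N / 2"
  have g: "0 \<le> ?g" using d power_le_one[of "\<delta> / 2" N] by simp
  have nz: "nonvanishing (W n (of_real x))"
    using V_antitone[OF x, of n] by (auto simp: nonvanishing_def W_of_real antitone_weights_def)
  have np: "nearly_positive \<delta> 0 (of_real x) (W n (of_real x))"
    using nearly_positive_real[OF V_antitone[OF x] x less_imp_le[OF d(1)] d(3), of n]
    by (simp only: ext[OF W_of_real])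
  have "osc_le (L t a) a (?g * (2 * ?g ^ n) * (1 - (\<delta> / 2) ^ t) * v a) (W (Suc n) (of_real x))"
  proof (rule contraction_step[OF nz np d(1,2), of _ 1])
    fix c X assume cX: "c \<in> {1..k}" "X \<subseteq> {1..k} - {c}"
    then have "insert c X \<subseteq> {1..k}" "X \<subseteq> {1..k}" by auto
    then have "0 < V n x X" "0 < V n x (insert c X)" "V n x (insert c X) \<le> V n x X"
      using V_antitone[OF x, of n] by (simp_all add: antitone_weights_def)
    then show "norm (ratio (W n (of_real x)) c X) \<le> 1"
      by (simp add: ratio_def W_of_real norm_divide)
  qed (use Suc g d in auto)
  then show ?case by (simp add: mult_ac)
qed

lemma W_tendsto: "((\<lambda>z. W n z Y) \<longlongrightarrow> W n z Y) (nhds z)"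
  using cont[of n Y] tendsto_at_iff_tendsto_nhds[of "\<lambda>z. W n z Y" z]
  by (simp add: continuous_on_eq_continuous_at isCont_def)

lemma continuous_ratio:
  assumes "nonvanishing (W n z)" "a \<in> {1..k}" "X \<subseteq> {1..k} - {a}"
  shows "((\<lambda>z. ratio (W n z) a X) \<longlongrightarrow> ratio (W n z) a X) (nhds z)"
proof -
  have "W n z X \<noteq> 0" using assms by (auto simp: nonvanishing_def)
  then show ?thesis unfolding ratio_def by (intro tendsto_divide W_tendsto)
qed

lemma power_near_1_le_2: "\<exists>b>0. (1 + b :: real) ^ m \<le> 2"
proof (cases "m = 0")
  case False
  define b where "b = root m 2 - 1"
  have "0 < b" using False by (simp add: b_def)
  moreover have "(1 + b) ^ m = 2" using False by (simp add: b_def)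
  ultimately show ?thesis by (intro exI[of _ b]) auto
qed (auto intro: exI[of _ 1])

text \<open>The bootstrap. At a time \<open>n1\<close> the real oscillations are below a small multiple of \<open>\<epsilon>\<close>, and by continuity so are those
  at nearby \<open>z\<close>. The induction claim \<open>near j\<close> says that at time \<open>n1 + j\<close> the oscillations at \<open>z\<close>
  are below \<open>\<epsilon> * \<gamma> ^ j\<close> and that the ratios at \<open>z\<close> have drifted away from those at \<open>x\<close> by at most
  \<open>\<epsilon> * E j\<close>, both relative to the weights. As \<open>E\<close> is bounded by a geometric series, \<open>near j\<close> implies
  closeness within \<open>\<beta>\<close>, and with it near positivity, which is what the step to \<open>j + 1\<close> requires.\<close>

theorem eventually_nonzero:
  assumes x: "0 \<le> x"
  shows "\<exists>n1. \<forall>\<^sub>F z in nhds (of_real x). \<forall>n\<ge>n1. (\<Sum>X\<in>Pow {1..k}. z ^ card X * W n z X) \<noteq> 0"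
proof -
  define \<delta> where "\<delta> = 1 / (2 * edge_count_sum x)"
  have ecs: "1 \<le> edge_count_sum x" by (rule edge_count_sum_ge_1[OF x])
  have d: "0 < \<delta>" "\<delta> \<le> 1 / 2" "\<delta> * edge_count_sum x \<le> 1" using ecs by (auto simp: \<delta>_def field_simps)
  define \<kappa> where "\<kappa> = (\<delta> / 2) ^ N"
  have kap: "0 < \<kappa>" "\<kappa> \<le> 1" using d by (auto simp: \<kappa>_def intro!: power_le_one)
  define \<gamma> where "\<gamma> = 1 - \<kappa> / 2"
  have gam: "0 < \<gamma>" "\<gamma> < 1" using kap by (auto simp: \<gamma>_def)
  define \<theta> where "\<theta> t = 1 - (\<delta> / 2) ^ t" for t
  have th: "0 \<le> \<theta> t" "\<theta> t \<le> 1" for t using d by (auto simp: \<theta>_def intro!: power_le_one)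
  define \<eta> where "\<eta> = \<kappa> / 8"
  have eta: "0 < \<eta>" "\<eta> \<le> 1" "\<eta> \<le> (\<delta> / 2) ^ N / 8" using kap by (auto simp: \<eta>_def \<kappa>_def)
  obtain c where c: "0 < c" "c \<le> 1" and Vc: "\<And>n. antitone_weights c (V n x)"
    using real_ratio_lower_bound[OF x] by blast
  obtain \<beta>0 where b0: "0 < \<beta>0" and stable: "\<And>z W V. norm (z - of_real x) \<le> \<beta>0 \<Longrightarrow> antitone_weights c V \<Longrightarrow> nonvanishing W \<Longrightarrow>
    (\<forall>a\<in>{1..k}. \<forall>X\<subseteq>{1..k} - {a}. norm (ratio W a X - of_real (V (insert a X) / V X)) \<le> \<beta>0) \<Longrightarrow>
    nearly_positive \<delta> \<eta> z W \<and> (\<Sum>X\<in>Pow {1..k}. z ^ card X * W X) \<noteq> 0"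
    using stable_neighbourhood[OF x c less_imp_le[OF d(1)] d(3) eta(1,2)] by blast
  obtain b :: real where b: "0 < b" "(1 + b) ^ m \<le> 2" using power_near_1_le_2 by blast
  define \<beta> where "\<beta> = min \<beta>0 b"
  define B where "B = 1 + b"
  have bet: "0 < \<beta>" "\<beta> \<le> \<beta>0" "\<beta> \<le> b" using b0 b by (auto simp: \<beta>_def)
  have B: "1 \<le> B" "B ^ m \<le> 2" using b by (auto simp: B_def)
  define S where "S = 1 + (\<Sum>a\<in>{1..k}. v a)"
  have v0: "0 \<le> v a" if "a \<in> {1..k}" for a using v_ge_1[OF that] by simp
  have vS: "v a \<le> S" if "a \<in> {1..k}" for a
    using member_le_sum[of a "{1..k}" v] v0 that by (simp add: S_def)
  have S: "0 < S" using sum_nonneg[of "{1..k}" v] v0 by (simp add: S_def add_pos_nonneg)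
  \<comment> \<open>Oscillation at \<open>z\<close>, oscillation at \<open>x\<close>, initial distance of the ratios, and the sum of all later drifts.\<close>
  define D where "D = 3 + 4 / (1 - \<gamma>)"
  have D: "0 < D" using gam by (simp add: D_def add_pos_pos)
  define \<epsilon> where "\<epsilon> = \<beta> / (S * D)"
  have eps: "0 < \<epsilon>" "S * \<epsilon> * D = \<beta>" using bet S D by (simp_all add: \<epsilon>_def)
  obtain n1 where n1: "\<gamma> ^ n1 < \<epsilon> / 8" using real_arch_pow_inv[of "\<epsilon> / 8" \<gamma>] gam eps by auto
  have osc_x: "osc_le (L t a) a (\<epsilon> / 4 * \<gamma> ^ j * \<theta> t * v a) (W (n1 + j) (of_real x))"
    if "t \<le> N" "a \<in> {1..k} - F" for t a j
  proof (rule osc_le_mono[OF real_oscillation_decay[OF x d that]])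
    have "2 * \<gamma> ^ (n1 + j) \<le> \<epsilon> / 4 * \<gamma> ^ j" using n1 gam by (simp add: power_add)
    then show "2 * (1 - (\<delta> / 2) ^ N / 2) ^ (n1 + j) * (1 - (\<delta> / 2) ^ t) * v a \<le> \<epsilon> / 4 * \<gamma> ^ j * \<theta> t * v a"
      unfolding \<theta>_def[symmetric] \<kappa>_def[symmetric] \<gamma>_def[symmetric]
      using th v0[of a] that by (intro mult_right_mono) auto
  qed
  have nz_x: "nonvanishing (W n (of_real x))" for n
    using V_antitone[OF x, of n] by (auto simp: nonvanishing_def W_of_real antitone_weights_def)
  have np_x: "nearly_positive \<delta> 0 (of_real x) (W n (of_real x))" for n
    using nearly_positive_real[OF V_antitone[OF x] x less_imp_le[OF d(1)] d(3), of n]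
    by (simp only: ext[OF W_of_real])
  have ratio_x: "ratio (W n (of_real x)) a X = of_real (V n x (insert a X) / V n x X)" for n a X
    by (simp add: ratio_def W_of_real)
  have ratio_x_le: "norm (ratio (W n (of_real x)) a X) \<le> 1" if "a \<in> {1..k}" "X \<subseteq> {1..k} - {a}" for n a X
  proof -
    have "insert a X \<subseteq> {1..k}" "X \<subseteq> {1..k}" using that by auto
    then have "0 < V n x X" "0 < V n x (insert a X)" "V n x (insert a X) \<le> V n x X"
      using V_antitone[OF x, of n] by (simp_all add: antitone_weights_def)
    then show ?thesis by (simp add: ratio_def W_of_real norm_divide)
  qed
  define close where "close z \<longleftrightarrow> norm (z - of_real x) < \<beta> \<and> (\<forall>X\<in>Pow {1..k}. W n1 z X \<noteq> 0) \<and>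
    (\<forall>a\<in>{1..k}. \<forall>X\<in>Pow ({1..k} - {a}). norm (ratio (W n1 z) a X - ratio (W n1 (of_real x)) a X) < \<epsilon> / 8)" for z
  have "\<forall>\<^sub>F z in nhds (of_real x). close z"
    unfolding close_def
  proof (intro eventually_conj eventually_ball_finite ballI)
    show "\<forall>\<^sub>F z in nhds (of_real x). norm (z - of_real x) < \<beta>"
      using tendstoD[OF tendsto_ident_at bet(1)] bet(1)
      by (auto simp: eventually_nhds_metric dist_norm)
  next
    fix X assume "X \<in> Pow {1..k}"
    then have "W n1 (of_real x) X \<noteq> 0" using nz_x by (simp add: nonvanishing_def)
    then show "\<forall>\<^sub>F z in nhds (of_real x). W n1 z X \<noteq> 0" by (rule tendsto_imp_eventually_ne[OF W_tendsto])
  next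
    fix a X assume "a \<in> {1..k}" "X \<in> Pow ({1..k} - {a})"
    then have "((\<lambda>z. ratio (W n1 z) a X) \<longlongrightarrow> ratio (W n1 (of_real x)) a X) (nhds (of_real x))"
      by (intro continuous_ratio nz_x) auto
    from tendstoD[OF this, of "\<epsilon> / 8"] eps(1)
    show "\<forall>\<^sub>F z in nhds (of_real x). norm (ratio (W n1 z) a X - ratio (W n1 (of_real x)) a X) < \<epsilon> / 8"
      by (simp add: dist_norm)
  qed auto
  moreover have "\<forall>n\<ge>n1. (\<Sum>X\<in>Pow {1..k}. z ^ card X * W n z X) \<noteq> 0" if z: "close z" for z
  proof -
    define E where "E j = 1 + 4 * (1 - \<gamma> ^ j) / (1 - \<gamma>)" for j
    have E: "E j \<le> D - 2" for j
      using gam by (simp add: E_def D_def divide_right_mono)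
    have E_Suc: "E (Suc j) = E j + 4 * \<gamma> ^ j" for j using gam by (simp add: E_def field_simps)
    define near where "near j \<longleftrightarrow> nonvanishing (W (n1 + j) z) \<and>
       (\<forall>t\<le>N. \<forall>a\<in>{1..k} - F. osc_le (L t a) a (\<epsilon> * \<gamma> ^ j * \<theta> t * v a) (W (n1 + j) z)) \<and>
       (\<forall>a\<in>{1..k} - F. norm (ratio (W (n1 + j) z) a {} - ratio (W (n1 + j) (of_real x)) a {}) \<le> v a * \<epsilon> * E j)" for j
    have osc_full: "osc_le {} a (\<epsilon> * \<gamma> ^ j * v a) (W (n1 + j) z)"
        "osc_le {} a (\<epsilon> * \<gamma> ^ j * v a) (W (n1 + j) (of_real x))"
      if "near j" "a \<in> {1..k} - F" for j a
    proof -
      have g: "0 \<le> \<gamma> ^ j" using gam by simp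
      have le: "\<epsilon> * \<gamma> ^ j * \<theta> N * v a \<le> \<epsilon> * \<gamma> ^ j * v a"
        "\<epsilon> / 4 * \<gamma> ^ j * \<theta> N * v a \<le> \<epsilon> * \<gamma> ^ j * v a"
      proof -
        have "\<epsilon> * \<gamma> ^ j * \<theta> N \<le> \<epsilon> * \<gamma> ^ j * 1" using eps g th by (intro mult_left_mono) auto
        then show 1: "\<epsilon> * \<gamma> ^ j * \<theta> N * v a \<le> \<epsilon> * \<gamma> ^ j * v a" using v0[of a] that by (simp add: mult_right_mono)
        have "0 \<le> \<epsilon> * \<gamma> ^ j * \<theta> N * v a" using eps g th v0[of a] that by simp
        then show "\<epsilon> / 4 * \<gamma> ^ j * \<theta> N * v a \<le> \<epsilon> * \<gamma> ^ j * v a" using 1 by simp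
      qed
      have "osc_le (L N a) a (\<epsilon> * \<gamma> ^ j * \<theta> N * v a) (W (n1 + j) z)" using that unfolding near_def by blast
      from osc_le_mono[OF this le(1)] show "osc_le {} a (\<epsilon> * \<gamma> ^ j * v a) (W (n1 + j) z)" using that L_N by simp
      from osc_le_mono[OF osc_x[OF order_refl that(2)] le(2)]
      show "osc_le {} a (\<epsilon> * \<gamma> ^ j * v a) (W (n1 + j) (of_real x))" using that L_N by simp
    qed
    have ratio_close: "norm (ratio (W (n1 + j) z) a X - ratio (W (n1 + j) (of_real x)) a X) \<le> \<beta>"
      if near: "near j" and a: "a \<in> {1..k}" and X: "X \<subseteq> {1..k} - {a}" for j a X
    proof (cases "a \<in> F")
      case True
      have "insert a X \<subseteq> {1..k}" using a X by auto
      then have "ratio (W (n1 + j) z) a X = 1" "ratio (W (n1 + j) (of_real x)) a X = 1"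
        using near True nz_x by (auto intro!: ratio_isolated simp: near_def)
      then show ?thesis using bet by simp
    next
      case False
      then have aF: "a \<in> {1..k} - F" using a by simp
      let ?r = "\<lambda>X. ratio (W (n1 + j) z) a X" and ?s = "\<lambda>X. ratio (W (n1 + j) (of_real x)) a X"
      have g: "\<epsilon> * \<gamma> ^ j * v a \<le> \<epsilon> * v a"
        using eps gam v0[OF a] by (intro mult_right_mono) (auto intro!: mult_left_le power_le_one)
      have 1: "norm (?r X - ?r {}) \<le> \<epsilon> * v a"
        using osc_le_mono[OF osc_full(1)[OF near aF] g] X by (simp add: osc_le_def)
      have 2: "norm (?s {} - ?s X) \<le> \<epsilon> * v a"
        using osc_le_mono[OF osc_full(2)[OF near aF] g] X by (simp add: osc_le_def)
      have 3: "norm (?r {} - ?s {}) \<le> v a * \<epsilon> * E j" using near aF unfolding near_def by blast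
      have "?r X - ?s X = (?r X - ?r {}) + (?r {} - ?s {}) + (?s {} - ?s X)" by simp
      also have "norm \<dots> \<le> \<epsilon> * v a + v a * \<epsilon> * E j + \<epsilon> * v a"
        by (intro order_trans[OF norm_triangle_ineq] add_mono 1 2 3)
      also have "\<dots> = v a * \<epsilon> * (E j + 2)" by (simp add: algebra_simps)
      also have "\<dots> \<le> S * \<epsilon> * D"
        using E[of j] vS[OF a] v0[OF a] eps(1) S gam
        by (intro mult_mono) (auto simp: E_def power_le_one intro!: add_nonneg_nonneg divide_nonneg_nonneg)
      finally show ?thesis using eps by simp
    qed
    have stable_j: "nearly_positive \<delta> \<eta> z (W (n1 + j) z) \<and> (\<Sum>X\<in>Pow {1..k}. z ^ card X * W (n1 + j) z X) \<noteq> 0"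
      if near: "near j" for j
    proof (rule stable[OF _ Vc[of "n1 + j"]])
      show "norm (z - of_real x) \<le> \<beta>0" using z bet by (simp add: close_def)
      show "nonvanishing (W (n1 + j) z)" using near by (simp add: near_def)
      show "\<forall>a\<in>{1..k}. \<forall>X\<subseteq>{1..k} - {a}. norm (ratio (W (n1 + j) z) a X -
          of_real (V (n1 + j) x (insert a X) / V (n1 + j) x X)) \<le> \<beta>0"
        unfolding ratio_x[symmetric] using ratio_close[OF near] bet(2) by (meson order_trans)
    qed
    have "near j" for j
    proof (induction j)
      case 0
      have nz: "nonvanishing (W n1 z)" using z by (auto simp: close_def nonvanishing_def)
      have r: "norm (ratio (W n1 z) a X - ratio (W n1 (of_real x)) a X) \<le> \<epsilon> / 8"
        if "a \<in> {1..k}" "X \<subseteq> {1..k} - {a}" for a X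
        using z that unfolding close_def by (meson PowI less_imp_le)
      have osc: "osc_le (L t a) a (\<epsilon> * \<theta> t * v a) (W n1 z)" if t: "t \<le> N" and a: "a \<in> {1..k} - F" for t a
      proof (cases t)
        case 0
        then show ?thesis using osc_separated[OF nz, of a] a by (simp add: \<theta>_def)
      next
        case (Suc s)
        have "(\<delta> / 2) ^ t \<le> (\<delta> / 2) ^ 1" unfolding Suc using d by (intro power_decreasing) auto
        then have "1 / 2 \<le> \<theta> t" using d by (simp add: \<theta>_def)
        then have "1 / 2 * 1 \<le> \<theta> t * v a" using v_ge_1[of a] a by (intro mult_mono) auto
        then have half: "\<epsilon> / 2 \<le> \<epsilon> * \<theta> t * v a" using eps(1) mult_left_mono[of "1/2" "\<theta> t * v a" \<epsilon>] by (simp add: mult.assoc)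
        show ?thesis unfolding osc_le_def
        proof (intro allI impI)
          fix X X' assume X: "X \<subseteq> {1..k} - {a}" "X' \<subseteq> {1..k} - {a}" "X \<inter> L t a = X' \<inter> L t a"
          let ?r = "\<lambda>X. ratio (W n1 z) a X" and ?s = "\<lambda>X. ratio (W n1 (of_real x)) a X"
          have 1: "norm (?s X - ?s X') \<le> \<epsilon> / 4 * \<theta> t * v a"
            using osc_x[OF t a, of 0] X by (simp add: osc_le_def)
          have 2: "norm (?r X - ?s X) \<le> \<epsilon> / 8" "norm (?s X' - ?r X') \<le> \<epsilon> / 8"
            using r[of a X] r[of a X'] a X by (simp_all add: norm_minus_commute)
          have "?r X - ?r X' = (?r X - ?s X) + (?s X - ?s X') + (?s X' - ?r X')" by simp
          also have "norm \<dots> \<le> \<epsilon> / 8 + \<epsilon> / 4 * \<theta> t * v a + \<epsilon> / 8"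
            by (intro order_trans[OF norm_triangle_ineq] add_mono 1 2)
          also have "\<dots> \<le> \<epsilon> * \<theta> t * v a"
          proof -
            have "\<epsilon> / 4 * \<theta> t * v a = (\<epsilon> * \<theta> t * v a) / 4" by simp
            then show ?thesis using half eps(1) by linarith
          qed
          finally show "norm (?r X - ?r X') \<le> \<epsilon> * \<theta> t * v a" .
        qed
      qed
      have "norm (ratio (W n1 z) a {} - ratio (W n1 (of_real x)) a {}) \<le> v a * \<epsilon> * E 0" if "a \<in> {1..k} - F" for a
      proof -
        have "\<epsilon> / 8 \<le> \<epsilon> * 1" using eps by simp
        also have "\<dots> \<le> \<epsilon> * v a" using v_ge_1[of a] that eps by (intro mult_left_mono) auto
        finally show ?thesis using r[of a "{}"] that by (simp add: E_def mult.commute)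
      qed
      then show ?case using nz osc by (simp add: near_def)
    next
      case (Suc j)
      note near = Suc.IH
      have nz: "nonvanishing (W (n1 + j) z)" using near by (simp add: near_def)
      have np: "nearly_positive \<delta> \<eta> z (W (n1 + j) z)" using stable_j[OF near] by simp
      have Bz: "norm (ratio (W (n1 + j) z) a X) \<le> B" if "a \<in> {1..k}" "X \<subseteq> {1..k} - {a}" for a X
      proof -
        have "norm (ratio (W (n1 + j) z) a X)
            \<le> norm (ratio (W (n1 + j) z) a X - ratio (W (n1 + j) (of_real x)) a X) + norm (ratio (W (n1 + j) (of_real x)) a X)"
          by (metis diff_add_cancel norm_triangle_ineq)
        also have "\<dots> \<le> b + 1"
          using ratio_close[OF near that] ratio_x_le[OF that, of "n1 + j"] bet by linarith
        finally show ?thesis by (simp add: B_def)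
      qed
      have Bx: "norm (ratio (W (n1 + j) (of_real x)) a X) \<le> B" if "a \<in> {1..k}" "X \<subseteq> {1..k} - {a}" for a X
        using ratio_x_le[OF that, of "n1 + j"] B(1) by linarith
      have g: "0 \<le> \<gamma> ^ j" using gam by simp
      have nz': "nonvanishing (W (n1 + Suc j) z)"
        using np by (simp add: nonvanishing_def nearly_positive_def step)
      have osc': "osc_le (L t a) a (\<epsilon> * \<gamma> ^ Suc j * \<theta> t * v a) (W (n1 + Suc j) z)"
        if t: "t \<le> N" and a: "a \<in> {1..k} - F" for t a
      proof -
        have "osc_le (L t a) a ((1 - (\<delta> / 2) ^ N / 2) * (\<epsilon> * \<gamma> ^ j) * (1 - (\<delta> / 2) ^ t) * v a) (W (Suc (n1 + j)) z)"
        proof (rule contraction_step[OF nz np d(1,2) _ eta(3) _ B Bz _ t a])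
          show "osc_le (L t a) a (\<epsilon> * \<gamma> ^ j * (1 - (\<delta> / 2) ^ t) * v a) (W (n1 + j) z)"
            if "t \<le> N" "a \<in> {1..k} - F" for t a
            using near that unfolding near_def \<theta>_def by blast
        qed (use eta eps g in auto)
        then show ?thesis unfolding \<theta>_def[symmetric] \<kappa>_def[symmetric] \<gamma>_def[symmetric] by (simp add: mult_ac)
      qed
      have drift: "norm (ratio (W (n1 + Suc j) z) a {} - ratio (W (n1 + Suc j) (of_real x)) a {}) \<le> v a * \<epsilon> * E (Suc j)"
        if a: "a \<in> {1..k} - F" for a
      proof -
        let ?p = "parent a" and ?q = "card (members H (\<Phi> a))"
        have ak: "a \<in> {1..k}" "{} \<subseteq> {1..k} - {a}" using a by auto
        have p: "?p \<in> {1..k} - F" "?p \<in> {1..k}" using v_parent[OF a] mark_edge(5)[OF ak(1)] by auto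
        have va: "v a = ?q\<^sup>2 * v ?p" using v_parent[OF a] by simp
        have e0: "0 \<le> \<epsilon> * \<gamma> ^ j * v ?p" using eps g v0[OF p(2)] by simp
        define u where "u = ratio (W (n1 + j) z) ?p {}"
        define y where "y = ratio (W (n1 + j) (of_real x)) ?p {}"
        have 1: "norm (ratio (W (n1 + Suc j) z) a {} - u ^ ?q) \<le> 2 * ?q\<^sup>2 * (\<epsilon> * \<gamma> ^ j * v ?p)"
          unfolding add_Suc_right ratio_Suc[OF ak] u_def
          using less_imp_le[OF d(1)] e0 eta(2) B Bz[OF p(2)] ak osc_full(1)[OF near p(1)]
          by (intro ratio_transfer_approx[OF nz np]) auto
        have 2: "norm (ratio (W (n1 + Suc j) (of_real x)) a {} - y ^ ?q) \<le> 2 * ?q\<^sup>2 * (\<epsilon> * \<gamma> ^ j * v ?p)"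
          unfolding add_Suc_right ratio_Suc[OF ak] y_def
          using less_imp_le[OF d(1)] e0 B Bx[OF p(2)] ak osc_full(2)[OF near p(1)]
          by (intro ratio_transfer_approx[OF nz_x np_x]) auto
        have uy: "norm (u - y) \<le> v ?p * \<epsilon> * E j"
          using near p(1) unfolding near_def u_def y_def by blast
        have uB: "norm u \<le> B" "norm y \<le> B" using Bz[OF p(2), of "{}"] Bx[OF p(2), of "{}"] by (auto simp: u_def y_def)
        have 3: "norm (u ^ ?q - y ^ ?q) \<le> ?q\<^sup>2 * (v ?p * \<epsilon> * E j)"
        proof -
          have nn: "0 \<le> v ?p * \<epsilon> * E j" using uy norm_ge_zero order_trans by blast
          have "norm ((\<Prod>i<?q. u) - (\<Prod>i<?q. y)) \<le> card {..<?q} * B ^ (card {..<?q} - 1) * (v ?p * \<epsilon> * E j)"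
            using uy uB B nn by (intro norm_prod_diff_le) auto
          also have "\<dots> \<le> ?q\<^sup>2 * (v ?p * \<epsilon> * E j)"
            using mult_power_le_square[OF mark_edge(6,7)[OF ak(1)] B] nn by (intro mult_right_mono) auto
          finally show ?thesis by simp
        qed
        have "ratio (W (n1 + Suc j) z) a {} - ratio (W (n1 + Suc j) (of_real x)) a {}
          = (ratio (W (n1 + Suc j) z) a {} - u ^ ?q) + (u ^ ?q - y ^ ?q) + (y ^ ?q - ratio (W (n1 + Suc j) (of_real x)) a {})"
          by simp
        also have "norm \<dots> \<le> 2 * ?q\<^sup>2 * (\<epsilon> * \<gamma> ^ j * v ?p) + ?q\<^sup>2 * (v ?p * \<epsilon> * E j) + 2 * ?q\<^sup>2 * (\<epsilon> * \<gamma> ^ j * v ?p)"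
          using 1 2 3 by (intro order_trans[OF norm_triangle_ineq] add_mono) (auto simp: norm_minus_commute)
        also have "\<dots> = v a * \<epsilon> * E (Suc j)" unfolding E_Suc va by (simp add: algebra_simps)
        finally show ?thesis .
      qed
      show ?case unfolding near_def using nz' osc' drift by blast
    qed
    then show ?thesis using stable_j by (metis le_add_diff_inverse)
  qed
  ultimately show ?thesis by (intro exI[of _ n1]) (rule eventually_mono)
qed

end

section \<open>Partition functions with prescribed marks\<close>

definition cond_sets :: "nat \<Rightarrow> 'v marked_graph \<Rightarrow> nat set \<Rightarrow> 'v set set" where
  "cond_sets k G X = {I. I \<subseteq> verts G - mark G ` {1..k} \<and> independent_set G (I \<union> mark G ` X)}"

text \<open>Marked vertices are not counted in the exponent. The values are taken in an arbitrary semiring so that the same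
  definition serves at real and at complex points.\<close>

definition cond_poly :: "nat \<Rightarrow> 'v marked_graph \<Rightarrow> nat set \<Rightarrow> 'a \<Rightarrow> 'a :: comm_semiring_1" where
  "cond_poly k G X z = (\<Sum>I\<in>cond_sets k G X. z ^ card I)"

definition linked :: "'v marked_graph \<Rightarrow> 'v \<Rightarrow> 'v \<Rightarrow> bool" where
  "linked G u v \<longleftrightarrow> (\<exists>p. is_path G u p v)"

lemma marked_graphsD:
  assumes "G \<in> marked_graphs k"
  shows "finite (verts G)" "inj_on (mark G) {1..k}" "\<And>j. j \<in> {1..k} \<Longrightarrow> mark G j \<in> verts G"
    "\<And>u v. adjacent G u v \<Longrightarrow> u \<in> verts G \<and> v \<in> verts G \<and> u \<noteq> v"
proof -
  show "finite (verts G)" "inj_on (mark G) {1..k}" "\<And>j. j \<in> {1..k} \<Longrightarrow> mark G j \<in> verts G"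
    using assms by (auto simp: marked_graphs_def)
  fix u v assume "adjacent G u v"
  then have "{u, v} \<subseteq> verts G" "card {u, v} = 2" using assms by (auto simp: marked_graphs_def adjacent_def)
  then show "u \<in> verts G \<and> v \<in> verts G \<and> u \<noteq> v" by (auto simp: card_insert_if split: if_splits)
qed

lemma adjacent_sym: "adjacent G u v \<longleftrightarrow> adjacent G v u"
  by (simp add: adjacent_def insert_commute)

lemma independent_set_subset: "independent_set G J \<Longrightarrow> I \<subseteq> J \<Longrightarrow> independent_set G I"
  unfolding independent_set_def by blast

lemma cond_sets_antimono: "X \<subseteq> X' \<Longrightarrow> cond_sets k G X' \<subseteq> cond_sets k G X"
  unfolding cond_sets_def by (auto elim!: independent_set_subset)

lemma finite_cond_sets: "finite (verts G) \<Longrightarrow> finite (cond_sets k G X)"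
  by (rule finite_subset[of _ "Pow (verts G)"]) (auto simp: cond_sets_def)

lemma indep_poly_eq_sum_cond_poly:
  assumes G: "G \<in> marked_graphs k"
  shows "indep_poly G z = (\<Sum>X\<in>Pow {1..k}. z ^ card X * cond_poly k G X z)"
proof -
  note D = marked_graphsD[OF G]
  have inv: "{j \<in> {1..k}. mark G j \<in> I \<union> mark G ` X} = X" if "X \<subseteq> {1..k}" "I \<subseteq> verts G - mark G ` {1..k}" for I X
    using that D(2) by (auto dest: inj_onD)
  define f where "f = (\<lambda>(X, I). I \<union> mark G ` X)"
  define g where "g I = ({j \<in> {1..k}. mark G j \<in> I}, I - mark G ` {1..k})" for I
  have "(\<Sum>X\<in>Pow {1..k}. z ^ card X * cond_poly k G X z)
      = (\<Sum>(X, I)\<in>Sigma (Pow {1..k}) (cond_sets k G). z ^ card X * z ^ card I)"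
    unfolding cond_poly_def sum_distrib_left
    by (rule sum.Sigma) (auto simp: finite_cond_sets D)
  also have "\<dots> = (\<Sum>I | independent_set G I. z ^ card I)"
  proof (rule sum.reindex_bij_witness[where i = g and j = f])
    fix x assume x: "x \<in> Sigma (Pow {1..k}) (cond_sets k G)"
    obtain X I where xe: "x = (X, I)" by (cases x)
    have XI: "X \<subseteq> {1..k}" "I \<in> cond_sets k G X" using x by (auto simp: xe)
    then have I: "I \<subseteq> verts G - mark G ` {1..k}" "independent_set G (I \<union> mark G ` X)" by (auto simp: cond_sets_def)
    show "g (f x) = x"
      using inv[OF XI(1) I(1)] XI(1) I(1) by (auto simp: xe f_def g_def)
    show "f x \<in> Collect (independent_set G)" using I by (simp add: xe f_def)
    have "card (I \<union> mark G ` X) = card I + card (mark G ` X)"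
      using I XI D(1) finite_subset[OF XI(1)] finite_subset[of I "verts G"] by (intro card_Un_disjoint) auto
    also have "card (mark G ` X) = card X" using D(2) XI(1) by (metis card_image inj_on_subset)
    finally show "z ^ card (f x) = (case x of (X, I) \<Rightarrow> z ^ card X * z ^ card I)"
      by (simp add: power_add mult.commute xe f_def)
  next
    fix I assume "I \<in> Collect (independent_set G)"
    then have I: "independent_set G I" by simp
    have e: "I - mark G ` {1..k} \<union> mark G ` {j \<in> {1..k}. mark G j \<in> I} = I" by auto
    then show "f (g I) = I" by (simp add: f_def g_def)
    have "I \<subseteq> verts G" using I by (simp add: independent_set_def)
    then show "g I \<in> Sigma (Pow {1..k}) (cond_sets k G)"
      using I e by (auto simp: cond_sets_def g_def)
  qed
  finally show ?thesis by (simp add: indep_poly_def)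
qed

text \<open>Occupying an isolated vertex imposes no constraint on the others.\<close>

lemma cond_sets_isolated:
  assumes "G \<in> marked_graphs k" "a \<in> {1..k}" "degree G (mark G a) = 0"
  shows "cond_sets k G (insert a X) = cond_sets k G X"
proof -
  have no: "\<not> adjacent G (mark G a) v" for v
  proof
    assume "adjacent G (mark G a) v"
    then have "{mark G a, v} \<in># {#e \<in># edges G. mark G a \<in> e#}" by (simp add: adjacent_def)
    then show False using assms(3) by (auto simp: degree_def)
  qed
  then have "\<not> adjacent G v (mark G a)" for v by (simp add: adjacent_sym[of G v])
  then show ?thesis using no marked_graphsD(3)[OF assms(1,2)]
    by (auto simp: cond_sets_def independent_set_def)
qed

lemma linked_closed:
  assumes "G \<in> marked_graphs k" "linked G u v" "adjacent G v w"
  shows "linked G u w"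
proof -
  obtain p where p: "is_path G u p v" using assms(2) by (auto simp: linked_def)
  have w: "w \<in> verts G" using marked_graphsD(4)[OF assms(1,3)] by simp
  show ?thesis
  proof (cases "w \<in> set p")
    case True
    then obtain p1 p2 where sp: "p = p1 @ w # p2" by (meson split_list)
    have "is_path G u (p1 @ [w]) w"
      using p unfolding is_path_def sp
      by (auto simp: successively_append_iff hd_append split: if_splits)
    then show ?thesis by (auto simp: linked_def)
  next
    case False
    have "is_path G u (p @ [w]) w"
      using p False w assms(3) by (auto simp: is_path_def successively_append_iff hd_append)
    then show ?thesis by (auto simp: linked_def)
  qed
qed

definition part_poly :: "nat \<Rightarrow> 'v marked_graph \<Rightarrow> 'v set \<Rightarrow> nat set \<Rightarrow> 'a \<Rightarrow> 'a :: comm_semiring_1" where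
  "part_poly k G C X z = (\<Sum>I | I \<subseteq> (verts G - mark G ` {1..k}) \<inter> C \<and> independent_set G (I \<union> mark G ` X \<inter> C). z ^ card I)"

lemma cond_poly_split:
  assumes G: "G \<in> marked_graphs k" and C: "\<And>u v. adjacent G u v \<Longrightarrow> u \<in> C \<longleftrightarrow> v \<in> C"
  shows "cond_poly k G X z = part_poly k G C X z * part_poly k G (- C) X z"
proof -
  let ?S = "\<lambda>C. {I. I \<subseteq> (verts G - mark G ` {1..k}) \<inter> C \<and> independent_set G (I \<union> mark G ` X \<inter> C)}"
  note fin = marked_graphsD(1)[OF G]
  have "part_poly k G C X z * part_poly k G (- C) X z = (\<Sum>(I, J)\<in>?S C \<times> ?S (- C). z ^ card I * z ^ card J)"
    by (simp add: part_poly_def sum_product sum.cartesian_product)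
  also have "\<dots> = (\<Sum>I\<in>cond_sets k G X. z ^ card I)"
  proof (rule sum.reindex_bij_witness[where j = "\<lambda>x. fst x \<union> snd x" and i = "\<lambda>I. (I \<inter> C, I - C)"])
    fix x assume x: "x \<in> ?S C \<times> ?S (- C)"
    obtain I J where xe: "x = (I, J)" by (cases x)
    have I: "I \<subseteq> (verts G - mark G ` {1..k}) \<inter> C" "independent_set G (I \<union> mark G ` X \<inter> C)"
      and J: "J \<subseteq> (verts G - mark G ` {1..k}) \<inter> - C" "independent_set G (J \<union> mark G ` X \<inter> - C)"
      using x by (auto simp: xe)
    show "((fst x \<union> snd x) \<inter> C, fst x \<union> snd x - C) = x" using I J by (auto simp: xe)
    have "\<not> adjacent G u v" if "u \<in> (I \<union> J) \<union> mark G ` X" "v \<in> (I \<union> J) \<union> mark G ` X" for u v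
    proof
      assume adj: "adjacent G u v"
      show False
      proof (cases "u \<in> C")
        case True
        then have "u \<in> I \<union> mark G ` X \<inter> C" "v \<in> I \<union> mark G ` X \<inter> C" using that C[OF adj] I J by auto
        then show False using I(2) adj by (auto simp: independent_set_def)
      next
        case False
        then have "u \<in> J \<union> mark G ` X \<inter> - C" "v \<in> J \<union> mark G ` X \<inter> - C" using that C[OF adj] I J by auto
        then show False using J(2) adj by (auto simp: independent_set_def)
      qed
    qed
    moreover have "(I \<union> J) \<union> mark G ` X \<subseteq> verts G"
      using I J unfolding independent_set_def by blast
    ultimately show "fst x \<union> snd x \<in> cond_sets k G X"
      using I(1) J(1) unfolding cond_sets_def independent_set_def xe fst_conv snd_conv by blast
    have "card (I \<union> J) = card I + card J"
      using I(1) J(1) fin by (intro card_Un_disjoint) (auto intro: finite_subset)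
    then show "z ^ card (fst x \<union> snd x) = (case x of (I, J) \<Rightarrow> z ^ card I * z ^ card J)"
      by (simp add: power_add xe)
  next
    fix I assume I: "I \<in> cond_sets k G X"
    show "fst (I \<inter> C, I - C) \<union> snd (I \<inter> C, I - C) = I" by auto
    show "(I \<inter> C, I - C) \<in> ?S C \<times> ?S (- C)"
      using I unfolding cond_sets_def
      by (auto elim!: independent_set_subset)
  qed
  finally show ?thesis by (simp add: cond_poly_def)
qed

text \<open>Splitting the graph into the component of the mark \<open>a\<close> and the rest, the two marks act on different
  factors.\<close>

lemma cond_poly_separated:
  assumes G: "G \<in> marked_graphs k" and un: "\<not> linked G (mark G a) (mark G b)" and ab: "a \<in> {1..k}" "b \<in> {1..k}"
  shows "cond_poly k G X z * cond_poly k G (insert a (insert b X)) z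
    = cond_poly k G (insert a X) z * (cond_poly k G (insert b X) z :: 'a :: comm_semiring_1)"
proof -
  define C where "C = {v. linked G (mark G a) v}"
  have C: "u \<in> C \<longleftrightarrow> v \<in> C" if "adjacent G u v" for u v
    using linked_closed[OF G] that adjacent_sym[of G] unfolding C_def by blast
  have "is_path G (mark G a) [mark G a] (mark G a)"
    using marked_graphsD(3)[OF G ab(1)] by (simp add: is_path_def)
  then have a: "mark G a \<in> C" by (auto simp: C_def linked_def)
  have b: "mark G b \<notin> C" using un by (simp add: C_def)
  have split: "cond_poly k G Y z = part_poly k G C Y z * part_poly k G (- C) Y z" for Y
    by (rule cond_poly_split[OF G C])
  have pb: "part_poly k G C (insert b Y) z = part_poly k G C Y z" for Y using b by (simp add: part_poly_def)
  have pa: "part_poly k G (- C) (insert a Y) z = part_poly k G (- C) Y z" for Y using a by (simp add: part_poly_def)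
  have pb': "part_poly k G C (insert a (insert b X)) z = part_poly k G C (insert a X) z"
    unfolding insert_commute[of a b] by (rule pb)
  show ?thesis unfolding split pb' pa pb by (simp only: mult_ac)
qed

section \<open>Gluing of independent sets, degrees and paths\<close>

context gluing
begin

abbreviation "\<R> \<equiv> recursion k m H \<Phi>"

context
  fixes G :: "('v, 'h) vertex marked_graph"
  assumes G: "G \<in> marked_graphs k"
begin

lemma proj_unmarked: "v \<notin> mark G ` {1..k} \<Longrightarrow> proj k H G i v = Copy i v"
  by (simp add: proj_def)

lemma proj_marked_cases:
  assumes "i \<in> {1..m}" "v \<in> mark G ` {1..k}"
  obtains e where "e \<in> hedges H" "i \<in> members H e" "v = mark G (label H e)" "proj k H G i v = Merged e"
  using ex1_hedge[OF gluing G assms] proj_marked[OF gluing G] by metis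

lemma hedge_member:
  assumes "e \<in> hedges H" "i \<in> members H e" shows "i \<in> {1..m}" "label H e \<in> {1..k}"
  using gluing assms unfolding gluing_data_def by blast+

lemma verts_recursion:
  "verts (\<R> G) = Merged ` hedges H \<union> (\<Union>i\<in>{1..m}. Copy i ` (verts G - mark G ` {1..k}))" (is "?L = ?R")
proof
  show "?L \<subseteq> ?R"
  proof
    fix p assume "p \<in> ?L"
    then have "p \<in> (\<Union>i\<in>{1..m}. proj k H G i ` verts G)" by (simp only: recursion_def marked_graph.select_convs)
    then obtain i v where i: "i \<in> {1..m}" "v \<in> verts G" "p = proj k H G i v" by (elim UN_E imageE)
    show "p \<in> ?R"
    proof (cases "v \<in> mark G ` {1..k}")
      case True
      obtain e where "e \<in> hedges H" "proj k H G i v = Merged e" by (rule proj_marked_cases[OF i(1) True])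
      then show ?thesis using i(3) by (intro UnI1) (simp only: imageI)
    next
      case False
      then have "p \<in> Copy i ` (verts G - mark G ` {1..k})" using i proj_unmarked[of v i] by (intro image_eqI) auto
      then show ?thesis using i(1) by (intro UnI2 UN_I)
    qed
  qed
  show "?R \<subseteq> ?L"
  proof
    fix p assume "p \<in> ?R"
    then consider e where "e \<in> hedges H" "p = Merged e"
      | i v where "i \<in> {1..m}" "v \<in> verts G" "v \<notin> mark G ` {1..k}" "p = Copy i v"
      by (elim UnE UN_E imageE DiffE) auto
    then have "\<exists>i\<in>{1..m}. \<exists>v\<in>verts G. p = proj k H G i v"
    proof cases
      case 1
      have "members H e \<noteq> {}" using gluing 1(1) by (simp add: gluing_data_def)
      then obtain i where i: "i \<in> members H e" by blast
      note im = hedge_member[OF 1(1) i]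
      have "p = proj k H G i (mark G (label H e))" using proj_marked[OF gluing G 1(1) i] 1(2) by simp
      then show ?thesis using im(1) marked_graphsD(3)[OF G im(2)] by (intro bexI)
    next
      case 2
      then have "p = proj k H G i v" using proj_unmarked by simp
      then show ?thesis using 2 by (intro bexI)
    qed
    then show "p \<in> ?L" by (simp add: recursion_def image_iff)
  qed
qed

lemma mark_recursion: "mark (\<R> G) ` Y = Merged ` \<Phi> ` Y"
  by (simp add: recursion_def image_image)

lemma edges_recursion:
  "set_mset (edges (\<R> G)) = (\<Union>i\<in>{1..m}. (`) (proj k H G i) ` set_mset (edges G))"
  by (simp add: recursion_def set_mset_sum)

lemma adjacent_recursion:
  "adjacent (\<R> G) p q \<longleftrightarrow> (\<exists>i\<in>{1..m}. \<exists>u v. adjacent G u v \<and> p = proj k H G i u \<and> q = proj k H G i v)"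
proof
  assume "adjacent (\<R> G) p q"
  then obtain i e where i: "i \<in> {1..m}" "e \<in># edges G" "{p, q} = proj k H G i ` e"
    unfolding adjacent_def edges_recursion by blast
  then have "card e = 2" using G by (auto simp: marked_graphs_def)
  then obtain u v where uv: "e = {u, v}" by (meson card_2_iff)
  have "{p, q} = {proj k H G i u, proj k H G i v}" using i uv by simp
  then have "(p = proj k H G i u \<and> q = proj k H G i v) \<or> (p = proj k H G i v \<and> q = proj k H G i u)"
    by (simp only: doubleton_eq_iff)
  moreover have "adjacent G u v" "adjacent G v u" using i uv by (auto simp: adjacent_def insert_commute)
  ultimately show "\<exists>i\<in>{1..m}. \<exists>u v. adjacent G u v \<and> p = proj k H G i u \<and> q = proj k H G i v"
    using i(1) by blast
next
  assume "\<exists>i\<in>{1..m}. \<exists>u v. adjacent G u v \<and> p = proj k H G i u \<and> q = proj k H G i v"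
  then obtain i u v where i: "i \<in> {1..m}" "{u, v} \<in># edges G" "p = proj k H G i u" "q = proj k H G i v"
    unfolding adjacent_def by blast
  then have "{p, q} = proj k H G i ` {u, v}" by simp
  then have "{p, q} \<in> (`) (proj k H G i) ` set_mset (edges G)" using i(2) by blast
  then show "adjacent (\<R> G) p q" using i(1) unfolding adjacent_def edges_recursion by blast
qed

text \<open>The vertex sets of the glued graph in coordinates: the occupied merged vertices, and the
  unmarked vertices of each copy.\<close>

definition glue :: "'h set \<Rightarrow> (nat \<Rightarrow> ('v, 'h) vertex set) \<Rightarrow> ('v, 'h) vertex set" where
  "glue S J = Merged ` S \<union> (\<Union>i\<in>{1..m}. Copy i ` J i)"

lemma proj_in_glue:
  assumes i: "i \<in> {1..m}" and S: "S \<subseteq> hedges H" and J: "\<And>i. i \<in> {1..m} \<Longrightarrow> J i \<subseteq> verts G - mark G ` {1..k}"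
  shows "proj k H G i v \<in> glue S J \<longleftrightarrow> v \<in> J i \<union> mark G ` occupied_marks i S"
proof (cases "v \<in> mark G ` {1..k}")
  case True
  obtain e where e: "e \<in> hedges H" "i \<in> members H e" "v = mark G (label H e)" "proj k H G i v = Merged e"
    by (rule proj_marked_cases[OF i True])
  have "v \<notin> J i" using J[OF i] True by blast
  moreover have "Merged e \<in> glue S J \<longleftrightarrow> e \<in> S" by (auto simp: glue_def)
  moreover have "v \<in> mark G ` occupied_marks i S \<longleftrightarrow> e \<in> S"
  proof
    assume "e \<in> S" then show "v \<in> mark G ` occupied_marks i S" using e by (auto simp: occupied_marks_def)
  next
    assume "v \<in> mark G ` occupied_marks i S"
    then obtain e' where e': "e' \<in> S" "i \<in> members H e'" "v = mark G (label H e')"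
      unfolding occupied_marks_def by blast
    then have "e' \<in> hedges H" using S by blast
    moreover from this have "label H e' = label H e"
      using inj_onD[OF marked_graphsD(2)[OF G], of "label H e'" "label H e"] e e' hedge_member by metis
    ultimately show "e \<in> S" using hedge_unique[of e' e i] e e' by simp
  qed
  ultimately show ?thesis using e(4) by simp
next
  case False
  then have "v \<notin> mark G ` occupied_marks i S" using occupied_marks_subset[OF S] by blast
  then show ?thesis using i False by (auto simp: proj_unmarked glue_def)
qed

text \<open>Every edge of the glued graph comes from an edge in some copy, so independence can be tested copy by copy.\<close>

lemma independent_glue:
  assumes S: "S \<subseteq> hedges H" and J: "\<And>i. i \<in> {1..m} \<Longrightarrow> J i \<subseteq> verts G - mark G ` {1..k}"
  shows "independent_set (\<R> G) (glue S J) \<longleftrightarrow>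
    (\<forall>i\<in>{1..m}. independent_set G (J i \<union> mark G ` occupied_marks i S))"
proof -
  have g: "glue S J \<subseteq> verts (\<R> G)"
    unfolding glue_def verts_recursion using S J by (intro Un_mono UN_mono image_mono) auto
  have pg: "proj k H G i v \<in> glue S J \<longleftrightarrow> v \<in> J i \<union> mark G ` occupied_marks i S" if "i \<in> {1..m}" for i v
    using that S J by (rule proj_in_glue)
  have l: "J i \<union> mark G ` occupied_marks i S \<subseteq> verts G" if "i \<in> {1..m}" for i
    using J[OF that] occupied_marks_subset[OF S, of i] marked_graphsD(3)[OF G] by blast
  show ?thesis
  proof
    assume ind: "independent_set (\<R> G) (glue S J)"
    show "\<forall>i\<in>{1..m}. independent_set G (J i \<union> mark G ` occupied_marks i S)"
    proof
      fix i assume i: "i \<in> {1..m}"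
      have "\<not> adjacent G u v" if "u \<in> J i \<union> mark G ` occupied_marks i S" "v \<in> J i \<union> mark G ` occupied_marks i S" for u v
      proof
        assume "adjacent G u v"
        then have "adjacent (\<R> G) (proj k H G i u) (proj k H G i v)" unfolding adjacent_recursion using i by blast
        moreover have "proj k H G i u \<in> glue S J" "proj k H G i v \<in> glue S J"
          using that pg[OF i] by simp_all
        ultimately show False using ind unfolding independent_set_def by blast
      qed
      then show "independent_set G (J i \<union> mark G ` occupied_marks i S)"
        using l[OF i] unfolding independent_set_def by blast
    qed
  next
    assume ind: "\<forall>i\<in>{1..m}. independent_set G (J i \<union> mark G ` occupied_marks i S)"
    have "\<not> adjacent (\<R> G) p q" if pq: "p \<in> glue S J" "q \<in> glue S J" for p q
    proof
      assume "adjacent (\<R> G) p q"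
      then obtain i u v where i: "i \<in> {1..m}" and uv: "adjacent G u v" "p = proj k H G i u" "q = proj k H G i v"
        unfolding adjacent_recursion by blast
      then have "u \<in> J i \<union> mark G ` occupied_marks i S" "v \<in> J i \<union> mark G ` occupied_marks i S"
        using pq pg[OF i] by simp_all
      then show False using ind i uv(1) unfolding independent_set_def by blast
    qed
    then show "independent_set (\<R> G) (glue S J)" using g unfolding independent_set_def by blast
  qed
qed

text \<open>By \<open>independent_glue\<close>, independent sets with marks \<open>Y\<close> correspond to a set \<open>T\<close> of inner hyperedges
  together with a family of independent sets of the copies, chosen independently of each other once \<open>T\<close> is
  fixed.\<close>

lemma cond_poly_recursion:
  assumes Y: "Y \<subseteq> {1..k}"
  shows "cond_poly k (\<R> G) Y z = transfer z (\<lambda>X. cond_poly k G X z) Y"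
proof -
  define A where "A T i = cond_sets k G (occupied_marks i (T \<union> \<Phi> ` Y))" for T i
  have sub: "T \<union> \<Phi> ` Y \<subseteq> hedges H" if "T \<subseteq> inner_edges" for T by (rule config_subset[OF Y that])
  have Asub: "J i \<subseteq> verts G - mark G ` {1..k}" if "J \<in> Pi\<^sub>E {1..m} (A T)" "i \<in> {1..m}" for J T i
    using PiE_mem[OF that] by (simp add: A_def cond_sets_def)
  note fin = marked_graphsD(1)[OF G]
  have finA: "finite (A T i)" for T i unfolding A_def by (rule finite_cond_sets[OF fin])
  have "transfer z (\<lambda>X. cond_poly k G X z) Y
      = (\<Sum>T\<in>Pow inner_edges. \<Sum>J\<in>Pi\<^sub>E {1..m} (A T). z ^ card T * (\<Prod>i\<in>{1..m}. z ^ card (J i)))"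
    unfolding transfer_def config_weight_def cond_poly_def A_def[symmetric]
    by (simp only: prod_sum_PiE[OF finite_atLeastAtMost finA] sum_distrib_left)
  also have "\<dots> = (\<Sum>(T, J)\<in>Sigma (Pow inner_edges) (\<lambda>T. Pi\<^sub>E {1..m} (A T)). z ^ card T * (\<Prod>i\<in>{1..m}. z ^ card (J i)))"
    using finite_inner_edges finA by (intro sum.Sigma) (auto intro: finite_PiE)
  also have "\<dots> = (\<Sum>I\<in>cond_sets k (\<R> G) Y. z ^ card I)"
  proof (rule sum.reindex_bij_witness[where j = "\<lambda>x. glue (fst x) (snd x)"
        and i = "\<lambda>I. ({e. Merged e \<in> I}, \<lambda>i\<in>{1..m}. {v. Copy i v \<in> I})"])
    fix x assume x: "x \<in> Sigma (Pow inner_edges) (\<lambda>T. Pi\<^sub>E {1..m} (A T))"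
    obtain T J where xe: "x = (T, J)" by (cases x)
    have T: "T \<subseteq> inner_edges" and J: "J \<in> Pi\<^sub>E {1..m} (A T)" using x unfolding xe by blast+
    note Ji = Asub[OF J]
    have 1: "{e. Merged e \<in> glue T J} = T" by (auto simp: glue_def)
    have 2: "(\<lambda>i\<in>{1..m}. {v. Copy i v \<in> glue T J}) = J"
    proof
      fix i show "(\<lambda>i\<in>{1..m}. {v. Copy i v \<in> glue T J}) i = J i"
        using PiE_arb[OF J, of i] by (auto simp: glue_def)
    qed
    show "({e. Merged e \<in> glue (fst x) (snd x)}, \<lambda>i\<in>{1..m}. {v. Copy i v \<in> glue (fst x) (snd x)}) = x"
      unfolding xe fst_conv snd_conv 1 2 ..
    have un: "glue T J \<union> mark (\<R> G) ` Y = glue (T \<union> \<Phi> ` Y) J" by (auto simp: glue_def mark_recursion)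
    have ig: "independent_set (\<R> G) (glue (T \<union> \<Phi> ` Y) J) \<longleftrightarrow>
        (\<forall>i\<in>{1..m}. independent_set G (J i \<union> mark G ` occupied_marks i (T \<union> \<Phi> ` Y)))"
      using sub[OF T] Ji by (rule independent_glue)
    have "independent_set (\<R> G) (glue (T \<union> \<Phi> ` Y) J)"
      unfolding ig using PiE_mem[OF J] by (simp add: A_def cond_sets_def)
    moreover have "glue T J \<subseteq> verts (\<R> G) - mark (\<R> G) ` {1..k}"
    proof -
      have "T \<subseteq> hedges H" using T by (auto simp: inner_edges_def)
      then have "glue T J \<subseteq> verts (\<R> G)"
        unfolding glue_def verts_recursion using Ji by (intro Un_mono UN_mono image_mono) auto
      moreover have "glue T J \<inter> mark (\<R> G) ` {1..k} = {}"
        using T unfolding mark_recursion by (auto simp: glue_def inner_edges_def)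
      ultimately show ?thesis by blast
    qed
    ultimately show "glue (fst x) (snd x) \<in> cond_sets k (\<R> G) Y" by (simp add: cond_sets_def un xe)
    have finJ: "finite (J i)" if "i \<in> {1..m}" for i using Ji[OF that] fin finite_subset by blast
    have finT: "finite T" using T finite_inner_edges finite_subset by blast
    have "card (glue T J) = card (Merged ` T :: ('v, 'h) vertex set) + card (\<Union>i\<in>{1..m}. Copy i ` J i)"
      unfolding glue_def using finJ finT by (intro card_Un_disjoint) auto
    also have "card (Merged ` T :: ('v, 'h) vertex set) = card T" by (intro card_image) (simp add: inj_on_def)
    also have "card (\<Union>i\<in>{1..m}. Copy i ` J i) = (\<Sum>i\<in>{1..m}. card (Copy i ` J i))"
      using finJ by (intro card_UN_disjoint) auto
    also have "\<dots> = (\<Sum>i\<in>{1..m}. card (J i))"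
      by (intro sum.cong refl card_image) (simp add: inj_on_def)
    finally show "z ^ card (glue (fst x) (snd x)) = (case x of (T, J) \<Rightarrow> z ^ card T * (\<Prod>i\<in>{1..m}. z ^ card (J i)))"
      by (simp add: power_add power_sum xe)
  next
    fix I assume I: "I \<in> cond_sets k (\<R> G) Y"
    define T where "T = {e. Merged e \<in> I}"
    define J where "J = (\<lambda>i\<in>{1..m}. {v. Copy i v \<in> I})"
    have Isub: "I \<subseteq> verts (\<R> G) - mark (\<R> G) ` {1..k}" and ind: "independent_set (\<R> G) (I \<union> mark (\<R> G) ` Y)"
      using I by (auto simp: cond_sets_def)
    have Iglue: "glue T J = I"
    proof
      show "glue T J \<subseteq> I" by (auto simp: glue_def T_def J_def)
      show "I \<subseteq> glue T J"
      proof
        fix p assume p: "p \<in> I"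
        then have "p \<in> verts (\<R> G)" using Isub by blast
        then consider e where "p = Merged e" | i v where "i \<in> {1..m}" "p = Copy i v"
          unfolding verts_recursion by blast
        then show "p \<in> glue T J" using p by cases (auto simp: glue_def T_def J_def)
      qed
    qed
    then show "glue (fst ({e. Merged e \<in> I}, \<lambda>i\<in>{1..m}. {v. Copy i v \<in> I}))
        (snd ({e. Merged e \<in> I}, \<lambda>i\<in>{1..m}. {v. Copy i v \<in> I})) = I"
      unfolding fst_conv snd_conv T_def J_def .
    have T: "T \<subseteq> inner_edges"
    proof
      fix e assume "e \<in> T"
      then have "Merged e \<in> verts (\<R> G)" "Merged e \<notin> mark (\<R> G) ` {1..k}" using Isub by (auto simp: T_def)
      then show "e \<in> inner_edges" unfolding verts_recursion mark_recursion inner_edges_def by auto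
    qed
    have Ji: "J i \<subseteq> verts G - mark G ` {1..k}" if "i \<in> {1..m}" for i
    proof
      fix v assume "v \<in> J i"
      then have "Copy i v \<in> verts (\<R> G)" using Isub that by (auto simp: J_def)
      then show "v \<in> verts G - mark G ` {1..k}" unfolding verts_recursion by auto
    qed
    have un: "I \<union> mark (\<R> G) ` Y = glue (T \<union> \<Phi> ` Y) J" unfolding Iglue[symmetric] by (auto simp: glue_def mark_recursion)
    have ig: "independent_set (\<R> G) (glue (T \<union> \<Phi> ` Y) J) \<longleftrightarrow>
        (\<forall>i\<in>{1..m}. independent_set G (J i \<union> mark G ` occupied_marks i (T \<union> \<Phi> ` Y)))"
      using sub[OF T] Ji by (rule independent_glue)
    have "J \<in> Pi\<^sub>E {1..m} (A T)"
    proof (rule PiE_I)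
      fix i assume i: "i \<in> {1..m}"
      have "independent_set G (J i \<union> mark G ` occupied_marks i (T \<union> \<Phi> ` Y))"
        using ind i unfolding un ig by blast
      then show "J i \<in> A T i" using Ji[OF i] by (simp add: A_def cond_sets_def)
    qed (auto simp: J_def)
    then show "({e. Merged e \<in> I}, \<lambda>i\<in>{1..m}. {v. Copy i v \<in> I}) \<in> Sigma (Pow inner_edges) (\<lambda>T. Pi\<^sub>E {1..m} (A T))"
      using T unfolding T_def[symmetric] J_def[symmetric] by blast
  qed
  finally show ?thesis by (simp add: cond_poly_def)
qed

lemma degree_recursion:
  assumes j: "j \<in> {1..k}"
  shows "degree (\<R> G) (mark (\<R> G) j) = card (members H (\<Phi> j)) * degree G (mark G (parent j))"
proof -
  have in_proj: "Merged (\<Phi> j) \<in> proj k H G i ` e \<longleftrightarrow> i \<in> members H (\<Phi> j) \<and> mark G (parent j) \<in> e"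
    if i: "i \<in> {1..m}" for i e
  proof
    assume "Merged (\<Phi> j) \<in> proj k H G i ` e"
    then obtain v where v: "v \<in> e" "proj k H G i v = Merged (\<Phi> j)" by force
    then have "v \<in> mark G ` {1..k}" by (auto simp: proj_def split: if_splits)
    from proj_marked_cases[OF i this] v show "i \<in> members H (\<Phi> j) \<and> mark G (parent j) \<in> e"
      by (metis parent_def vertex.inject(3))
  next
    assume "i \<in> members H (\<Phi> j) \<and> mark G (parent j) \<in> e"
    then show "Merged (\<Phi> j) \<in> proj k H G i ` e"
      using proj_marked[OF gluing G mark_edge(1)[OF j]] unfolding parent_def by (metis imageI)
  qed
  have "degree (\<R> G) (mark (\<R> G) j)
      = size (filter_mset (\<lambda>e. Merged (\<Phi> j) \<in> e) (\<Sum>i\<in>{1..m}. image_mset ((`) (proj k H G i)) (edges G)))"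
    by (simp add: degree_def recursion_def)
  also have "\<dots> = (\<Sum>i\<in>{1..m}. size (filter_mset (\<lambda>e. Merged (\<Phi> j) \<in> e) (image_mset ((`) (proj k H G i)) (edges G))))"
  proof -
    have "size (filter_mset P (\<Sum>i\<in>A. f i)) = (\<Sum>i\<in>A. size (filter_mset P (f i)))"
      if "finite A" for A :: "nat set" and P and f :: "nat \<Rightarrow> ('v, 'h) vertex set multiset"
      using that by (induction A rule: finite_induct) auto
    then show ?thesis by simp
  qed
  also have "\<dots> = (\<Sum>i\<in>{1..m}. if i \<in> members H (\<Phi> j) then degree G (mark G (parent j)) else 0)"
  proof (intro sum.cong refl)
    fix i assume i: "i \<in> {1..m}"
    have "size (filter_mset (\<lambda>e. Merged (\<Phi> j) \<in> e) (image_mset ((`) (proj k H G i)) (edges G)))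
        = size (filter_mset (\<lambda>e. i \<in> members H (\<Phi> j) \<and> mark G (parent j) \<in> e) (edges G))"
      by (simp add: filter_mset_image_mset in_proj[OF i])
    then show "size (filter_mset (\<lambda>e. Merged (\<Phi> j) \<in> e) (image_mset ((`) (proj k H G i)) (edges G)))
        = (if i \<in> members H (\<Phi> j) then degree G (mark G (parent j)) else 0)"
      by (simp add: degree_def)
  qed
  also have "\<dots> = card (members H (\<Phi> j)) * degree G (mark G (parent j))"
    using mark_edge(2)[OF j] by (simp add: sum.If_cases Int_absorb1)
  finally show ?thesis .
qed

text \<open>A path inside a common copy survives the gluing. This is how closeness of two marks is inherited.\<close>

lemma path_recursion:
  assumes ab: "a \<in> {1..k}" "b \<in> {1..k}" and meet: "members H (\<Phi> a) \<inter> members H (\<Phi> b) \<noteq> {}"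
    and p: "is_path G (mark G (parent a)) p (mark G (parent b))"
  shows "\<exists>p'. is_path (\<R> G) (mark (\<R> G) a) p' (mark (\<R> G) b) \<and> length p' = length p"
proof -
  obtain i where i: "i \<in> members H (\<Phi> a)" "i \<in> members H (\<Phi> b)" using meet by blast
  then have im: "i \<in> {1..m}" using mark_edge(2)[OF ab(1)] by blast
  let ?f = "proj k H G i"
  have inj: "inj ?f" using proj_eq_iff[OF gluing G im im] by (auto intro: injI)
  have m: "?f (mark G (parent a)) = mark (\<R> G) a" "?f (mark G (parent b)) = mark (\<R> G) b"
    using proj_marked[OF gluing G mark_edge(1)[OF ab(1)] i(1)] proj_marked[OF gluing G mark_edge(1)[OF ab(2)] i(2)]
    by (simp_all add: parent_def recursion_def)
  have v: "?f ` verts G \<subseteq> verts (\<R> G)" using im unfolding recursion_def marked_graph.select_convs by blast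
  have "successively (adjacent (\<R> G)) (map ?f p)"
    unfolding successively_map
  proof (rule successively_mono)
    show "successively (adjacent G) p" using p by (simp add: is_path_def)
    show "adjacent (\<R> G) (?f u) (?f v)" if "adjacent G u v" for u v
      using that im unfolding adjacent_recursion by blast
  qed
  then have "is_path (\<R> G) (mark (\<R> G) a) (map ?f p) (mark (\<R> G) b)"
  proof -
    have "p \<noteq> []" "hd p = mark G (parent a)" "last p = mark G (parent b)" "set p \<subseteq> verts G" "distinct p"
      using p by (simp_all add: is_path_def)
    moreover from this have "set (map ?f p) \<subseteq> verts (\<R> G)" using v by auto
    moreover have "inj_on ?f (set p)" using inj by (rule inj_on_subset) simp
    ultimately show ?thesis using \<open>successively (adjacent (\<R> G)) (map ?f p)\<close> m
      unfolding is_path_def by (simp add: hd_map last_map distinct_map)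
  qed
  then show ?thesis by (intro exI[of _ "map ?f p"]) simp
qed

end

end

section \<open>Consequences of bounded degrees and diverging distances\<close>

locale graph_sequence = gluing k m H \<Phi>
  for k m and H :: "'h labeled_hypergraph" and \<Phi> +
  fixes G :: "nat \<Rightarrow> ('v, 'h) vertex marked_graph" and D :: nat
  assumes G_0: "G 0 \<in> marked_graphs k"
    and G_Suc: "G (Suc n) = recursion k m H \<Phi> (G n)"
    and max_degree_le: "max_degree (G n) \<le> D"
    and mark_dist: "(\<lambda>n. min_mark_dist k (G n)) \<longlonglongrightarrow> \<infinity>"
begin

lemma G_marked: "G n \<in> marked_graphs k"
  by (induction n) (auto simp: G_0 G_Suc intro: recursion_in_marked_graphs[OF gluing])

lemma iterated_parent: "a \<in> {1..k} \<Longrightarrow> (parent ^^ t) a \<in> {1..k}"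
  by (induction t) (simp_all del: atLeastAtMost_iff One_nat_def add: mark_edge(5))

text \<open>The number of copies of the \<open>t\<close> generations older graph that are merged at the mark \<open>a\<close>.\<close>

definition copy_count :: "nat \<Rightarrow> nat \<Rightarrow> nat" where
  "copy_count t a = (\<Prod>s<t. card (members H (\<Phi> ((parent ^^ s) a))))"

lemma copy_count_Suc: "copy_count (Suc t) a = card (members H (\<Phi> a)) * copy_count t (parent a)"
  unfolding copy_count_def prod.lessThan_Suc_shift by (simp add: funpow_swap1)

lemma mark_degree_iterate:
  "a \<in> {1..k} \<Longrightarrow> degree (G (n + t)) (mark (G (n + t)) a)
    = copy_count t a * degree (G n) (mark (G n) ((parent ^^ t) a))"
proof (induction t arbitrary: a)
  case 0 then show ?case by (simp add: copy_count_def)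
next
  case (Suc t)
  show ?case
    using degree_recursion[OF G_marked[of "n + t"] Suc.prems] Suc.IH[OF mark_edge(5)[OF Suc.prems]]
    by (simp add: G_Suc copy_count_Suc funpow_swap1)
qed

lemma mark_degree_le:
  assumes "a \<in> {1..k}" shows "degree (G n) (mark (G n) a) \<le> D"
proof -
  have "degree (G n) (mark (G n) a) \<le> max_degree (G n)"
    unfolding max_degree_def using marked_graphsD(1,3)[OF G_marked] assms by (intro Max_ge) auto
  then show ?thesis using max_degree_le[of n] by simp
qed

text \<open>If more than \<open>D\<close> copies are merged at a mark within \<open>t\<close> generations, then the degree bound leaves it only
  degree \<open>0\<close> from time \<open>t\<close> on.\<close>

definition isolated_marks :: "nat set" where
  "isolated_marks = {a \<in> {1..k}. \<exists>t. D < copy_count t a}"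

lemma isolated_marks_eventually:
  "\<exists>n0. \<forall>n\<ge>n0. \<forall>a\<in>isolated_marks. degree (G n) (mark (G n) a) = 0"
proof -
  have "\<exists>t. D < copy_count t a" if "a \<in> isolated_marks" for a using that by (simp add: isolated_marks_def)
  then obtain T where T: "\<And>a. a \<in> isolated_marks \<Longrightarrow> D < copy_count (T a) a" by metis
  have fin: "finite isolated_marks" by (simp add: isolated_marks_def)
  have "degree (G n) (mark (G n) a) = 0" if n: "n \<ge> (\<Sum>a\<in>isolated_marks. T a)" and a: "a \<in> isolated_marks" for n a
  proof -
    have ak: "a \<in> {1..k}" using a by (simp add: isolated_marks_def)
    have "T a \<le> n" using n member_le_sum[OF a, of T] fin by simp
    then have e: "degree (G n) (mark (G n) a) = copy_count (T a) a * degree (G (n - T a)) (mark (G (n - T a)) ((parent ^^ T a) a))"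
      using mark_degree_iterate[OF ak, of "n - T a" "T a"] by simp
    show ?thesis
    proof (rule ccontr)
      assume "degree (G n) (mark (G n) a) \<noteq> 0"
      then have "copy_count (T a) a \<le> degree (G n) (mark (G n) a)" using e by simp
      then show False using mark_degree_le[OF ak, of n] T[OF a] by simp
    qed
  qed
  then show ?thesis by blast
qed

text \<open>The largest number of copies ever merged at \<open>a\<close> picks up the factor \<open>card (members H (\<Phi> a))\<close> from
  \<open>parent a\<close> to \<open>a\<close>; it is squared because of the Lipschitz constants in \<open>mult_power_le_square\<close>.
  The value at isolated marks is a default.\<close>

definition mark_weight :: "nat \<Rightarrow> real" where
  "mark_weight a = (if a \<in> isolated_marks then 1 else (Max (range (\<lambda>t. copy_count t a)))\<^sup>2)"

lemma mark_weight_parent: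
  assumes a: "a \<in> {1..k} - isolated_marks"
  shows "parent a \<notin> isolated_marks \<and> mark_weight a = (card (members H (\<Phi> a)))\<^sup>2 * mark_weight (parent a)"
proof -
  let ?q = "card (members H (\<Phi> a))"
  have ak: "a \<in> {1..k}" and le: "copy_count t a \<le> D" for t using a by (auto simp: isolated_marks_def not_less)
  have q: "1 \<le> ?q" by (rule mark_edge(6)[OF ak])
  have le': "copy_count t (parent a) \<le> D" for t
  proof -
    have "1 * copy_count t (parent a) \<le> ?q * copy_count t (parent a)" using q by (rule mult_le_mono1)
    then have "copy_count t (parent a) \<le> copy_count (Suc t) a" by (simp only: copy_count_Suc mult_1)
    then show ?thesis using le[of "Suc t"] by (rule order_trans)
  qed
  then have p: "parent a \<notin> isolated_marks" by (simp add: isolated_marks_def not_less)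
  have fin: "finite (range (\<lambda>t. copy_count t a))" by (rule finite_subset[of _ "{..D}"]) (use le in auto)
  have fin': "finite (range (\<lambda>t. copy_count t (parent a)))" by (rule finite_subset[of _ "{..D}"]) (use le' in auto)
  have "Max (range (\<lambda>t. copy_count t a)) = ?q * Max (range (\<lambda>t. copy_count t (parent a)))"
  proof (rule antisym)
    have "copy_count t a \<le> ?q * Max (range (\<lambda>t. copy_count t (parent a)))" for t
    proof (cases t)
      case 0
      have "copy_count 0 (parent a) \<le> Max (range (\<lambda>t. copy_count t (parent a)))" using fin' by (intro Max_ge) auto
      then have "1 * 1 \<le> ?q * Max (range (\<lambda>t. copy_count t (parent a)))"
        using q by (intro mult_le_mono) (simp_all add: copy_count_def)
      then show ?thesis by (simp add: 0 copy_count_def)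
    next
      case (Suc s)
      then show ?thesis using fin' by (simp add: copy_count_Suc)
    qed
    then show "Max (range (\<lambda>t. copy_count t a)) \<le> ?q * Max (range (\<lambda>t. copy_count t (parent a)))"
      using fin by simp
    obtain t where "Max (range (\<lambda>t. copy_count t (parent a))) = copy_count t (parent a)"
      using Max_in[OF fin'] by auto
    then have "?q * Max (range (\<lambda>t. copy_count t (parent a))) = copy_count (Suc t) a" by (simp add: copy_count_Suc)
    also have "\<dots> \<le> Max (range (\<lambda>t. copy_count t a))" using fin by (intro Max_ge) auto
    finally show "?q * Max (range (\<lambda>t. copy_count t (parent a))) \<le> Max (range (\<lambda>t. copy_count t a))" .
  qed
  then show ?thesis using a p by (simp add: mark_weight_def power_mult_distrib)
qed

lemma mark_weight_ge_1:
  assumes a: "a \<in> {1..k}" shows "1 \<le> mark_weight a"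
proof (cases "a \<in> isolated_marks")
  case True then show ?thesis by (simp add: mark_weight_def)
next
  case False
  then have "copy_count t a \<le> D" for t using a by (auto simp: isolated_marks_def not_less)
  then have "range (\<lambda>t. copy_count t a) \<subseteq> {..D}" by auto
  then have "finite (range (\<lambda>t. copy_count t a))" by (rule finite_subset) simp
  then have "copy_count 0 a \<le> Max (range (\<lambda>t. copy_count t a))" by (intro Max_ge) auto
  then show ?thesis using False by (simp add: mark_weight_def copy_count_def)
qed

lemma mark_paths_long:
  "\<exists>n0. \<forall>n\<ge>n0. \<forall>a\<in>{1..k}. \<forall>b\<in>{1..k}. \<forall>p. a \<noteq> b \<longrightarrow> is_path (G n) (mark (G n) a) p (mark (G n) b) \<longrightarrow> l < length p - 1"
proof -
  have "\<forall>\<^sub>F n in sequentially. enat l < min_mark_dist k (G n)"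
    using mark_dist by (rule order_tendstoD(1)) simp
  then obtain n0 where n0: "\<And>n. n \<ge> n0 \<Longrightarrow> enat l < min_mark_dist k (G n)"
    by (auto simp: eventually_sequentially)
  have "l < length p - 1" if n: "n \<ge> n0" and ab: "a \<in> {1..k}" "b \<in> {1..k}" "a \<noteq> b"
    and p: "is_path (G n) (mark (G n) a) p (mark (G n) b)" for n a b p
  proof -
    have "min_mark_dist k (G n) \<le> graph_dist (G n) (mark (G n) a) (mark (G n) b)"
      unfolding min_mark_dist_def using ab by (intro Inf_lower) blast
    also have "\<dots> \<le> enat (length p - 1)"
      unfolding graph_dist_def using p by (intro Inf_lower) blast
    finally have "enat l < enat (length p - 1)" using n0[OF n] by (rule less_le_trans[rotated])
    then show ?thesis by simp
  qed
  then show ?thesis by blast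
qed

text \<open>The marks \<open>b\<close> that share a copy with \<open>a\<close> in each of the last \<open>t\<close> generations, and whose ancestors were
  connected at some time.\<close>

primrec influencers :: "nat \<Rightarrow> nat \<Rightarrow> nat set" where
  "influencers 0 a = {b \<in> {1..k}. b \<noteq> a \<and> (\<exists>n. linked (G n) (mark (G n) a) (mark (G n) b))}"
| "influencers (Suc t) a = {b \<in> {1..k}. b \<noteq> a \<and> members H (\<Phi> a) \<inter> members H (\<Phi> b) \<noteq> {} \<and>
    parent b \<in> influencers t (parent a)}"

lemma influencersD: "b \<in> influencers t a \<Longrightarrow> b \<in> {1..k} \<and> b \<noteq> a"
  by (cases t) auto

lemma influencers_iterate: "b \<in> influencers t a \<Longrightarrow> (parent ^^ t) b \<in> influencers 0 ((parent ^^ t) a)"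
proof (induction t arbitrary: a b)
  case 0 then show ?case by simp
next
  case (Suc t)
  then have "parent b \<in> influencers t (parent a)" by simp
  from Suc.IH[OF this] show ?case by (simp add: funpow_swap1)
qed

lemma influencers_path:
  assumes "a \<in> {1..k}" "b \<in> influencers t a"
    and "is_path (G n) (mark (G n) ((parent ^^ t) a)) p (mark (G n) ((parent ^^ t) b))"
  shows "\<exists>p'. is_path (G (n + t)) (mark (G (n + t)) a) p' (mark (G (n + t)) b) \<and> length p' = length p"
  using assms
proof (induction t arbitrary: a b)
  case 0 then show ?case by auto
next
  case (Suc t)
  have b: "b \<in> {1..k}" "members H (\<Phi> a) \<inter> members H (\<Phi> b) \<noteq> {}" "parent b \<in> influencers t (parent a)"
    using Suc.prems(2) by auto
  have "\<exists>p'. is_path (G (n + t)) (mark (G (n + t)) (parent a)) p' (mark (G (n + t)) (parent b)) \<and> length p' = length p"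
    using Suc.prems(3) by (intro Suc.IH mark_edge(5) Suc.prems(1) b(3)) (simp add: funpow_swap1)
  then obtain p' where p': "is_path (G (n + t)) (mark (G (n + t)) (parent a)) p' (mark (G (n + t)) (parent b))"
    "length p' = length p" by blast
  from path_recursion[OF G_marked Suc.prems(1) b(1,2) p'(1)] p'(2)
  show ?case by (simp add: G_Suc)
qed

text \<open>If \<open>b\<close> influenced \<open>a\<close> for infinitely many \<open>t\<close>, then one pair of ancestors would occur for infinitely many
  of them. A path joining this pair in some \<open>G n\<close> yields paths of the same length joining \<open>a\<close> and \<open>b\<close> in
  infinitely many \<open>G (n + t)\<close>, against the divergence of the distances.\<close>

lemma influencers_finite_time:
  assumes a: "a \<in> {1..k}" shows "finite {t. b \<in> influencers t a}"
proof (rule ccontr)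
  assume inf: "infinite {t. b \<in> influencers t a}"
  define f where "f t = ((parent ^^ t) a, (parent ^^ t) b)" for t
  obtain t1 where "b \<in> influencers t1 a" using infinite_imp_nonempty[OF inf] by blast
  then have b: "b \<in> {1..k}" "b \<noteq> a" using influencersD by auto
  then have "f ` {t. b \<in> influencers t a} \<subseteq> {1..k} \<times> {1..k}"
    using a iterated_parent unfolding f_def by blast
  then have "finite (f ` {t. b \<in> influencers t a})" by (rule finite_subset) simp
  from pigeonhole_infinite[OF inf this]
  obtain t0 where t0: "b \<in> influencers t0 a" and inf': "infinite {t \<in> {t. b \<in> influencers t a}. f t = f t0}" by auto
  obtain n p where p: "is_path (G n) (mark (G n) ((parent ^^ t0) a)) p (mark (G n) ((parent ^^ t0) b))"
    using influencers_iterate[OF t0] by (auto simp: linked_def)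
  obtain n0 where n0: "\<forall>n\<ge>n0. \<forall>a\<in>{1..k}. \<forall>b\<in>{1..k}. \<forall>p'. a \<noteq> b \<longrightarrow>
      is_path (G n) (mark (G n) a) p' (mark (G n) b) \<longrightarrow> length p < length p' - 1"
    using mark_paths_long[of "length p"] by (elim exE)
  obtain t where t: "t \<ge> n0" "t \<in> {t \<in> {t. b \<in> influencers t a}. f t = f t0}"
    using inf' unfolding infinite_nat_iff_unbounded_le by meson
  then have t': "b \<in> influencers t a" "f t = f t0" by simp_all
  obtain p' where p': "is_path (G (n + t)) (mark (G (n + t)) a) p' (mark (G (n + t)) b)" "length p' = length p"
    using influencers_path[OF a t'(1), of n p] p t'(2) by (auto simp: f_def)
  have "n0 \<le> n + t" using t(1) by simp
  from n0[rule_format, OF this a b(1) b(2)[symmetric] p'(1)] p'(2) show False by simp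
qed

lemma influencers_vanish: "\<exists>N. \<forall>a\<in>{1..k}. influencers N a = {}"
proof -
  have "finite (\<Union>a\<in>{1..k}. \<Union>b\<in>{1..k}. {t. b \<in> influencers t a})"
    using influencers_finite_time by blast
  then obtain N where N: "\<And>t. t \<in> (\<Union>a\<in>{1..k}. \<Union>b\<in>{1..k}. {t. b \<in> influencers t a}) \<Longrightarrow> t < N"
    unfolding finite_nat_set_iff_bounded by blast
  have "influencers N a = {}" if "a \<in> {1..k}" for a
  proof (rule ccontr)
    assume "influencers N a \<noteq> {}"
    then obtain b where "b \<in> influencers N a" by blast
    then have "N < N" using influencersD[of b N a] that by (intro N) blast
    then show False by simp
  qed
  then show ?thesis by blast
qed

lemma marks_eventually_nonadjacent:
  "\<exists>n0. \<forall>n\<ge>n0. \<forall>a\<in>{1..k}. \<forall>b\<in>{1..k}. \<not> adjacent (G n) (mark (G n) a) (mark (G n) b)"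
proof -
  obtain n0 where n0: "\<And>n a b p. n \<ge> n0 \<Longrightarrow> a \<in> {1..k} \<Longrightarrow> b \<in> {1..k} \<Longrightarrow> a \<noteq> b \<Longrightarrow>
      is_path (G n) (mark (G n) a) p (mark (G n) b) \<Longrightarrow> 1 < length p - 1"
    using mark_paths_long[of 1] by blast
  have "\<not> adjacent (G n) (mark (G n) a) (mark (G n) b)" if n: "n \<ge> n0" and ab: "a \<in> {1..k}" "b \<in> {1..k}" for n a b
  proof
    assume adj: "adjacent (G n) (mark (G n) a) (mark (G n) b)"
    then have ne: "mark (G n) a \<noteq> mark (G n) b" and v: "mark (G n) a \<in> verts (G n)" "mark (G n) b \<in> verts (G n)"
      using marked_graphsD(4)[OF G_marked] by blast+
    have "is_path (G n) (mark (G n) a) [mark (G n) a, mark (G n) b] (mark (G n) b)"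
      using adj ne v by (simp add: is_path_def)
    from n0[OF n ab _ this] ne show False by auto
  qed
  then show ?thesis by blast
qed

end

lemma cond_poly_of_real: "cond_poly k G X (of_real x :: complex) = of_real (cond_poly k G X x)"
  by (simp add: cond_poly_def)

text \<open>Positivity is due to the empty set, which is admissible as no two marks are adjacent.\<close>

lemma antitone_weights_cond_poly:
  fixes k m :: nat and H :: "'h labeled_hypergraph" and G :: "'v marked_graph" and x :: real
  assumes gl: "gluing k m H \<Phi>" and G: "G \<in> marked_graphs k" and x: "0 \<le> x"
    and sep: "\<And>a b. a \<in> {1..k} \<Longrightarrow> b \<in> {1..k} \<Longrightarrow> \<not> adjacent G (mark G a) (mark G b)"
  shows "gluing.antitone_weights k 0 (\<lambda>X. cond_poly k G X x)"
proof -
  note fin = finite_cond_sets[OF marked_graphsD(1)[OF G]]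
  have pos: "0 < cond_poly k G X x" if X: "X \<subseteq> {1..k}" for X
  proof -
    have "{} \<in> cond_sets k G X"
      using X sep marked_graphsD(3)[OF G] by (auto simp: cond_sets_def independent_set_def subset_iff)
    then have "(\<Sum>I\<in>{{} :: 'v set}. x ^ card I) \<le> cond_poly k G X x"
      unfolding cond_poly_def using fin x by (intro sum_mono2) auto
    then show ?thesis by simp
  qed
  moreover have "cond_poly k G (insert a X) x \<le> cond_poly k G X x" for a X
    unfolding cond_poly_def using fin x by (intro sum_mono2 cond_sets_antimono) auto
  ultimately show ?thesis unfolding gluing.antitone_weights_def[OF gl] by (auto intro: less_imp_le)
qed

lemma indep_poly_nonneg_real_nonzero:
  fixes G :: "'v marked_graph" and x :: real
  assumes G: "G \<in> marked_graphs k" and x: "0 \<le> x"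
  shows "indep_poly G (of_real x) \<noteq> 0"
proof -
  have fin: "finite {I. independent_set G I}"
    by (rule finite_subset[of _ "Pow (verts G)"])
      (use marked_graphsD(1)[OF G] in \<open>auto simp: independent_set_def\<close>)
  have "(\<Sum>I\<in>{{} :: 'v set}. x ^ card I) \<le> (\<Sum>I | independent_set G I. x ^ card I)"
    using fin x by (intro sum_mono2) (auto simp: independent_set_def)
  then have "0 < (\<Sum>I | independent_set G I. x ^ card I)" by simp
  moreover have "indep_poly G (of_real x) = of_real (\<Sum>I | independent_set G I. x ^ card I)"
    by (simp add: indep_poly_def)
  ultimately show ?thesis by (simp del: of_real_sum)
qed

context graph_sequence
begin

text \<open>The recursion is started at a time \<open>s\<close> after which no two marks are adjacent and the degrees of the
  isolated marks vanish. The graphs before \<open>G (s + n3)\<close> have positive values at \<open>x\<close>, hence no zeros near \<open>x\<close>.\<close>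

theorem indep_poly_eventually_nonzero:
  assumes x: "0 \<le> x"
  shows "\<forall>\<^sub>F z in nhds (of_real x). \<forall>n. indep_poly (G n) z \<noteq> 0"
proof -
  obtain n1 where n1: "\<And>n a. n \<ge> n1 \<Longrightarrow> a \<in> isolated_marks \<Longrightarrow> degree (G n) (mark (G n) a) = 0"
    using isolated_marks_eventually by blast
  obtain n2 where n2: "\<And>n a b. n \<ge> n2 \<Longrightarrow> a \<in> {1..k} \<Longrightarrow> b \<in> {1..k} \<Longrightarrow>
      \<not> adjacent (G n) (mark (G n) a) (mark (G n) b)"
    using marks_eventually_nonadjacent by blast
  obtain N where N: "\<And>a. a \<in> {1..k} \<Longrightarrow> influencers N a = {}" using influencers_vanish by blast
  define s where "s = max n1 n2"
  interpret hc: hard_core_recursion k m H \<Phi> "\<lambda>n z X. cond_poly k (G (s + n)) X z"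
    "\<lambda>n x X. cond_poly k (G (s + n)) X x" influencers N isolated_marks mark_weight
  proof
    fix n z Y assume "Y \<subseteq> {1..k}"
    then show "cond_poly k (G (s + Suc n)) Y z = transfer z (\<lambda>X. cond_poly k (G (s + n)) X z) Y"
      using cond_poly_recursion[OF G_marked] by (simp add: G_Suc)
  next
    fix n X show "continuous_on UNIV (\<lambda>z :: complex. cond_poly k (G (s + n)) X z)"
      unfolding cond_poly_def by (intro continuous_intros)
  next
    fix n and x :: real assume "0 \<le> x"
    then show "antitone_weights 0 (\<lambda>X. cond_poly k (G (s + n)) X x)"
      using gluing_axioms G_marked n2[of "s + n"] by (intro antitone_weights_cond_poly) (auto simp: s_def)
  next
    fix t a b
    assume "a \<in> {1..k}" "b \<in> {1..k}" "b \<noteq> a" "members H (\<Phi> a) \<inter> members H (\<Phi> b) \<noteq> {}" "parent b \<in> influencers t (parent a)"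
    then show "b \<in> influencers (Suc t) a" by simp
  next
    fix n and z :: complex and a b X
    assume ab: "a \<in> {1..k}" "b \<in> {1..k}" "b \<noteq> a" "b \<notin> influencers 0 a"
    then have "\<not> linked (G (s + n)) (mark (G (s + n)) a) (mark (G (s + n)) b)" by auto
    then show "cond_poly k (G (s + n)) X z * cond_poly k (G (s + n)) (insert a (insert b X)) z =
        cond_poly k (G (s + n)) (insert a X) z * cond_poly k (G (s + n)) (insert b X) z"
      using ab by (intro cond_poly_separated G_marked)
  next
    fix n and z :: complex and a X assume a: "a \<in> isolated_marks"
    then have "degree (G (s + n)) (mark (G (s + n)) a) = 0" using n1 by (simp add: s_def)
    then show "cond_poly k (G (s + n)) (insert a X) z = cond_poly k (G (s + n)) X z"
      using cond_sets_isolated[OF G_marked] a by (simp add: cond_poly_def isolated_marks_def)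
  qed (use N mark_weight_parent mark_weight_ge_1 cond_poly_of_real in auto)
  obtain n3 where "\<forall>\<^sub>F z in nhds (complex_of_real x). \<forall>n\<ge>n3. (\<Sum>X\<in>Pow {1..k}. z ^ card X * cond_poly k (G (s + n)) X z) \<noteq> 0"
    using hc.eventually_nonzero[OF x] by blast
  then have late: "\<forall>\<^sub>F z in nhds (complex_of_real x). \<forall>n\<ge>n3. indep_poly (G (s + n)) z \<noteq> 0"
    by (simp only: indep_poly_eq_sum_cond_poly[OF G_marked, symmetric])
  have "\<forall>\<^sub>F z in nhds (of_real x). indep_poly (G n) z \<noteq> 0" for n
  proof (rule tendsto_imp_eventually_ne)
    have "continuous_on UNIV (\<lambda>z. indep_poly (G n) z)"
      unfolding indep_poly_def by (intro continuous_intros)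
    then show "((\<lambda>z. indep_poly (G n) z) \<longlongrightarrow> indep_poly (G n) (of_real x)) (nhds (of_real x))"
      using tendsto_at_iff_tendsto_nhds[of "\<lambda>z. indep_poly (G n) z" "of_real x"]
      by (simp add: continuous_on_eq_continuous_at isCont_def)
  qed (rule indep_poly_nonneg_real_nonzero[OF G_marked x])
  then have "\<forall>\<^sub>F z in nhds (of_real x). \<forall>n\<in>{..<s + n3}. indep_poly (G n) z \<noteq> 0"
    by (intro eventually_ball_finite) auto
  with late show ?thesis
  proof eventually_elim
    case (elim z)
    show ?case
    proof
      fix n
      show "indep_poly (G n) z \<noteq> 0"
      proof (cases "n < s + n3")
        case True then show ?thesis using elim(2) by simp
      next
        case False
        then have "indep_poly (G (s + (n - s))) z \<noteq> 0" using elim(1) by (intro elim(1)[rule_format]) simp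
        then show ?thesis using False by simp
      qed
    qed
  qed
qed

end

theorem theorem1p1:
  fixes k m :: nat
    and H :: "'h labeled_hypergraph" and \<Phi> :: "nat \<Rightarrow> 'h"
    and G :: "nat \<Rightarrow> ('v, 'h) vertex marked_graph"
  assumes "k \<ge> 1" and "m \<ge> 2"
    and "gluing_data k m H \<Phi>"
    and "G 0 \<in> marked_graphs k"
    and "\<And>n. G (Suc n) = recursion k m H \<Phi> (G n)"
    and "\<exists>D. \<forall>n. max_degree (G n) \<le> D"
    and "(\<lambda>n. min_mark_dist k (G n)) \<longlonglongrightarrow> \<infinity>"
  shows "\<exists>U :: complex set. open U \<and> complex_of_real ` {0..} \<subseteq> U \<and>
    (\<forall>n. \<forall>z\<in>U. indep_poly (G n) z \<noteq> 0)"
proof -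
  obtain D where D: "\<And>n. max_degree (G n) \<le> D" using assms(6) by blast
  interpret graph_sequence k m H \<Phi> G D
    by unfold_locales (use assms(3,4,5,7) D in auto)
  have "\<exists>S. open S \<and> of_real x \<in> S \<and> (\<forall>z\<in>S. \<forall>n. indep_poly (G n) z \<noteq> 0)" if "0 \<le> x" for x :: real
    using indep_poly_eventually_nonzero[OF that] by (simp add: eventually_nhds)
  then obtain S where S: "\<And>x :: real. 0 \<le> x \<Longrightarrow> open (S x) \<and> of_real x \<in> S x \<and> (\<forall>z\<in>S x. \<forall>n. indep_poly (G n) z \<noteq> 0)"
    by metis
  show ?thesis
  proof (intro exI[of _ "\<Union>x\<in>{0..}. S x"] conjI)
    show "open (\<Union>x\<in>{0..}. S x)" using S by (intro open_UN) simp
    show "complex_of_real ` {0..} \<subseteq> (\<Union>x\<in>{0..}. S x)"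
    proof
      fix z assume "z \<in> complex_of_real ` {0..}"
      then obtain x where "0 \<le> x" "z = complex_of_real x" by auto
      then show "z \<in> (\<Union>x\<in>{0..}. S x)" using S[of x] by (intro UN_I[of x]) simp_all
    qed
    show "\<forall>n. \<forall>z\<in>\<Union>x\<in>{0..}. S x. indep_poly (G n) z \<noteq> 0"
      using S by simp
  qed
qed

end
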